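(* Let $\ell>0$, $\mathcal I=[0,\ell]$, and let $\mathsf P:\mathcal B(\mathbb R)\to\mathcal L(L^2(\mathcal I))$ be the momentum POVM of a particle confined to $\mathcal I$. Then $$\mathsf P[n]=\tilde{\mathsf P}[n]=P_0^n\qquad\text{for all }n=1,2,\ldots.$$
   Context: Inner products are linear in the second argument. $\mathcal B(\mathbb R)$ is the Borel $\sigma$-algebra and $\mathcal L(\cdot)$ denotes bounded operators. Momentum POVM: Let $\mathcal F:L^2(\mathbb R)\to L^2(\mathbb R)$ be the unitary Fourier–Plancherel operator, $(\mathcal F\psi)(x)=\frac1{\sqrt{2\pi}}\int_{\mathbb R}e^{-ixt}\psi(t)\,dt$ for $\psi\in L^1(\mathbb R)\cap L^2(\mathbb R)$. Let $(\mathsf Q_{\mathbb R}(Y)\psi)(x)=\chi_Y(x)\psi(x)$ and $\mathsf P_{\mathbb R}(Y)=\mathcal F^*\mathsf Q_{\mathbb R}(Y)\mathcal F$ for $Y\in\mathcal B(\mathbb R)$. Let $U:L^2(\mathcal I)\to L^2(\mathbb R)$ be the isometry extending functions by $0$ outside $\mathcal I$. Then $\mathsf P(Y):=U^*\mathsf P_{\mathbb R}(Y)U$, $Y\in\mathcal B(\mathbb R)$. It is a normalized POVM (strongly $\sigma$-additive, positive operator valued, $\mathsf P(\mathbb R)=I$). $\mathsf P_{\psi,\varphi}$ denotes the complex measure $Y\mapsto\langle\psi|\mathsf P(Y)\varphi\rangle$; it has density $x\mapsto\overline{(\mathcal FU\psi)(x)}(\mathcal FU\varphi)(x)$. Moment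 operators: $\tilde{\mathsf P}[n]$ has domain $\{\varphi\in L^2(\mathcal I):\int x^{2n}\,d\mathsf P_{\varphi,\varphi}(x)<\infty\}$; $\mathsf P[n]$ has domain $\{\varphi\in L^2(\mathcal I):\int|x|^n\,d|\mathsf P_{\psi,\varphi}|(x)<\infty\text{ for all }\psi\in L^2(\mathcal I)\}$; on their respective domains both operators $A$ are determined by $\langle\psi|A\varphi\rangle=\int x^n\,d\mathsf P_{\psi,\varphi}(x)$ for all $\psi\in L^2(\mathcal I)$. $P_0$ is the operator $-i\,d/dx$ in $L^2(\mathcal I)$ whose domain is the set of absolutely continuous $\varphi\in L^2(\mathcal I)$ with $\varphi'\in L^2(\mathcal I)$ and $\varphi(0)=\varphi(\ell)=0$; $P_0^n$ is its $n$-fold composition with natural domain. Equality of operators includes equality of domains. *)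

theory Defs
  imports "HOL-Analysis.Analysis"
begin

section \<open>The Hilbert space of square integrable functions\<close>

text \<open>
  Elements of \<open>L2 M\<close> are classes of functions modulo equality almost everywhere. The measures used
  below are restrictions of \<^const>\<open>lborel\<close>; Borel representatives lose nothing, since every Lebesgue
  measurable function is almost everywhere equal to a Borel one.
\<close>

definition sq_integrable :: "'a measure \<Rightarrow> ('a \<Rightarrow> complex) set" where
  "sq_integrable M = {f \<in> borel_measurable M. integrable M (\<lambda>x. (cmod (f x))\<^sup>2)}"

definition ae_rel :: "'a measure \<Rightarrow> (('a \<Rightarrow> complex) \<times> ('a \<Rightarrow> complex)) set" where
  "ae_rel M = {(f, g). f \<in> sq_integrable M \<and> g \<in> sq_integrable M \<and> (AE x in M. f x = g x)}"

definition L2 :: "'a measure \<Rightarrow> ('a \<Rightarrow> complex) set set" where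
  "L2 M = sq_integrable M // ae_rel M"

definition cls :: "'a measure \<Rightarrow> ('a \<Rightarrow> complex) \<Rightarrow> ('a \<Rightarrow> complex) set" where
  "cls M f = ae_rel M `` {f}"

definition rep :: "('a \<Rightarrow> complex) set \<Rightarrow> 'a \<Rightarrow> complex" where
  "rep \<phi> = (SOME f. f \<in> \<phi>)"

definition inner_L2 ::
    "'a measure \<Rightarrow> ('a \<Rightarrow> complex) set \<Rightarrow> ('a \<Rightarrow> complex) set \<Rightarrow> complex" where
  "inner_L2 M \<psi> \<phi> = (LINT x|M. cnj (rep \<psi> x) * rep \<phi> x)"

definition adjoint_L2 ::
    "'a measure \<Rightarrow> 'b measure \<Rightarrow> (('a \<Rightarrow> complex) set \<Rightarrow> ('b \<Rightarrow> complex) set)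
      \<Rightarrow> ('b \<Rightarrow> complex) set \<Rightarrow> ('a \<Rightarrow> complex) set" where
  "adjoint_L2 M N T \<phi> =
    (THE \<eta>. \<eta> \<in> L2 M \<and> (\<forall>\<psi>\<in>L2 M. inner_L2 M \<psi> \<eta> = inner_L2 N (T \<psi>) \<phi>))"

text \<open>Linearity is not listed: a surjection preserving the inner product is automatically linear.\<close>

definition unitary_L2 ::
    "'a measure \<Rightarrow> 'b measure \<Rightarrow> (('a \<Rightarrow> complex) set \<Rightarrow> ('b \<Rightarrow> complex) set) \<Rightarrow> bool" where
  "unitary_L2 M N T \<longleftrightarrow> bij_betw T (L2 M) (L2 N) \<and>
    (\<forall>\<psi>\<in>L2 M. \<forall>\<phi>\<in>L2 M. inner_L2 N (T \<psi>) (T \<phi>) = inner_L2 M \<psi> \<phi>)"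


section \<open>Complex measures on the Borel sets of the real line\<close>

text \<open>
  A complex measure is a set function \<open>\<mu> :: real set \<Rightarrow> complex\<close>, of which only the values on Borel
  sets matter. For a countably additive \<open>\<mu>\<close> the set functions passed to \<^const>\<open>measure_of\<close> below are
  countably additive, so that \<^const>\<open>measure_of\<close> does not degenerate to the zero measure.
\<close>

definition total_variation :: "(real set \<Rightarrow> complex) \<Rightarrow> real measure" where
  "total_variation \<mu> = measure_of UNIV (sets borel)
    (\<lambda>A. SUP B \<in> {B :: nat \<Rightarrow> real set.
                    range B \<subseteq> sets borel \<and> disjoint_family B \<and> (\<Union>i. B i) = A}.
           \<Sum>i. ennreal (cmod (\<mu> (B i))))"

text \<open>The positive part \<open>\<nu>\<^sup>+\<close> of the Jordan decomposition of a signed measure.\<close>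

definition pos_part :: "(real set \<Rightarrow> real) \<Rightarrow> real measure" where
  "pos_part \<nu> = measure_of UNIV (sets borel)
    (\<lambda>A. SUP B \<in> {B \<in> sets borel. B \<subseteq> A}. ennreal (\<nu> B))"

definition signed_integral :: "(real set \<Rightarrow> real) \<Rightarrow> (real \<Rightarrow> real) \<Rightarrow> real" where
  "signed_integral \<nu> f = (LINT x|pos_part \<nu>. f x) - (LINT x|pos_part (\<lambda>B. - \<nu> B). f x)"

definition complex_measure_integral :: "(real set \<Rightarrow> complex) \<Rightarrow> (real \<Rightarrow> real) \<Rightarrow> complex" where
  "complex_measure_integral \<mu> f =
    Complex (signed_integral (\<lambda>B. Re (\<mu> B)) f) (signed_integral (\<lambda>B. Im (\<mu> B)) f)"

text \<open>The measure given by a countably additive set function whose values are nonnegative reals.\<close>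

definition positive_measure :: "(real set \<Rightarrow> complex) \<Rightarrow> real measure" where
  "positive_measure \<mu> = measure_of UNIV (sets borel) (\<lambda>A. ennreal (Re (\<mu> A)))"


section \<open>Moment operators of an operator valued measure\<close>

text \<open>
  Unbounded operators are partial maps. Hence \<^const>\<open>dom\<close> is the domain of an operator, equality
  includes equality of domains, and \<open>\<circ>\<^sub>m\<close> is composition with the natural domain.
\<close>

definition op_power ::
    "'a measure \<Rightarrow> (('a \<Rightarrow> complex) set \<rightharpoonup> ('a \<Rightarrow> complex) set) \<Rightarrow> nat
      \<Rightarrow> (('a \<Rightarrow> complex) set \<rightharpoonup> ('a \<Rightarrow> complex) set)" where
  "op_power M A n = ((\<lambda>B. A \<circ>\<^sub>m B) ^^ n) (Some |` L2 M)"

definition matrix_measure ::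
    "'a measure \<Rightarrow> (real set \<Rightarrow> ('a \<Rightarrow> complex) set \<Rightarrow> ('a \<Rightarrow> complex) set)
      \<Rightarrow> ('a \<Rightarrow> complex) set \<Rightarrow> ('a \<Rightarrow> complex) set \<Rightarrow> real set \<Rightarrow> complex" where
  "matrix_measure M E \<psi> \<phi> = (\<lambda>Y. inner_L2 M \<psi> (E Y \<phi>))"

definition moment_vector ::
    "'a measure \<Rightarrow> (real set \<Rightarrow> ('a \<Rightarrow> complex) set \<Rightarrow> ('a \<Rightarrow> complex) set) \<Rightarrow> nat
      \<Rightarrow> ('a \<Rightarrow> complex) set \<Rightarrow> ('a \<Rightarrow> complex) set" where
  "moment_vector M E n \<phi> = (THE \<eta>. \<eta> \<in> L2 M \<and>
    (\<forall>\<psi>\<in>L2 M. inner_L2 M \<psi> \<eta> =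
      complex_measure_integral (matrix_measure M E \<psi> \<phi>) (\<lambda>x. x ^ n)))"

definition moment_op ::
    "'a measure \<Rightarrow> (real set \<Rightarrow> ('a \<Rightarrow> complex) set \<Rightarrow> ('a \<Rightarrow> complex) set) \<Rightarrow> nat
      \<Rightarrow> (('a \<Rightarrow> complex) set \<rightharpoonup> ('a \<Rightarrow> complex) set)" where
  "moment_op M E n \<phi> =
    (if \<phi> \<in> L2 M \<and>
        (\<forall>\<psi>\<in>L2 M. (\<integral>\<^sup>+ x. ennreal (\<bar>x\<bar> ^ n) \<partial>total_variation (matrix_measure M E \<psi> \<phi>)) < \<infinity>)
     then Some (moment_vector M E n \<phi>) else None)"

definition moment_op_tilde ::
    "'a measure \<Rightarrow> (real set \<Rightarrow> ('a \<Rightarrow> complex) set \<Rightarrow> ('a \<Rightarrow> complex) set) \<Rightarrow> nat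
      \<Rightarrow> (('a \<Rightarrow> complex) set \<rightharpoonup> ('a \<Rightarrow> complex) set)" where
  "moment_op_tilde M E n \<phi> =
    (if \<phi> \<in> L2 M \<and>
        (\<integral>\<^sup>+ x. ennreal (x ^ (2 * n)) \<partial>positive_measure (matrix_measure M E \<phi> \<phi>)) < \<infinity>
     then Some (moment_vector M E n \<phi>) else None)"


section \<open>The momentum observable of a particle confined to an interval\<close>

text \<open>
  Plancherel's theorem provides such an operator; it is unique on \<open>L2 lborel\<close>, since the square
  integrable functions that are also integrable are dense there.
\<close>

definition fourier_plancherel :: "(real \<Rightarrow> complex) set \<Rightarrow> (real \<Rightarrow> complex) set" where
  "fourier_plancherel = (SOME F. unitary_L2 lborel lborel F \<and>
    (\<forall>f \<in> sq_integrable lborel. integrable lborel f \<longrightarrow>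
      F (cls lborel f) = cls lborel (\<lambda>x. complex_of_real (1 / sqrt (2 * pi)) *
        (LINT t|lborel. exp (- \<i> * complex_of_real (x * t)) * f t))))"

definition position_line :: "real set \<Rightarrow> (real \<Rightarrow> complex) set \<Rightarrow> (real \<Rightarrow> complex) set" where
  "position_line Y \<psi> = cls lborel (\<lambda>x. indicator Y x * rep \<psi> x)"

definition momentum_line :: "real set \<Rightarrow> (real \<Rightarrow> complex) set \<Rightarrow> (real \<Rightarrow> complex) set" where
  "momentum_line Y = adjoint_L2 lborel lborel fourier_plancherel \<circ> position_line Y \<circ> fourier_plancherel"

definition interval_measure_space :: "real \<Rightarrow> real measure" where
  "interval_measure_space l = restrict_space lborel {0..l}"

definition extend_zero :: "real \<Rightarrow> (real \<Rightarrow> complex) set \<Rightarrow> (real \<Rightarrow> complex) set" where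
  "extend_zero l \<phi> = cls lborel (\<lambda>x. indicator {0..l} x * rep \<phi> x)"

definition momentum_povm ::
    "real \<Rightarrow> real set \<Rightarrow> (real \<Rightarrow> complex) set \<Rightarrow> (real \<Rightarrow> complex) set" where
  "momentum_povm l Y =
    adjoint_L2 (interval_measure_space l) lborel (extend_zero l) \<circ> momentum_line Y \<circ> extend_zero l"

definition abs_continuous_on :: "real set \<Rightarrow> (real \<Rightarrow> 'a::metric_space) \<Rightarrow> bool" where
  "abs_continuous_on S f \<longleftrightarrow>
    (\<forall>e>0. \<exists>d>0. \<forall>(m::nat) a b.
      (\<forall>i<m. a i \<le> b i \<and> {a i..b i} \<subseteq> S) \<longrightarrow>
      disjoint_family_on (\<lambda>i. {a i<..<b i}) {..<m} \<longrightarrow>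
      (\<Sum>i<m. b i - a i) < d \<longrightarrow>
      (\<Sum>i<m. dist (f (a i)) (f (b i))) < e)"

text \<open>
  \<open>has_dirichlet_derivative l \<phi> g\<close>: the class \<open>\<phi>\<close> has an absolutely continuous representative which
  vanishes at both endpoints and whose almost everywhere derivative is the square integrable \<open>g\<close>.
\<close>

definition has_dirichlet_derivative ::
    "real \<Rightarrow> (real \<Rightarrow> complex) set \<Rightarrow> (real \<Rightarrow> complex) \<Rightarrow> bool" where
  "has_dirichlet_derivative l \<phi> g \<longleftrightarrow>
    \<phi> \<in> L2 (interval_measure_space l) \<and> g \<in> sq_integrable (interval_measure_space l) \<and>
    (\<exists>f\<in>\<phi>. abs_continuous_on {0..l} f \<and> f 0 = 0 \<and> f l = 0 \<and>
      (AE x in interval_measure_space l. (f has_vector_derivative g x) (at x within {0..l})))"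

definition P0 :: "real \<Rightarrow> ((real \<Rightarrow> complex) set \<rightharpoonup> (real \<Rightarrow> complex) set)" where
  "P0 l \<phi> =
    (if \<exists>g. has_dirichlet_derivative l \<phi> g
     then Some (cls (interval_measure_space l) (\<lambda>x. - \<i> * (SOME g. has_dirichlet_derivative l \<phi> g) x))
     else None)"

end

theory Submission
  imports Defs "HOL-Probability.Characteristic_Functions" "HOL-Probability.Sinc_Integral"
begin

text \<open>
  Write \<open>hat l \<phi>\<close> for the Fourier transform of \<open>\<phi>\<close> extended by zero to the line; it is a continuous square
  integrable function. The complex measure of the momentum observable in the states \<open>\<psi>\<close>, \<open>\<phi>\<close> has the density
  \<open>cnj (hat l \<psi>) * hat l \<phi>\<close> (\<open>matrix_measure_momentum\<close>), and the total variation, the Jordan decomposition and the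
  integral of a measure with a density are expressed by the density (\<open>total_variation_density\<close>,
  \<open>complex_measure_integral_density\<close>). All three operators can therefore be compared through multiplication by
  \<open>x ^ n\<close> on the Fourier side: each of them turns out to have the domain \<open>{\<phi>. x ^ n * hat l \<phi> \<in> L\<^sup>2}\<close>, and to send
  \<open>\<phi>\<close> to the vector with the transform \<open>x ^ n * hat l \<phi>\<close>.

  For the operator defined by the moments of \<open>P\<^sub>\<phi>\<^sub>\<phi>\<close> this domain is the definition. For \<open>P\<^sub>0\<close> it has two halves.
  Integration by parts for absolutely continuous functions has no boundary terms, because the functions in the
  domain vanish at both endpoints (\<open>fourier_dirichlet_derivative\<close>). Conversely, if \<open>x * hat l \<phi>\<close> is square
  integrable then \<open>hat l \<phi>\<close> is integrable, so by Fourier inversion the extension of \<open>\<phi>\<close> by zero has a continuous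
  version on the whole line; this version vanishes off the interval, hence at the endpoints, and it is the
  indefinite integral of a square integrable function (\<open>first_moment_imp_dirichlet_derivative\<close>). That the boundary
  condition comes for free is the reason why \<open>P\<^sub>0\<close>, and none of its extensions, appears. Iteration settles \<open>P\<^sub>0\<^sup>n\<close>
  (\<open>op_power_P0\<close>).

  The remaining inclusion starts from the weak condition that \<open>x ^ n * cnj (hat l \<psi>) * hat l \<phi>\<close> is integrable for
  every \<open>\<psi>\<close>. For \<open>n = 1\<close> it bounds the difference quotients of \<open>\<phi>\<close> weakly in \<open>L\<^sup>2\<close> of the interval, since the
  multiplier \<open>(exp (\<i> x h) - 1) / h\<close> has modulus at most \<open>\<bar>x\<bar>\<close>; uniform boundedness makes them bounded in norm, and letting
  \<open>h\<close> tend to zero shows that \<open>x * hat l \<phi>\<close> is square integrable (\<open>weak_first_moment_imp_strong\<close>). An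
  induction applies this to \<open>P\<^sub>0\<^sup>n \<phi>\<close> (\<open>weak_moment_imp_strong\<close>).

  The analytic tools are developed along the way: completeness of \<open>L\<^sup>2\<close> and uniform boundedness, Plancherel's
  theorem (by Gaussian regularisation), the fundamental theorem of calculus for absolutely continuous functions,
  and Lebesgue's differentiation theorem on the line.
\<close>

section \<open>Square integrable functions\<close>

definition l2norm :: "'a measure \<Rightarrow> ('a \<Rightarrow> complex) \<Rightarrow> real" where
  "l2norm M f = sqrt (LINT x|M. (cmod (f x))\<^sup>2)"

definition l2ip :: "'a measure \<Rightarrow> ('a \<Rightarrow> complex) \<Rightarrow> ('a \<Rightarrow> complex) \<Rightarrow> complex" where
  "l2ip M f g = (LINT x|M. cnj (f x) * g x)"

lemma borel_measurable_cnj [measurable]: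
  "f \<in> borel_measurable M \<Longrightarrow> (\<lambda>x. cnj (f x)) \<in> borel_measurable M"
  by (rule measurable_compose[of f _ borel])
     (auto intro!: borel_measurable_continuous_onI continuous_intros)

lemma sq_integrable_measurable: "f \<in> sq_integrable M \<Longrightarrow> f \<in> borel_measurable M"
  by (simp add: sq_integrable_def)

lemma sq_integrable_integrable: "f \<in> sq_integrable M \<Longrightarrow> integrable M (\<lambda>x. (cmod (f x))\<^sup>2)"
  by (simp add: sq_integrable_def)

lemma sq_integrable_cong_AE:
  assumes "f \<in> sq_integrable M" "g \<in> borel_measurable M" "AE x in M. f x = g x"
  shows "g \<in> sq_integrable M"
proof -
  have [measurable]: "f \<in> borel_measurable M" "g \<in> borel_measurable M"
    using assms by (simp_all add: sq_integrable_measurable)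
  have "integrable M (\<lambda>x. (cmod (f x))\<^sup>2) \<longleftrightarrow> integrable M (\<lambda>x. (cmod (g x))\<^sup>2)"
    by (rule integrable_cong_AE) (use assms(3) in auto)
  then show ?thesis
    using assms by (simp add: sq_integrable_def)
qed

lemma sq_integrable_bound:
  assumes "f \<in> sq_integrable M" "g \<in> borel_measurable M" "\<And>x. x \<in> space M \<Longrightarrow> cmod (g x) \<le> cmod (f x)"
  shows "g \<in> sq_integrable M"
proof -
  have [measurable]: "g \<in> borel_measurable M" by fact
  have "integrable M (\<lambda>x. (cmod (g x))\<^sup>2)"
    by (rule Bochner_Integration.integrable_bound[OF sq_integrable_integrable[OF assms(1)]])
       (use assms(3) in \<open>auto intro!: AE_I2 power_mono\<close>)
  then show ?thesis using assms(2) by (simp add: sq_integrable_def)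
qed

lemma sq_integrable_iff_nn:
  "f \<in> sq_integrable M \<longleftrightarrow>
     f \<in> borel_measurable M \<and> (\<integral>\<^sup>+x. ennreal ((cmod (f x))\<^sup>2) \<partial>M) < \<infinity>"
  by (auto simp: sq_integrable_def integrable_iff_bounded)

lemma sq_integrable_zero [simp]: "(\<lambda>x. 0) \<in> sq_integrable M"
  by (simp add: sq_integrable_def)

lemma sq_integrable_cmult:
  assumes "f \<in> sq_integrable M" shows "(\<lambda>x. c * f x) \<in> sq_integrable M"
  using assms by (auto simp: sq_integrable_def norm_mult power_mult_distrib)

lemma sq_integrable_cnj:
  assumes "f \<in> sq_integrable M" shows "(\<lambda>x. cnj (f x)) \<in> sq_integrable M"
  using assms by (auto simp: sq_integrable_def)

lemma sq_integrable_indicator: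
  assumes f: "f \<in> sq_integrable M" and A [measurable]: "A \<in> sets M"
  shows "(\<lambda>x. indicator A x * f x) \<in> sq_integrable M"
proof (rule sq_integrable_bound[OF f])
  have [measurable]: "f \<in> borel_measurable M" using f by (rule sq_integrable_measurable)
  show "(\<lambda>x. indicator A x * f x) \<in> borel_measurable M" by measurable
qed (auto simp: indicator_def)

lemma sq_integrable_add:
  assumes f: "f \<in> sq_integrable M" and g: "g \<in> sq_integrable M"
  shows "(\<lambda>x. f x + g x) \<in> sq_integrable M"
proof -
  have [measurable]: "f \<in> borel_measurable M" "g \<in> borel_measurable M"
    using f g by (simp_all add: sq_integrable_measurable)
  have "integrable M (\<lambda>x. (cmod (f x + g x))\<^sup>2)"
  proof (rule Bochner_Integration.integrable_bound)
    show "integrable M (\<lambda>x. 2 * (cmod (f x))\<^sup>2 + 2 * (cmod (g x))\<^sup>2)"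
      using f g by (simp add: sq_integrable_integrable)
    have "(cmod (f x + g x))\<^sup>2 \<le> 2 * (cmod (f x))\<^sup>2 + 2 * (cmod (g x))\<^sup>2" for x
    proof -
      have "(cmod (f x + g x))\<^sup>2 \<le> (cmod (f x) + cmod (g x))\<^sup>2"
        by (intro power_mono norm_triangle_ineq) simp
      also have "\<dots> \<le> 2 * (cmod (f x))\<^sup>2 + 2 * (cmod (g x))\<^sup>2"
        using sum_squares_bound[of "cmod (f x)" "cmod (g x)"] by (simp add: power2_sum)
      finally show ?thesis .
    qed
    then show "AE x in M. norm ((cmod (f x + g x))\<^sup>2) \<le> norm (2 * (cmod (f x))\<^sup>2 + 2 * (cmod (g x))\<^sup>2)"
      by (intro AE_I2) simp
  qed simp
  then show ?thesis by (simp add: sq_integrable_def)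
qed

lemma sq_integrable_diff:
  assumes f: "f \<in> sq_integrable M" and g: "g \<in> sq_integrable M"
  shows "(\<lambda>x. f x - g x) \<in> sq_integrable M"
  using sq_integrable_add[OF f sq_integrable_cmult[OF g, of "-1"]] by simp

lemma integrable_cmod_mult:
  assumes f: "f \<in> sq_integrable M" and g: "g \<in> sq_integrable M"
  shows "integrable M (\<lambda>x. cmod (f x) * cmod (g x))"
proof (rule Bochner_Integration.integrable_bound)
  have [measurable]: "f \<in> borel_measurable M" "g \<in> borel_measurable M"
    using f g by (simp_all add: sq_integrable_measurable)
  show "integrable M (\<lambda>x. (cmod (f x))\<^sup>2 + (cmod (g x))\<^sup>2)"
    using f g by (simp add: sq_integrable_integrable)
  have "cmod (f x) * cmod (g x) \<le> (cmod (f x))\<^sup>2 + (cmod (g x))\<^sup>2" for x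
    using sum_squares_bound[of "cmod (f x)" "cmod (g x)"]
      mult_nonneg_nonneg[OF norm_ge_zero[of "f x"] norm_ge_zero[of "g x"]] by linarith
  then show "AE x in M. norm (cmod (f x) * cmod (g x)) \<le> norm ((cmod (f x))\<^sup>2 + (cmod (g x))\<^sup>2)"
    by (intro AE_I2) simp
qed (use f g in \<open>auto dest!: sq_integrable_measurable\<close>)

lemma integrable_mult:
  assumes f: "f \<in> sq_integrable M" and g: "g \<in> sq_integrable M"
  shows "integrable M (\<lambda>x. f x * g x)"
proof (rule Bochner_Integration.integrable_bound[OF integrable_cmod_mult[OF f g]])
  show "(\<lambda>x. f x * g x) \<in> borel_measurable M"
    using f g by (auto dest!: sq_integrable_measurable)
qed (simp add: norm_mult)

lemma integrable_cnj_mult: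
  assumes f: "f \<in> sq_integrable M" and g: "g \<in> sq_integrable M"
  shows "integrable M (\<lambda>x. cnj (f x) * g x)"
  using integrable_mult[OF sq_integrable_cnj[OF f] g] .

lemma l2norm_nonneg [simp]: "0 \<le> l2norm M f"
  by (simp add: l2norm_def)

lemma l2norm_sq: "(l2norm M f)\<^sup>2 = (LINT x|M. (cmod (f x))\<^sup>2)"
  by (simp add: l2norm_def)

lemma l2norm_nn:
  assumes "f \<in> sq_integrable M"
  shows "(\<integral>\<^sup>+x. ennreal ((cmod (f x))\<^sup>2) \<partial>M) = ennreal ((l2norm M f)\<^sup>2)"
  unfolding l2norm_sq by (rule nn_integral_eq_integral[OF sq_integrable_integrable[OF assms]]) simp

lemma l2norm_cmult: "l2norm M (\<lambda>x. c * f x) = cmod c * l2norm M f"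
  by (simp add: l2norm_def norm_mult power_mult_distrib real_sqrt_mult)

lemma l2norm_minus_commute: "l2norm M (\<lambda>x. f x - g x) = l2norm M (\<lambda>x. g x - f x)"
  by (simp add: l2norm_def norm_minus_commute)

lemma l2norm_cnj: "l2norm M (\<lambda>x. cnj (f x)) = l2norm M f"
  by (simp add: l2norm_def)

lemma l2ip_self: "l2ip M f f = of_real ((l2norm M f)\<^sup>2)"
proof -
  have "l2ip M f f = (LINT x|M. complex_of_real ((cmod (f x))\<^sup>2))"
    unfolding l2ip_def by (intro Bochner_Integration.integral_cong refl) (simp only: complex_norm_square mult.commute)
  also have "\<dots> = of_real (LINT x|M. (cmod (f x))\<^sup>2)" by (rule integral_complex_of_real)
  finally show ?thesis by (simp add: l2norm_sq)
qed

lemma l2ip_cong_AE: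
  assumes "AE x in M. f x = f' x" "AE x in M. g x = g' x"
    and "f \<in> borel_measurable M" "f' \<in> borel_measurable M" "g \<in> borel_measurable M" "g' \<in> borel_measurable M"
  shows "l2ip M f g = l2ip M f' g'"
  unfolding l2ip_def by (rule integral_cong_AE) (use assms in auto)

lemma l2ip_add_right:
  assumes "f \<in> sq_integrable M" "g \<in> sq_integrable M" "h \<in> sq_integrable M"
  shows "l2ip M f (\<lambda>x. g x + h x) = l2ip M f g + l2ip M f h"
  unfolding l2ip_def using integrable_cnj_mult[OF assms(1,2)] integrable_cnj_mult[OF assms(1,3)]
  by (simp add: distrib_left)

lemma l2ip_add_left:
  assumes "f \<in> sq_integrable M" "g \<in> sq_integrable M" "h \<in> sq_integrable M"
  shows "l2ip M (\<lambda>x. f x + g x) h = l2ip M f h + l2ip M g h"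
  unfolding l2ip_def using integrable_cnj_mult[OF assms(1,3)] integrable_cnj_mult[OF assms(2,3)]
  by (simp add: distrib_right)

lemma l2ip_diff_right:
  assumes "f \<in> sq_integrable M" "g \<in> sq_integrable M" "h \<in> sq_integrable M"
  shows "l2ip M f (\<lambda>x. g x - h x) = l2ip M f g - l2ip M f h"
  unfolding l2ip_def using integrable_cnj_mult[OF assms(1,2)] integrable_cnj_mult[OF assms(1,3)]
  by (simp add: right_diff_distrib)

lemma l2ip_diff_left:
  assumes "f \<in> sq_integrable M" "g \<in> sq_integrable M" "h \<in> sq_integrable M"
  shows "l2ip M (\<lambda>x. f x - g x) h = l2ip M f h - l2ip M g h"
  unfolding l2ip_def using integrable_cnj_mult[OF assms(1,3)] integrable_cnj_mult[OF assms(2,3)]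
  by (simp add: left_diff_distrib)

lemma l2ip_cmult_right: "l2ip M f (\<lambda>x. c * g x) = c * l2ip M f g"
  unfolding l2ip_def by (simp add: mult.left_commute)

lemma l2ip_cmult_left: "l2ip M (\<lambda>x. c * f x) g = cnj c * l2ip M f g"
  unfolding l2ip_def by (simp add: mult.assoc)

lemma l2ip_cnj: "cnj (l2ip M f g) = l2ip M g f"
  unfolding l2ip_def by (subst Bochner_Integration.integral_cnj[symmetric]) (simp add: mult.commute)

lemma l2norm_eq_0_AE:
  assumes "f \<in> sq_integrable M" "l2norm M f = 0"
  shows "AE x in M. f x = 0"
proof -
  have "(LINT x|M. (cmod (f x))\<^sup>2) = 0" using assms(2) by (simp add: l2norm_def)
  then have "AE x in M. (cmod (f x))\<^sup>2 = 0"
    using integral_nonneg_eq_0_iff_AE[OF sq_integrable_integrable[OF assms(1)]] by simp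
  then show ?thesis by simp
qed

text \<open>
  Integrate \<open>2 (s u) (t v) \<le> (s u)\<^sup>2 + (t v)\<^sup>2\<close> and take for \<open>s\<close> and \<open>t\<close> the norms of \<open>g\<close> and \<open>f\<close>.
\<close>

lemma l2_Cauchy_Schwarz:
  assumes f: "f \<in> sq_integrable M" and g: "g \<in> sq_integrable M"
  shows "(LINT x|M. cmod (f x) * cmod (g x)) \<le> l2norm M f * l2norm M g"
proof -
  let ?I = "LINT x|M. cmod (f x) * cmod (g x)"
  let ?a = "l2norm M f" and ?b = "l2norm M g"
  have key: "2 * s * t * ?I \<le> s\<^sup>2 * ?a\<^sup>2 + t\<^sup>2 * ?b\<^sup>2" for s t :: real
  proof -
    have "2 * s * t * ?I = (LINT x|M. 2 * s * t * (cmod (f x) * cmod (g x)))" by simp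
    also have "\<dots> \<le> (LINT x|M. s\<^sup>2 * (cmod (f x))\<^sup>2 + t\<^sup>2 * (cmod (g x))\<^sup>2)"
    proof (rule integral_mono)
      show "integrable M (\<lambda>x. 2 * s * t * (cmod (f x) * cmod (g x)))"
        using integrable_cmod_mult[OF f g] by simp
      show "integrable M (\<lambda>x. s\<^sup>2 * (cmod (f x))\<^sup>2 + t\<^sup>2 * (cmod (g x))\<^sup>2)"
        using f g by (simp add: sq_integrable_integrable)
      show "2 * s * t * (cmod (f x) * cmod (g x)) \<le> s\<^sup>2 * (cmod (f x))\<^sup>2 + t\<^sup>2 * (cmod (g x))\<^sup>2" for x
        using sum_squares_bound[of "s * cmod (f x)" "t * cmod (g x)"]
        by (simp add: power_mult_distrib algebra_simps)
    qed
    also have "\<dots> = s\<^sup>2 * ?a\<^sup>2 + t\<^sup>2 * ?b\<^sup>2"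
      using f g by (simp add: sq_integrable_integrable l2norm_sq)
    finally show ?thesis .
  qed
  show ?thesis
  proof (cases "?a = 0 \<or> ?b = 0")
    case True
    then have "AE x in M. cmod (f x) * cmod (g x) = 0"
      using l2norm_eq_0_AE[OF f] l2norm_eq_0_AE[OF g] by (auto elim: eventually_mono)
    then have "?I = 0" by (rule integral_eq_zero_AE)
    then show ?thesis by simp
  next
    case False
    then have pos: "0 < ?a * ?b" by (simp add: less_le)
    have "2 * (?a * ?b) * ?I \<le> 2 * (?a * ?b) * (?a * ?b)"
      using key[of ?b ?a] by (simp add: power2_eq_square algebra_simps)
    then show ?thesis using pos by (simp add: mult_le_cancel_left_pos)
  qed
qed

lemma l2ip_bound:
  assumes f: "f \<in> sq_integrable M" and g: "g \<in> sq_integrable M"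
  shows "cmod (l2ip M f g) \<le> l2norm M f * l2norm M g"
proof -
  have "cmod (l2ip M f g) \<le> (LINT x|M. cmod (cnj (f x) * g x))"
    unfolding l2ip_def by (rule integral_norm_bound)
  also have "\<dots> \<le> l2norm M f * l2norm M g"
    using l2_Cauchy_Schwarz[OF f g] by (simp add: norm_mult)
  finally show ?thesis .
qed

lemma l2norm_triangle:
  assumes f: "f \<in> sq_integrable M" and g: "g \<in> sq_integrable M"
  shows "l2norm M (\<lambda>x. f x + g x) \<le> l2norm M f + l2norm M g"
proof (rule power2_le_imp_le)
  have "(l2norm M (\<lambda>x. f x + g x))\<^sup>2 = Re (l2ip M (\<lambda>x. f x + g x) (\<lambda>x. f x + g x))"
    by (simp add: l2ip_self)
  also have "\<dots> = (l2norm M f)\<^sup>2 + (l2norm M g)\<^sup>2 + Re (l2ip M f g) + Re (l2ip M g f)"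
    using l2ip_add_left[OF f g sq_integrable_add[OF f g]] l2ip_add_right[OF f f g]
      l2ip_add_right[OF g f g] l2ip_self[of M f] l2ip_self[of M g] by simp
  also have "\<dots> \<le> (l2norm M f)\<^sup>2 + (l2norm M g)\<^sup>2 + l2norm M f * l2norm M g + l2norm M g * l2norm M f"
    using l2ip_bound[OF f g] l2ip_bound[OF g f] complex_Re_le_cmod[of "l2ip M f g"]
      complex_Re_le_cmod[of "l2ip M g f"] by linarith
  also have "\<dots> = (l2norm M f + l2norm M g)\<^sup>2" by (simp add: power2_sum)
  finally show "(l2norm M (\<lambda>x. f x + g x))\<^sup>2 \<le> (l2norm M f + l2norm M g)\<^sup>2" .
qed simp

lemma l2norm_triangle_diff:
  assumes "f \<in> sq_integrable M" "g \<in> sq_integrable M" "h \<in> sq_integrable M"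
  shows "l2norm M (\<lambda>x. f x - h x) \<le> l2norm M (\<lambda>x. f x - g x) + l2norm M (\<lambda>x. g x - h x)"
  using l2norm_triangle[OF sq_integrable_diff[OF assms(1,2)] sq_integrable_diff[OF assms(2,3)]] by simp

lemma l2norm_diff_abs:
  assumes f: "f \<in> sq_integrable M" and g: "g \<in> sq_integrable M"
  shows "\<bar>l2norm M f - l2norm M g\<bar> \<le> l2norm M (\<lambda>x. f x - g x)"
  using l2norm_triangle[OF sq_integrable_diff[OF f g] g] l2norm_triangle[OF sq_integrable_diff[OF g f] f]
    l2norm_minus_commute[of M f g] by simp

lemma l2norm_tendsto:
  assumes "\<And>n. s n \<in> sq_integrable M" "f \<in> sq_integrable M"
    and "(\<lambda>n. l2norm M (\<lambda>x. s n x - f x)) \<longlonglongrightarrow> 0"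
  shows "(\<lambda>n. l2norm M (s n)) \<longlonglongrightarrow> l2norm M f"
proof -
  have "(\<lambda>n. l2norm M (s n) - l2norm M f) \<longlonglongrightarrow> 0"
    by (rule tendsto_0_le[OF assms(3), of _ 1])
       (use l2norm_diff_abs[OF assms(1) assms(2)] in auto)
  then show ?thesis by (simp add: LIM_zero_iff)
qed

lemma l2ip_tendsto:
  assumes s: "\<And>n. s n \<in> sq_integrable M" and f: "f \<in> sq_integrable M"
    and t: "\<And>n. t n \<in> sq_integrable M" and g: "g \<in> sq_integrable M"
    and sl: "(\<lambda>n. l2norm M (\<lambda>x. s n x - f x)) \<longlonglongrightarrow> 0"
    and tl: "(\<lambda>n. l2norm M (\<lambda>x. t n x - g x)) \<longlonglongrightarrow> 0"
  shows "(\<lambda>n. l2ip M (s n) (t n)) \<longlonglongrightarrow> l2ip M f g"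
proof -
  have "(\<lambda>n. l2norm M (\<lambda>x. s n x - f x) * l2norm M (t n) + l2norm M f * l2norm M (\<lambda>x. t n x - g x))
      \<longlonglongrightarrow> 0 * l2norm M g + l2norm M f * 0"
    by (intro tendsto_intros sl tl l2norm_tendsto t g)
  then have lim: "(\<lambda>n. l2norm M (\<lambda>x. s n x - f x) * l2norm M (t n) + l2norm M f * l2norm M (\<lambda>x. t n x - g x)) \<longlonglongrightarrow> 0"
    by simp
  have "(\<lambda>n. l2ip M (s n) (t n) - l2ip M f g) \<longlonglongrightarrow> 0"
  proof (rule tendsto_0_le[OF lim, of _ 1], intro always_eventually allI)
    fix n
    have "l2ip M (s n) (t n) - l2ip M f g = l2ip M (\<lambda>x. s n x - f x) (t n) + l2ip M f (\<lambda>x. t n x - g x)"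
      using s f t g by (simp add: l2ip_diff_left l2ip_diff_right)
    then have "cmod (l2ip M (s n) (t n) - l2ip M f g)
        \<le> cmod (l2ip M (\<lambda>x. s n x - f x) (t n)) + cmod (l2ip M f (\<lambda>x. t n x - g x))"
      by (simp add: norm_triangle_ineq)
    also have "\<dots> \<le> l2norm M (\<lambda>x. s n x - f x) * l2norm M (t n) + l2norm M f * l2norm M (\<lambda>x. t n x - g x)"
      by (intro add_mono l2ip_bound sq_integrable_diff s f t g)
    finally show "norm (l2ip M (s n) (t n) - l2ip M f g) \<le>
       norm (l2norm M (\<lambda>x. s n x - f x) * l2norm M (t n) + l2norm M f * l2norm M (\<lambda>x. t n x - g x)) * 1"
      by simp
  qed
  then show ?thesis by (simp add: LIM_zero_iff)
qed

text \<open>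
  Fatou's lemma is used throughout to obtain square integrability of a pointwise limit from a bound on norms.
\<close>

lemma l2_Fatou:
  assumes s: "\<And>n. s n \<in> sq_integrable M" and f [measurable]: "f \<in> borel_measurable M"
    and lim: "AE x in M. (\<lambda>n. s n x) \<longlonglongrightarrow> f x"
    and bound: "eventually (\<lambda>n. l2norm M (s n) \<le> C) sequentially"
  shows "f \<in> sq_integrable M" "l2norm M f \<le> C"
proof -
  have [measurable]: "s n \<in> borel_measurable M" for n using s by (rule sq_integrable_measurable)
  obtain n where "l2norm M (s n) \<le> C"
    using bound by (auto simp: eventually_sequentially)
  then have C0: "0 \<le> C" using l2norm_nonneg order_trans by blast
  have "AE x in M. ennreal ((cmod (f x))\<^sup>2) = liminf (\<lambda>n. ennreal ((cmod (s n x))\<^sup>2))"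
    using lim
  proof eventually_elim
    case (elim x)
    have "(\<lambda>n. ennreal ((cmod (s n x))\<^sup>2)) \<longlonglongrightarrow> ennreal ((cmod (f x))\<^sup>2)"
      by (intro tendsto_intros tendsto_ennrealI elim)
    from lim_imp_Liminf[OF _ this] show ?case by simp
  qed
  then have "(\<integral>\<^sup>+x. ennreal ((cmod (f x))\<^sup>2) \<partial>M) = (\<integral>\<^sup>+x. liminf (\<lambda>n. ennreal ((cmod (s n x))\<^sup>2)) \<partial>M)"
    by (rule nn_integral_cong_AE)
  also have "\<dots> \<le> liminf (\<lambda>n. \<integral>\<^sup>+x. ennreal ((cmod (s n x))\<^sup>2) \<partial>M)"
    by (rule nn_integral_liminf) measurable
  also have "\<dots> = liminf (\<lambda>n. ennreal ((l2norm M (s n))\<^sup>2))"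
    by (simp add: l2norm_nn[OF s])
  also have "\<dots> \<le> liminf (\<lambda>n. ennreal (C\<^sup>2))"
    by (rule Liminf_mono, rule eventually_mono[OF bound]) (auto intro!: ennreal_leI power_mono)
  also have "\<dots> = ennreal (C\<^sup>2)" by (simp add: Liminf_const)
  finally have le: "(\<integral>\<^sup>+x. ennreal ((cmod (f x))\<^sup>2) \<partial>M) \<le> ennreal (C\<^sup>2)" .
  then have "(\<integral>\<^sup>+x. ennreal ((cmod (f x))\<^sup>2) \<partial>M) < \<infinity>"
    using le_less_trans by fastforce
  then show fs: "f \<in> sq_integrable M" by (simp add: sq_integrable_iff_nn)
  have "(l2norm M f)\<^sup>2 \<le> C\<^sup>2" using le unfolding l2norm_nn[OF fs] by (simp add: ennreal_le_iff)
  then show "l2norm M f \<le> C" using C0 by (rule power2_le_imp_le)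
qed


text \<open>
  The sum \<open>\<Sum>k. 2^k \<bar>t (k+1) - t k\<bar>\<^sup>2\<close> has finite integral. Hence it is finite almost everywhere, and there the
  increments decay geometrically.
\<close>

lemma l2_fast_Cauchy_AE_convergent:
  assumes t: "\<And>k. t k \<in> sq_integrable M"
    and fast: "\<And>k. l2norm M (\<lambda>x. t (Suc k) x - t k x) \<le> (1/2) ^ k"
  shows "AE x in M. convergent (\<lambda>k. t k x)"
proof -
  have [measurable]: "t k \<in> borel_measurable M" for k using t by (rule sq_integrable_measurable)
  let ?d = "\<lambda>k x. cmod (t (Suc k) x - t k x)"
  have "(\<integral>\<^sup>+x. (\<Sum>k. ennreal (2 ^ k * (?d k x)\<^sup>2)) \<partial>M) = (\<Sum>k. \<integral>\<^sup>+x. ennreal (2 ^ k * (?d k x)\<^sup>2) \<partial>M)"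
    by (rule nn_integral_suminf) measurable
  also have "\<dots> \<le> (\<Sum>k. ennreal ((1/2) ^ k))"
  proof (rule suminf_le)
    fix k
    have "(\<integral>\<^sup>+x. ennreal (2 ^ k * (?d k x)\<^sup>2) \<partial>M) = ennreal (2 ^ k) * (\<integral>\<^sup>+x. ennreal ((?d k x)\<^sup>2) \<partial>M)"
      by (simp add: ennreal_mult nn_integral_cmult)
    also have "\<dots> = ennreal (2 ^ k * (l2norm M (\<lambda>x. t (Suc k) x - t k x))\<^sup>2)"
      by (simp add: l2norm_nn[OF sq_integrable_diff[OF t t]] ennreal_mult)
    also have "\<dots> \<le> ennreal (2 ^ k * ((1/2) ^ k)\<^sup>2)"
      by (intro ennreal_leI mult_left_mono power_mono fast) simp_all
    also have "2 ^ k * ((1/2) ^ k)\<^sup>2 = ((1/2) ^ k :: real)"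
      by (simp add: power2_eq_square field_simps)
    finally show "(\<integral>\<^sup>+x. ennreal (2 ^ k * (?d k x)\<^sup>2) \<partial>M) \<le> ennreal ((1/2) ^ k)" .
  qed auto
  also have "\<dots> = ennreal (\<Sum>k. (1/2) ^ k)"
    by (rule suminf_ennreal2) (auto intro: summable_geometric)
  also have "\<dots> < \<infinity>" by simp
  finally have "AE x in M. (\<Sum>k. ennreal (2 ^ k * (?d k x)\<^sup>2)) \<noteq> \<infinity>"
    by (intro nn_integral_PInf_AE) auto
  then show ?thesis
  proof eventually_elim
    case (elim x)
    define c where "c = enn2real (\<Sum>k. ennreal (2 ^ k * (?d k x)\<^sup>2))"
    have c: "(\<Sum>k. ennreal (2 ^ k * (?d k x)\<^sup>2)) = ennreal c"
      using elim by (simp add: c_def less_top)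
    have c0: "0 \<le> c" by (simp add: c_def)
    define a where "a = (\<lambda>k. ennreal (2 ^ k * (?d k x)\<^sup>2))"
    have "?d k x \<le> sqrt c * sqrt (1/2) ^ k" for k
    proof -
      have "a k \<le> suminf a" using sum_le_suminf[of a "{k}"] by simp
      then have "ennreal (2 ^ k * (?d k x)\<^sup>2) \<le> ennreal c" unfolding a_def c .
      then have "2 ^ k * (?d k x)\<^sup>2 \<le> c" using c0 by (simp only: ennreal_le_iff)
      then have "(?d k x)\<^sup>2 \<le> c * (1/2) ^ k" by (simp add: field_simps)
      then have "sqrt ((?d k x)\<^sup>2) \<le> sqrt (c * (1/2) ^ k)" by (rule real_sqrt_le_mono)
      then show ?thesis by (simp add: real_sqrt_mult real_sqrt_power)
    qed
    then have "summable (\<lambda>k. t (Suc k) x - t k x)"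
    proof (intro summable_comparison_test[OF exI[of _ 0] summable_mult[OF summable_geometric]] allI impI)
      show "norm (sqrt (1/2)) < 1" using real_sqrt_less_mono[of "1/2" 1] by simp
    qed simp
    then have "convergent (\<lambda>n. \<Sum>k<n. t (Suc k) x - t k x)"
      by (simp add: summable_iff_convergent)
    moreover have "(\<Sum>k<n. t (Suc k) x - t k x) = t n x - t 0 x" for n
      by (rule sum_lessThan_telescope)
    ultimately have "convergent (\<lambda>n. t n x - t 0 x)" by simp
    then have "convergent (\<lambda>n. (t n x - t 0 x) + t 0 x)" by (intro convergent_add convergent_const)
    then show ?case by simp
  qed
qed

text \<open>
  A rapidly Cauchy subsequence converges almost everywhere, and Fatou's lemma, applied to its differences with a
  fixed term of the sequence, shows that its pointwise limit is also the limit in norm.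
\<close>

theorem Riesz_Fischer:
  assumes s: "\<And>n. s n \<in> sq_integrable M"
    and Cauchy: "\<And>e. 0 < e \<Longrightarrow> \<exists>N. \<forall>m\<ge>N. \<forall>n\<ge>N. l2norm M (\<lambda>x. s m x - s n x) < e"
  obtains f where "f \<in> sq_integrable M" "(\<lambda>n. l2norm M (\<lambda>x. s n x - f x)) \<longlonglongrightarrow> 0"
proof -
  have "\<exists>N. \<forall>k. (\<forall>m\<ge>N k. \<forall>n\<ge>N k. l2norm M (\<lambda>x. s m x - s n x) < (1/2) ^ k) \<and> N k \<le> N (Suc k)"
  proof (rule dependent_nat_choice)
    show "\<exists>N. \<forall>m\<ge>N. \<forall>n\<ge>N. l2norm M (\<lambda>x. s m x - s n x) < (1/2) ^ 0" by (rule Cauchy) simp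
    fix N k
    obtain N' where "\<forall>m\<ge>N'. \<forall>n\<ge>N'. l2norm M (\<lambda>x. s m x - s n x) < (1/2) ^ Suc k"
      using Cauchy[of "(1/2) ^ Suc k"] by auto
    then show "\<exists>N'. (\<forall>m\<ge>N'. \<forall>n\<ge>N'. l2norm M (\<lambda>x. s m x - s n x) < (1/2) ^ Suc k) \<and> N \<le> N'"
      by (intro exI[of _ "max N N'"]) auto
  qed
  then obtain N where N: "\<And>k m n. N k \<le> m \<Longrightarrow> N k \<le> n \<Longrightarrow> l2norm M (\<lambda>x. s m x - s n x) < (1/2) ^ k"
    and N_Suc: "\<And>k. N k \<le> N (Suc k)" by blast
  have N_mono: "N k \<le> N j" if "k \<le> j" for k j by (rule lift_Suc_mono_le[where f=N, OF N_Suc that])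
  have [measurable]: "s n \<in> borel_measurable M" for n using s by (rule sq_integrable_measurable)
  define f where "f = (\<lambda>x. lim (\<lambda>k. s (N k) x))"
  have fm [measurable]: "f \<in> borel_measurable M"
    unfolding f_def by (rule borel_measurable_lim_metric) measurable
  have "AE x in M. convergent (\<lambda>k. s (N k) x)"
    by (rule l2_fast_Cauchy_AE_convergent) (auto intro!: s less_imp_le N N_Suc)
  then have lim: "AE x in M. (\<lambda>k. s (N k) x) \<longlonglongrightarrow> f x"
    by eventually_elim (simp add: f_def convergent_LIMSEQ_iff)
  have fat: "(\<lambda>x. f x - s n x) \<in> sq_integrable M \<and> l2norm M (\<lambda>x. f x - s n x) \<le> (1/2) ^ k"
    if "N k \<le> n" for n k
  proof -
    have lim': "AE x in M. (\<lambda>j. s (N j) x - s n x) \<longlonglongrightarrow> f x - s n x"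
      using lim by eventually_elim (intro tendsto_intros)
    have ev: "eventually (\<lambda>j. l2norm M (\<lambda>x. s (N j) x - s n x) \<le> (1/2) ^ k) sequentially"
      using eventually_ge_at_top[of k] by eventually_elim (rule less_imp_le[OF N[OF N_mono that]])
    show ?thesis
      using l2_Fatou[OF sq_integrable_diff[OF s s] _ lim' ev] by auto
  qed
  have fs: "f \<in> sq_integrable M"
    using sq_integrable_add[OF conjunct1[OF fat[OF order_refl]] s, of 0 "N 0"] by simp
  have "(\<lambda>n. l2norm M (\<lambda>x. s n x - f x)) \<longlonglongrightarrow> 0"
  proof (rule LIMSEQ_I)
    fix e :: real assume "0 < e"
    then obtain k where k: "(1/2) ^ k < e" using real_arch_pow_inv[of e "1/2"] by auto
    show "\<exists>n0. \<forall>n\<ge>n0. norm (l2norm M (\<lambda>x. s n x - f x) - 0) < e"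
    proof (intro exI[of _ "N k"] allI impI)
      fix n assume "N k \<le> n"
      then have "l2norm M (\<lambda>x. f x - s n x) \<le> (1/2) ^ k" using fat by blast
      then show "norm (l2norm M (\<lambda>x. s n x - f x) - 0) < e"
        using k by (simp add: l2norm_minus_commute[of M f])
    qed
  qed
  with fs show thesis by (rule that)
qed

text \<open>
  The ratio \<open>1/3\<close> makes the sum of all later steps half as large as the current one.
\<close>

lemma l2norm_telescope_geometric:
  assumes s: "\<And>n. s n \<in> sq_integrable M"
    and step: "\<And>n. l2norm M (\<lambda>x. s (Suc n) x - s n x) \<le> (1/3) ^ n"
  shows "l2norm M (\<lambda>x. s (n + k) x - s n x) \<le> 3/2 * (1/3) ^ n - 3/2 * (1/3) ^ (n + k)"
proof (induction k)
  case 0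
  then show ?case by (simp add: l2norm_def)
next
  case (Suc k)
  have "l2norm M (\<lambda>x. s (n + Suc k) x - s n x)
      \<le> l2norm M (\<lambda>x. s (n + Suc k) x - s (n + k) x) + l2norm M (\<lambda>x. s (n + k) x - s n x)"
    by (rule l2norm_triangle_diff) (rule s)+
  also have "\<dots> \<le> (1/3) ^ (n + k) + (3/2 * (1/3) ^ n - 3/2 * (1/3) ^ (n + k))"
    using Suc step[of "n + k"] by simp
  also have "\<dots> = 3/2 * (1/3) ^ n - 3/2 * (1/3) ^ (n + Suc k)" by simp
  finally show ?case .
qed

text \<open>
  A gliding hump: if the norms were unbounded, choose \<open>g n\<close> of huge norm in the family and build \<open>x (n+1) = x n \<plusminus> 3^(-n) g n / \<parallel>g n\<parallel>\<close>, with the sign making the pairing with \<open>g n\<close> at least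
  \<open>3^(-n) \<parallel>g n\<parallel>\<close>. All later steps together move the limit by at most half as much, so the pairings of
  the limit with the \<open>g n\<close> are unbounded.
\<close>

theorem l2_uniform_boundedness:
  fixes g :: "'j \<Rightarrow> 'a \<Rightarrow> complex"
  assumes g: "\<And>j. j \<in> J \<Longrightarrow> g j \<in> sq_integrable M"
    and weak: "\<And>u. u \<in> sq_integrable M \<Longrightarrow> \<exists>B. \<forall>j\<in>J. cmod (l2ip M u (g j)) \<le> B"
  shows "\<exists>C. \<forall>j\<in>J. l2norm M (g j) \<le> C"
proof (rule ccontr)
  assume "\<not> ?thesis"
  then have "\<forall>n::nat. \<exists>j. j \<in> J \<and> 2 * real n * 3 ^ n < l2norm M (g j)" by (meson not_le)
  from choice[OF this] obtain j
    where jJ: "\<And>n. j n \<in> J" and jn: "\<And>n::nat. 2 * real n * 3 ^ n < l2norm M (g (j n))"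
    by blast
  define G where "G n = g (j n)" for n
  have G: "G n \<in> sq_integrable M" for n unfolding G_def by (rule g[OF jJ])
  have Gpos: "l2norm M (G n) > 0" for n
    using jn[of n] unfolding G_def by (rule le_less_trans[rotated]) simp
  \<comment> \<open>The \<open>n\<close>-th step is taken in the direction of \<open>G n\<close> and has length \<open>3^(-n)\<close>.\<close>
  have "\<exists>x. \<forall>n. x n \<in> sq_integrable M \<and>
      (l2norm M (\<lambda>t. x (Suc n) t - x n t) \<le> (1/3) ^ n \<and>
       (1/3) ^ n * l2norm M (G n) \<le> cmod (l2ip M (x (Suc n)) (G n)))"
  proof (rule dependent_nat_choice)
    show "\<exists>x. x \<in> sq_integrable M" by (rule exI[of _ "\<lambda>x. 0"]) simp
    fix x :: "'a \<Rightarrow> complex" and n assume x: "x \<in> sq_integrable M"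
    define c where "c = complex_of_real ((1/3) ^ n / l2norm M (G n))"
    define y where "y = (\<lambda>t. c * G n t)"
    have y: "y \<in> sq_integrable M" unfolding y_def by (rule sq_integrable_cmult[OF G])
    have cc: "cmod c = (1/3) ^ n / l2norm M (G n)"
      unfolding c_def norm_of_real using Gpos[of n] by simp
    have ny: "l2norm M y = (1/3) ^ n"
      unfolding y_def l2norm_cmult cc using Gpos[of n] by simp
    have "cmod (l2ip M y (G n)) = cmod c * (l2norm M (G n))\<^sup>2"
      unfolding y_def l2ip_cmult_left l2ip_self norm_mult norm_of_real by simp
    also have "\<dots> = (1/3) ^ n * l2norm M (G n)"
      unfolding cc using Gpos[of n] by (simp add: power2_eq_square)
    finally have yG: "cmod (l2ip M y (G n)) = (1/3) ^ n * l2norm M (G n)" .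
    \<comment> \<open>One of the two signs does not decrease the pairing with \<open>G n\<close>.\<close>
    have "2 * l2ip M y (G n) = l2ip M (\<lambda>t. x t + y t) (G n) - l2ip M (\<lambda>t. x t - y t) (G n)"
      unfolding l2ip_add_left[OF x y G] l2ip_diff_left[OF x y G] by simp
    then have "cmod (2 * l2ip M y (G n)) \<le> cmod (l2ip M (\<lambda>t. x t + y t) (G n)) + cmod (l2ip M (\<lambda>t. x t - y t) (G n))"
      by (simp only: norm_triangle_ineq4)
    then have "2 * cmod (l2ip M y (G n)) \<le> cmod (l2ip M (\<lambda>t. x t + y t) (G n)) + cmod (l2ip M (\<lambda>t. x t - y t) (G n))"
      by (simp only: norm_mult norm_numeral)
    then consider "(1/3) ^ n * l2norm M (G n) \<le> cmod (l2ip M (\<lambda>t. x t + y t) (G n))"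
      | "(1/3) ^ n * l2norm M (G n) \<le> cmod (l2ip M (\<lambda>t. x t - y t) (G n))"
      using yG by linarith
    then show "\<exists>x'. x' \<in> sq_integrable M \<and> l2norm M (\<lambda>t. x' t - x t) \<le> (1/3) ^ n \<and>
       (1/3) ^ n * l2norm M (G n) \<le> cmod (l2ip M x' (G n))"
    proof cases
      case 1
      then show ?thesis using x y ny by (intro exI[of _ "\<lambda>t. x t + y t"]) (simp add: sq_integrable_add)
    next
      case 2
      have "l2norm M (\<lambda>t. x t - y t - x t) = l2norm M y" by (simp add: l2norm_def)
      then show ?thesis using 2 x y ny by (intro exI[of _ "\<lambda>t. x t - y t"]) (simp add: sq_integrable_diff)
    qed
  qed
  then obtain x where x: "\<And>n. x n \<in> sq_integrable M"
    and step: "\<And>n. l2norm M (\<lambda>t. x (Suc n) t - x n t) \<le> (1/3) ^ n"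
    and large: "\<And>n. (1/3) ^ n * l2norm M (G n) \<le> cmod (l2ip M (x (Suc n)) (G n))" by blast
  have tele: "l2norm M (\<lambda>t. x m t - x n t) \<le> 3/2 * (1/3) ^ n" if "n \<le> m" for m n
  proof -
    have "l2norm M (\<lambda>t. x m t - x n t) \<le> 3/2 * (1/3) ^ n - 3/2 * (1/3) ^ m"
      using l2norm_telescope_geometric[where s=x, OF x step, of n "m - n"] that by simp
    moreover have "0 \<le> (1/3::real) ^ m" by simp
    ultimately show ?thesis by linarith
  qed
  obtain z where z: "z \<in> sq_integrable M" and xz: "(\<lambda>n. l2norm M (\<lambda>t. x n t - z t)) \<longlonglongrightarrow> 0"
  proof (rule Riesz_Fischer[where s=x and M=M, OF x])
    fix e :: real assume e: "0 < e"
    then obtain N where N: "(1/3) ^ N < e / 3" using real_arch_pow_inv[of "e/3" "1/3"] by auto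
    have "l2norm M (\<lambda>t. x m t - x n t) < e" if "N \<le> m" "N \<le> n" for m n
      using l2norm_triangle_diff[OF x[of m] x[of N] x[of n]] tele[OF that(1)] tele[OF that(2)] N
        l2norm_minus_commute[of M "x N" "x n"] by linarith
    then show "\<exists>N. \<forall>m\<ge>N. \<forall>n\<ge>N. l2norm M (\<lambda>t. x m t - x n t) < e" by blast
  qed
  have zx: "l2norm M (\<lambda>t. z t - x n t) \<le> 3/2 * (1/3) ^ n" for n
  proof (rule LIMSEQ_le_const)
    show "(\<lambda>m. l2norm M (\<lambda>t. x m t - z t) + 3/2 * (1/3) ^ n) \<longlonglongrightarrow> 3/2 * (1/3) ^ n"
      using tendsto_add[OF xz tendsto_const[of "3/2 * (1/3) ^ n"]] by simp
    show "\<exists>N. \<forall>m\<ge>N. l2norm M (\<lambda>t. z t - x n t) \<le> l2norm M (\<lambda>t. x m t - z t) + 3/2 * (1/3) ^ n"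
    proof (intro exI[of _ n] allI impI)
      fix m assume "n \<le> m"
      then show "l2norm M (\<lambda>t. z t - x n t) \<le> l2norm M (\<lambda>t. x m t - z t) + 3/2 * (1/3) ^ n"
        using l2norm_triangle_diff[OF z x[of m] x[of n]] tele[of n m] l2norm_minus_commute[of M z "x m"] by simp
    qed
  qed
  have big: "real n < cmod (l2ip M z (G n))" for n
  proof -
    have "l2ip M (x (Suc n)) (G n) = l2ip M z (G n) - l2ip M (\<lambda>t. z t - x (Suc n) t) (G n)"
      using z x G by (simp add: l2ip_diff_left)
    then have "cmod (l2ip M (x (Suc n)) (G n)) \<le> cmod (l2ip M z (G n)) + cmod (l2ip M (\<lambda>t. z t - x (Suc n) t) (G n))"
      by (simp add: norm_triangle_ineq4)
    moreover have "cmod (l2ip M (\<lambda>t. z t - x (Suc n) t) (G n)) \<le> 1/2 * (1/3) ^ n * l2norm M (G n)"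
      using l2ip_bound[OF sq_integrable_diff[OF z x] G, of "Suc n" n]
        mult_right_mono[OF zx[of "Suc n"] l2norm_nonneg[of M "G n"]] by simp
    ultimately have "1/2 * (1/3) ^ n * l2norm M (G n) \<le> cmod (l2ip M z (G n))"
      using large[of n] by linarith
    moreover have "real n < 1/2 * (1/3) ^ n * l2norm M (G n)"
      using jn[of n] unfolding G_def by (simp add: field_simps power_divide)
    ultimately show ?thesis by linarith
  qed
  obtain B where "\<And>n. cmod (l2ip M z (G n)) \<le> B"
    using weak[OF z] jJ unfolding G_def by blast
  moreover obtain n where "B < real n" using reals_Archimedean2 by blast
  ultimately show False using big[of n] by (meson less_le_trans not_less order.strict_trans)
qed

section \<open>Classes of square integrable functions\<close>

lemma equiv_ae_rel: "equiv (sq_integrable M) (ae_rel M)"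
proof (rule equivI)
  show "ae_rel M \<subseteq> sq_integrable M \<times> sq_integrable M" by (auto simp: ae_rel_def)
  show "refl_on (sq_integrable M) (ae_rel M)" by (auto simp: refl_on_def ae_rel_def)
  show "sym (ae_rel M)" by (auto simp: sym_def ae_rel_def elim: AE_mp)
  show "trans (ae_rel M)" by (auto simp: trans_def ae_rel_def elim: AE_mp)
qed

lemma cls_in_L2: "f \<in> sq_integrable M \<Longrightarrow> cls M f \<in> L2 M"
  by (simp add: cls_def L2_def quotientI)

lemma in_cls_iff: "g \<in> cls M f \<longleftrightarrow> f \<in> sq_integrable M \<and> g \<in> sq_integrable M \<and> (AE x in M. f x = g x)"
  by (simp add: cls_def ae_rel_def)

lemma rep_in: assumes "\<phi> \<in> L2 M" shows "rep \<phi> \<in> \<phi>"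
proof -
  obtain f where "f \<in> sq_integrable M" "\<phi> = ae_rel M `` {f}"
    using assms unfolding L2_def by (auto elim: quotientE)
  then have "\<exists>f. f \<in> \<phi>" by (auto simp: ae_rel_def)
  then show ?thesis unfolding rep_def by (rule someI_ex)
qed

lemma in_L2_sq_integrable: assumes "\<phi> \<in> L2 M" "f \<in> \<phi>" shows "f \<in> sq_integrable M"
  using assms unfolding L2_def by (auto simp: ae_rel_def elim!: quotientE)

lemma rep_sq_integrable: "\<phi> \<in> L2 M \<Longrightarrow> rep \<phi> \<in> sq_integrable M"
  using in_L2_sq_integrable rep_in by blast

lemma cls_eq_of_mem: assumes "\<phi> \<in> L2 M" "f \<in> \<phi>" shows "cls M f = \<phi>"
proof -
  obtain g where g: "g \<in> sq_integrable M" "\<phi> = ae_rel M `` {g}"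
    using assms(1) unfolding L2_def by (auto elim: quotientE)
  then have "(g, f) \<in> ae_rel M" using assms(2) by simp
  then show ?thesis unfolding cls_def g(2) using equiv_class_eq[OF equiv_ae_rel] by metis
qed

lemma cls_rep: "\<phi> \<in> L2 M \<Longrightarrow> cls M (rep \<phi>) = \<phi>"
  by (rule cls_eq_of_mem) (auto intro: rep_in)

lemma cls_eqI:
  assumes "f \<in> sq_integrable M" "g \<in> sq_integrable M" "AE x in M. f x = g x"
  shows "cls M f = cls M g"
  using assms by (intro cls_eq_of_mem cls_in_L2) (auto simp: in_cls_iff elim: AE_mp)

lemma rep_cls: assumes "f \<in> sq_integrable M" shows "AE x in M. rep (cls M f) x = f x"
  using rep_in[OF cls_in_L2[OF assms]] by (auto simp: in_cls_iff elim: AE_mp)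

lemma inner_L2_eq: "inner_L2 M \<psi> \<phi> = l2ip M (rep \<psi>) (rep \<phi>)"
  by (simp add: inner_L2_def l2ip_def)

lemma inner_L2_cls:
  assumes f: "f \<in> sq_integrable M" and g: "g \<in> sq_integrable M"
  shows "inner_L2 M (cls M f) (cls M g) = l2ip M f g"
  unfolding inner_L2_eq
  by (rule l2ip_cong_AE)
     (use f g in \<open>auto intro!: rep_cls sq_integrable_measurable rep_sq_integrable cls_in_L2\<close>)

lemma inner_L2_rep_cls:
  assumes f: "\<psi> \<in> L2 M" and g: "g \<in> sq_integrable M"
  shows "inner_L2 M \<psi> (cls M g) = l2ip M (rep \<psi>) g"
  using inner_L2_cls[OF rep_sq_integrable[OF f] g] cls_rep[OF f] by simp

text \<open>
  The difference of two vectors with equal inner products is orthogonal to itself.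
\<close>

lemma L2_eqI:
  assumes a: "a \<in> L2 M" and b: "b \<in> L2 M"
    and eq: "\<And>\<psi>. \<psi> \<in> L2 M \<Longrightarrow> inner_L2 M \<psi> a = inner_L2 M \<psi> b"
  shows "a = b"
proof -
  let ?d = "\<lambda>x. rep a x - rep b x"
  have d: "?d \<in> sq_integrable M" using a b by (intro sq_integrable_diff rep_sq_integrable)
  have "l2ip M ?d (rep a) = l2ip M ?d (rep b)"
    using eq[OF cls_in_L2[OF d]] inner_L2_cls[OF d rep_sq_integrable[OF a]]
      inner_L2_cls[OF d rep_sq_integrable[OF b]] cls_rep[OF a] cls_rep[OF b] by simp
  then have "l2ip M ?d ?d = 0"
    using l2ip_diff_right[OF d rep_sq_integrable[OF a] rep_sq_integrable[OF b]] by simp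
  then have "l2norm M ?d = 0" by (simp add: l2ip_self)
  then have "AE x in M. rep a x = rep b x"
    using l2norm_eq_0_AE[OF d] by simp
  then show ?thesis
    using cls_eqI[OF rep_sq_integrable[OF a] rep_sq_integrable[OF b]] cls_rep[OF a] cls_rep[OF b] by simp
qed

lemma adjoint_L2_eqI:
  assumes "\<eta> \<in> L2 M" "\<And>\<psi>. \<psi> \<in> L2 M \<Longrightarrow> inner_L2 M \<psi> \<eta> = inner_L2 N (T \<psi>) \<phi>"
  shows "adjoint_L2 M N T \<phi> = \<eta>"
  unfolding adjoint_L2_def
proof (rule the_equality)
  fix \<eta>' assume "\<eta>' \<in> L2 M \<and> (\<forall>\<psi>\<in>L2 M. inner_L2 M \<psi> \<eta>' = inner_L2 N (T \<psi>) \<phi>)"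
  then show "\<eta>' = \<eta>" using assms by (intro L2_eqI) auto
qed (use assms in auto)

section \<open>Translations in the space of integrable functions\<close>

definition L1_translation_continuous :: "(real \<Rightarrow> complex) \<Rightarrow> bool" where
  "L1_translation_continuous f \<longleftrightarrow>
     (\<forall>e>0. \<exists>d>0. \<forall>u. \<bar>u\<bar> < d \<longrightarrow> (LINT t|lborel. cmod (f (t + u) - f t)) < e)"

lemma integrable_translate:
  fixes f :: "real \<Rightarrow> 'a :: {banach, second_countable_topology}"
  assumes "integrable lborel f" shows "integrable lborel (\<lambda>t. f (t + u))"
  using lborel_integrable_real_affine[OF assms, of 1 u] by (simp add: add.commute)

lemma integral_translate:
  fixes f :: "real \<Rightarrow> 'a :: {banach, second_countable_topology}"
  shows "(LINT t|lborel. f (t + u)) = (LINT t|lborel. f t)"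
  using lborel_integral_real_affine[of 1 f u] by (simp add: add.commute)

text \<open>
  Translation is an isometry of \<open>L\<^sup>1\<close>, so the functions on which it acts continuously form a closed set.
\<close>

lemma L1_translation_continuous_approx:
  assumes f: "integrable lborel f"
    and approx: "\<And>e. 0 < e \<Longrightarrow> \<exists>g. integrable lborel g \<and> L1_translation_continuous g \<and>
                   (LINT t|lborel. cmod (f t - g t)) < e"
  shows "L1_translation_continuous f"
  unfolding L1_translation_continuous_def
proof (intro allI impI)
  fix e :: real assume "0 < e"
  then obtain g where g: "integrable lborel g" and tg: "L1_translation_continuous g"
    and fg: "(LINT t|lborel. cmod (f t - g t)) < e / 3"
    using approx[of "e/3"] by auto
  obtain d where "0 < d" and d: "\<And>u. \<bar>u\<bar> < d \<Longrightarrow> (LINT t|lborel. cmod (g (t + u) - g t)) < e / 3"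
    using tg \<open>0 < e\<close> unfolding L1_translation_continuous_def by (meson divide_pos_pos zero_less_numeral)
  have "(LINT t|lborel. cmod (f (t + u) - f t)) < e" if "\<bar>u\<bar> < d" for u
  proof -
    have fgu: "integrable lborel (\<lambda>t. cmod (f (t + u) - g (t + u)))"
      using f g by (intro integrable_norm Bochner_Integration.integrable_diff integrable_translate)
    have ggu: "integrable lborel (\<lambda>t. cmod (g (t + u) - g t))"
      using g by (intro integrable_norm Bochner_Integration.integrable_diff integrable_translate)
    have fg': "integrable lborel (\<lambda>t. cmod (f t - g t))"
      using f g by (intro integrable_norm Bochner_Integration.integrable_diff)
    have "(LINT t|lborel. cmod (f (t + u) - f t))
        \<le> (LINT t|lborel. cmod (f (t + u) - g (t + u)) + cmod (g (t + u) - g t) + cmod (f t - g t))"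
    proof (rule integral_mono)
      show "integrable lborel (\<lambda>t. cmod (f (t + u) - f t))"
        using f by (intro integrable_norm Bochner_Integration.integrable_diff integrable_translate)
      show "integrable lborel (\<lambda>t. cmod (f (t + u) - g (t + u)) + cmod (g (t + u) - g t) + cmod (f t - g t))"
        by (intro Bochner_Integration.integrable_add fgu ggu fg')
      fix t
      have eq: "f (t + u) - f t = (f (t + u) - g (t + u)) + (g (t + u) - g t) - (f t - g t)" by simp
      show "cmod (f (t + u) - f t) \<le> cmod (f (t + u) - g (t + u)) + cmod (g (t + u) - g t) + cmod (f t - g t)"
        unfolding eq
        using norm_triangle_ineq4[of "(f (t + u) - g (t + u)) + (g (t + u) - g t)" "f t - g t"]
          norm_triangle_ineq[of "f (t + u) - g (t + u)" "g (t + u) - g t"] by linarith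
    qed
    also have "\<dots> = (LINT t|lborel. cmod (f (t + u) - g (t + u))) + (LINT t|lborel. cmod (g (t + u) - g t))
                    + (LINT t|lborel. cmod (f t - g t))"
      using fgu ggu fg' by simp
    also have "(LINT t|lborel. cmod (f (t + u) - g (t + u))) = (LINT t|lborel. cmod (f t - g t))"
      by (rule integral_translate)
    finally show ?thesis using fg d[OF that] by simp
  qed
  then show "\<exists>d>0. \<forall>u. \<bar>u\<bar> < d \<longrightarrow> (LINT t|lborel. cmod (f (t + u) - f t)) < e"
    using \<open>0 < d\<close> by blast
qed

text \<open>
  For an open set the positive part of \<open>1\<^sub>T - 1\<^sub>T(\<cdot> + u)\<close> tends to zero pointwise, so its integral tends
  to zero; the negative part has the same integral, because translation preserves the measure of \<open>T\<close>.
\<close>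

lemma L1_translation_continuous_open:
  assumes T: "open T" and fin: "emeasure lborel T < \<infinity>"
  shows "L1_translation_continuous (indicator T)"
proof (rule ccontr)
  assume "\<not> ?thesis"
  then obtain e where "0 < e"
    and bad: "\<And>d. 0 < d \<Longrightarrow> \<exists>u. \<bar>u\<bar> < d \<and> e \<le> (LINT t|lborel. cmod (indicator T (t + u) - indicator T t))"
    unfolding L1_translation_continuous_def by (meson not_less)
  have "\<forall>n. \<exists>u. \<bar>u\<bar> < 1 / real (Suc n) \<and> e \<le> (LINT t|lborel. cmod (indicator T (t + u) - indicator T t))"
    using bad by simp
  from choice[OF this] obtain u where u: "\<And>n. \<bar>u n\<bar> < 1 / real (Suc n)"
    and ue: "\<And>n. e \<le> (LINT t|lborel. cmod (indicator T (t + u n) - indicator T t))" by blast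
  have u0: "u \<longlonglongrightarrow> 0"
  proof (rule tendsto_0_le[OF LIMSEQ_inverse_real_of_nat, of _ 1], intro always_eventually allI)
    show "norm (u n) \<le> norm (inverse (real (Suc n))) * 1" for n
      using less_imp_le[OF u[of n]] by (simp add: inverse_eq_divide)
  qed
  have [measurable]: "T \<in> sets borel" using T by simp
  let ?i = "indicator T :: real \<Rightarrow> real"
  have int: "integrable lborel ?i" using fin by (simp add: less_top)
  have intu: "integrable lborel (\<lambda>t. ?i (t + u n))" for n by (rule integrable_translate[OF int])
  have eq: "(LINT t|lborel. cmod (indicator T (t + u n) - indicator T t)) = 2 * (LINT t|lborel. max 0 (?i t - ?i (t + u n)))" for n
  proof -
    have "(LINT t|lborel. cmod (indicator T (t + u n) - indicator T t))
        = (LINT t|lborel. 2 * max 0 (?i t - ?i (t + u n)) + (?i (t + u n) - ?i t))"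
      by (intro Bochner_Integration.integral_cong refl) (auto simp: indicator_def)
    also have "\<dots> = 2 * (LINT t|lborel. max 0 (?i t - ?i (t + u n))) + ((LINT t|lborel. ?i (t + u n)) - (LINT t|lborel. ?i t))"
      using int intu by (subst Bochner_Integration.integral_add) (auto intro!: integrable_max)
    also have "(LINT t|lborel. ?i (t + u n)) = (LINT t|lborel. ?i t)" by (rule integral_translate)
    finally show ?thesis by simp
  qed
  have "(\<lambda>n. LINT t|lborel. max 0 (?i t - ?i (t + u n))) \<longlonglongrightarrow> integral\<^sup>L lborel (\<lambda>t::real. 0::real)"
  proof (rule integral_dominated_convergence[where w="?i"])
    show "AE t in lborel. (\<lambda>n. max 0 (?i t - ?i (t + u n))) \<longlonglongrightarrow> 0"
    proof (intro AE_I2)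
      fix t
      show "(\<lambda>n. max 0 (?i t - ?i (t + u n))) \<longlonglongrightarrow> 0"
      proof (cases "t \<in> T")
        case True
        have "(\<lambda>n. t + u n) \<longlonglongrightarrow> t + 0" by (intro tendsto_intros u0)
        then have "eventually (\<lambda>n. t + u n \<in> T) sequentially"
          using T True by (intro topological_tendstoD) auto
        then have "eventually (\<lambda>n. max 0 (?i t - ?i (t + u n)) = 0) sequentially"
          by eventually_elim (simp add: True)
        then show ?thesis by (rule tendsto_eventually)
      qed simp
    qed
  qed (auto simp: int indicator_def intro!: AE_I2)
  then have "(\<lambda>n. 2 * (LINT t|lborel. max 0 (?i t - ?i (t + u n)))) \<longlonglongrightarrow> 2 * 0"
    by (intro tendsto_intros) simp
  then have "e \<le> 0"
    by (intro LIMSEQ_le_const[where X="\<lambda>n. 2 * (LINT t|lborel. max 0 (?i t - ?i (t + u n)))"])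
       (use ue eq in auto)
  with \<open>0 < e\<close> show False by simp
qed

lemma L1_translation_continuous_scale:
  assumes "L1_translation_continuous f"
  shows "L1_translation_continuous (\<lambda>t. c * f t)"
  unfolding L1_translation_continuous_def
proof (intro allI impI)
  fix e :: real assume "0 < e"
  have "0 < e / (cmod c + 1)" using \<open>0 < e\<close> by (intro divide_pos_pos) (auto intro: add_nonneg_pos)
  then obtain d where "0 < d"
    and d: "\<And>u. \<bar>u\<bar> < d \<Longrightarrow> (LINT t|lborel. cmod (f (t + u) - f t)) < e / (cmod c + 1)"
    using assms unfolding L1_translation_continuous_def by blast
  have "(LINT t|lborel. cmod (c * f (t + u) - c * f t)) < e" if "\<bar>u\<bar> < d" for u
  proof -
    have "(LINT t|lborel. cmod (c * f (t + u) - c * f t)) = cmod c * (LINT t|lborel. cmod (f (t + u) - f t))"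
      by (simp add: norm_mult flip: right_diff_distrib)
    also have "\<dots> \<le> (cmod c + 1) * (LINT t|lborel. cmod (f (t + u) - f t))"
      by (intro mult_right_mono) auto
    also have "\<dots> < e"
      using d[OF that] by (subst (asm) pos_less_divide_eq) (auto intro: add_nonneg_pos simp: mult.commute)
    finally show ?thesis .
  qed
  then show "\<exists>d>0. \<forall>u. \<bar>u\<bar> < d \<longrightarrow> (LINT t|lborel. cmod (c * f (t + u) - c * f t)) < e"
    using \<open>0 < d\<close> by blast
qed

lemma L1_translation_continuous_add:
  assumes fi: "integrable lborel f" and gi: "integrable lborel g"
    and f: "L1_translation_continuous f" and g: "L1_translation_continuous g"
  shows "L1_translation_continuous (\<lambda>t. f t + g t)"
  unfolding L1_translation_continuous_def
proof (intro allI impI)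
  fix e :: real assume "0 < e"
  then have "0 < e / 2" by simp
  obtain d1 where "0 < d1"
    and d1: "\<And>u. \<bar>u\<bar> < d1 \<Longrightarrow> (LINT t|lborel. cmod (f (t + u) - f t)) < e / 2"
    using f \<open>0 < e / 2\<close> unfolding L1_translation_continuous_def by blast
  obtain d2 where "0 < d2"
    and d2: "\<And>u. \<bar>u\<bar> < d2 \<Longrightarrow> (LINT t|lborel. cmod (g (t + u) - g t)) < e / 2"
    using g \<open>0 < e / 2\<close> unfolding L1_translation_continuous_def by blast
  have "(LINT t|lborel. cmod (f (t + u) + g (t + u) - (f t + g t))) < e" if "\<bar>u\<bar> < min d1 d2" for u
  proof -
    have ii: "integrable lborel (\<lambda>t. cmod (f (t + u) - f t))" "integrable lborel (\<lambda>t. cmod (g (t + u) - g t))"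
      using fi gi by (auto intro!: integrable_norm Bochner_Integration.integrable_diff integrable_translate)
    have "(LINT t|lborel. cmod (f (t + u) + g (t + u) - (f t + g t)))
        \<le> (LINT t|lborel. cmod (f (t + u) - f t) + cmod (g (t + u) - g t))"
    proof (rule integral_mono)
      show "integrable lborel (\<lambda>t. cmod (f (t + u) + g (t + u) - (f t + g t)))"
        using fi gi by (intro integrable_norm Bochner_Integration.integrable_diff
            Bochner_Integration.integrable_add integrable_translate)
      show "cmod (f (t + u) + g (t + u) - (f t + g t)) \<le> cmod (f (t + u) - f t) + cmod (g (t + u) - g t)" for t
        by (rule norm_diff_triangle_ineq)
    qed (use ii in auto)
    also have "\<dots> < e" using d1[of u] d2[of u] that ii by simp
    finally show ?thesis .
  qed
  then show "\<exists>d>0. \<forall>u. \<bar>u\<bar> < d \<longrightarrow> (LINT t|lborel. cmod (f (t + u) + g (t + u) - (f t + g t))) < e"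
    using \<open>0 < d1\<close> \<open>0 < d2\<close> by (intro exI[of _ "min d1 d2"]) auto
qed

lemma integrable_complex_indicator:
  assumes "A \<in> sets M" "emeasure M A < \<infinity>"
  shows "integrable M (indicator A :: 'a \<Rightarrow> complex)"
proof -
  have "(indicator A :: 'a \<Rightarrow> complex) = (\<lambda>x. complex_of_real (indicator A x))"
    by (auto simp: indicator_def)
  then show ?thesis using assms by (simp add: less_top)
qed

text \<open>
  Measurable sets of finite measure are approximated from outside by open sets; the integrable functions follow by
  linearity and by approximation.
\<close>

theorem integrable_imp_L1_translation_continuous:
  assumes "integrable lborel f" shows "L1_translation_continuous f"
  using assms
proof (induction rule: integrable_induct)
  case (base A c)
  have A: "A \<in> sets lborel" "emeasure lborel A < \<infinity>" using base by auto
  have iA: "integrable lborel (indicator A :: real \<Rightarrow> complex)"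
    by (rule integrable_complex_indicator[OF A])
  have "L1_translation_continuous (indicator A)"
  proof (rule L1_translation_continuous_approx[OF iA])
    fix e :: real assume e: "0 < e"
    obtain T where T: "open T" "A \<subseteq> T" "emeasure lebesgue (T - A) < ennreal e"
      by (rule sets_lebesgue_outer_open[of A e]) (use A e in auto)
    have Tb: "T \<in> sets borel" using T(1) by simp
    have TA: "emeasure lborel (T - A) < ennreal e"
      using T(3) A Tb by simp
    have "emeasure lborel T = emeasure lborel (A \<union> (T - A))" using T(2) by (simp add: Un_absorb1)
    also have "\<dots> \<le> emeasure lborel A + emeasure lborel (T - A)"
      using A Tb by (intro emeasure_subadditive) auto
    also have "\<dots> < \<infinity>" using A(2) less_trans[OF TA ennreal_less_top] by simp
    finally have Tf: "emeasure lborel T < \<infinity>" .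
    have iT: "integrable lborel (indicator T :: real \<Rightarrow> complex)"
      using Tb Tf by (intro integrable_complex_indicator) auto
    have "(LINT t|lborel. cmod (indicator A t - indicator T t)) = (LINT t|lborel. indicator (T - A) t)"
      by (intro Bochner_Integration.integral_cong refl) (use T(2) in \<open>auto simp: indicator_def\<close>)
    also have "\<dots> = measure lborel (T - A)" using A Tb by simp
    also have "\<dots> < e"
    proof -
      have "emeasure lborel (T - A) = ennreal (measure lborel (T - A))"
        using less_trans[OF TA ennreal_less_top] by (intro emeasure_eq_ennreal_measure) auto
      then show ?thesis using TA by (simp add: ennreal_less_iff)
    qed
    finally have "(LINT t|lborel. cmod (indicator A t - indicator T t)) < e" .
    then show "\<exists>g. integrable lborel g \<and> L1_translation_continuous g \<and>
                   (LINT t|lborel. cmod (indicator A t - g t)) < e"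
      using iT L1_translation_continuous_open[OF T(1) Tf] by blast
  qed
  then have "L1_translation_continuous (\<lambda>t. c * indicator A t)" by (rule L1_translation_continuous_scale)
  moreover have "(\<lambda>t. c * indicator A t) = (\<lambda>t. indicat_real A t *\<^sub>R c)" by (auto simp: indicator_def)
  ultimately show ?case by simp
next
  case (add f g)
  then show ?case by (intro L1_translation_continuous_add)
next
  case (lim f s)
  show ?case
  proof (rule L1_translation_continuous_approx[OF \<open>integrable lborel f\<close>])
    fix e :: real assume "0 < e"
    have "(\<lambda>i. LINT t|lborel. cmod (f t - s i t)) \<longlonglongrightarrow> integral\<^sup>L lborel (\<lambda>t::real. 0::real)"
    proof (rule integral_dominated_convergence[where w="\<lambda>t. 3 * cmod (f t)"])
      have [measurable]: "f \<in> borel_measurable lborel" using lim by auto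
      have [measurable]: "s i \<in> borel_measurable lborel" for i using lim by auto
      show "(\<lambda>t. cmod (f t - s i t)) \<in> borel_measurable lborel" for i by measurable
      show "integrable lborel (\<lambda>t. 3 * cmod (f t))" using lim by simp
      show "AE t in lborel. (\<lambda>i. cmod (f t - s i t)) \<longlonglongrightarrow> 0"
      proof (intro AE_I2)
        fix t
        have "(\<lambda>i. s i t) \<longlonglongrightarrow> f t" using lim by simp
        then have "(\<lambda>i. cmod (f t - s i t)) \<longlonglongrightarrow> cmod (f t - f t)" by (intro tendsto_intros)
        then show "(\<lambda>i. cmod (f t - s i t)) \<longlonglongrightarrow> 0" by simp
      qed
      show "AE t in lborel. norm (cmod (f t - s i t)) \<le> 3 * cmod (f t)" for i
      proof (intro AE_I2)
        fix t
        have "cmod (s i t) \<le> 2 * cmod (f t)" using lim by simp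
        then show "norm (cmod (f t - s i t)) \<le> 3 * cmod (f t)"
          using norm_triangle_ineq4[of "f t" "s i t"] by simp
      qed
    qed simp
    then have "eventually (\<lambda>i. (LINT t|lborel. cmod (f t - s i t)) < e) sequentially"
      using \<open>0 < e\<close> by (intro order_tendstoD) auto
    then obtain i where "(LINT t|lborel. cmod (f t - s i t)) < e" by (auto simp: eventually_sequentially)
    then show "\<exists>g. integrable lborel g \<and> L1_translation_continuous g \<and> (LINT t|lborel. cmod (f t - g t)) < e"
      using lim by blast
  qed
qed

section \<open>Plancherel's theorem\<close>

abbreviation (input) wave :: "real \<Rightarrow> complex" where
  "wave y \<equiv> exp (- \<i> * complex_of_real y)"

definition fourier :: "(real \<Rightarrow> complex) \<Rightarrow> real \<Rightarrow> complex" where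
  "fourier f x = complex_of_real (1 / sqrt (2 * pi)) *
     (LINT t|lborel. wave (x * t) * f t)"

lemma norm_exp_ii [simp]: "cmod (wave x) = 1"
  using norm_exp_i_times[of "- x"] by simp

lemma borel_measurable_character [measurable (raw)]:
  assumes "f \<in> borel_measurable M"
  shows "(\<lambda>x. wave (f x)) \<in> borel_measurable M"
  by (rule measurable_compose[OF assms, of "\<lambda>y. wave y" borel])
     (auto intro!: borel_measurable_continuous_onI continuous_intros)

lemma integrable_character_mult:
  assumes "integrable lborel f"
  shows "integrable lborel (\<lambda>t. wave (x * t) * f t)"
proof (rule Bochner_Integration.integrable_bound[OF integrable_norm[OF assms]])
  have [measurable]: "f \<in> borel_measurable lborel" using assms by auto
  show "(\<lambda>t. wave (x * t) * f t) \<in> borel_measurable lborel" by measurable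
qed (simp add: norm_mult del: of_real_mult)

lemma fourier_bound:
  assumes "integrable lborel f"
  shows "cmod (fourier f x) \<le> 1 / sqrt (2 * pi) * (LINT t|lborel. cmod (f t))"
proof -
  have "cmod (LINT t|lborel. wave (x * t) * f t)
      \<le> (LINT t|lborel. cmod (wave (x * t) * f t))"
    by (rule integral_norm_bound)
  also have "\<dots> = (LINT t|lborel. cmod (f t))"
    by (simp add: norm_mult del: of_real_mult)
  finally show ?thesis
    unfolding fourier_def norm_mult norm_of_real
    by (intro mult_mono) auto
qed

lemma fourier_add:
  assumes "integrable lborel f" "integrable lborel g"
  shows "fourier (\<lambda>t. f t + g t) x = fourier f x + fourier g x"
  unfolding fourier_def
  using integrable_character_mult[OF assms(1), of x] integrable_character_mult[OF assms(2), of x]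
  by (simp add: distrib_left del: of_real_mult)

lemma fourier_diff:
  assumes "integrable lborel f" "integrable lborel g"
  shows "fourier (\<lambda>t. f t - g t) x = fourier f x - fourier g x"
  unfolding fourier_def
  using integrable_character_mult[OF assms(1), of x] integrable_character_mult[OF assms(2), of x]
  by (simp add: right_diff_distrib del: of_real_mult)

lemma fourier_cmult: "fourier (\<lambda>t. c * f t) x = c * fourier f x"
proof -
  have "(LINT t|lborel. wave (x * t) * (c * f t))
      = (LINT t|lborel. c * (wave (x * t) * f t))"
    by (simp add: mult.left_commute)
  then show ?thesis unfolding fourier_def by simp
qed

lemma fourier_cnj: "fourier (\<lambda>t. cnj (f t)) x = cnj (fourier f (- x))"
proof -
  have "cnj (LINT t|lborel. wave (- x * t) * f t)
      = (LINT t|lborel. wave (x * t) * cnj (f t))"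
    by (subst Bochner_Integration.integral_cnj[symmetric]) (simp add: exp_cnj)
  then show ?thesis unfolding fourier_def by simp
qed

lemma fourier_cong_AE:
  assumes "f \<in> borel_measurable lborel" "g \<in> borel_measurable lborel" "AE t in lborel. f t = g t"
  shows "fourier f x = fourier g x"
proof -
  have [measurable]: "f \<in> borel_measurable lborel" "g \<in> borel_measurable lborel" by fact+
  have "(LINT t|lborel. wave (x * t) * f t) = (LINT t|lborel. wave (x * t) * g t)"
    by (rule integral_cong_AE) (use assms(3) in \<open>auto simp del: of_real_mult\<close>)
  then show ?thesis by (simp add: fourier_def)
qed

lemma continuous_fourier:
  assumes "integrable lborel f" shows "continuous_on UNIV (fourier f)"
  unfolding continuous_on_eq_continuous_at[OF open_UNIV] continuous_at_sequentially
proof (intro ballI allI impI)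
  fix x and u :: "nat \<Rightarrow> real" assume u: "u \<longlonglongrightarrow> x"
  have [measurable]: "f \<in> borel_measurable lborel" using assms by auto
  have "(\<lambda>n. LINT t|lborel. wave (u n * t) * f t)
     \<longlonglongrightarrow> (LINT t|lborel. wave (x * t) * f t)"
  proof (rule integral_dominated_convergence[where w="\<lambda>t. cmod (f t)"])
    show "AE t in lborel. (\<lambda>n. wave (u n * t) * f t) \<longlonglongrightarrow> wave (x * t) * f t"
      by (intro AE_I2 tendsto_intros u)
  qed (use assms in \<open>auto simp: norm_mult simp del: of_real_mult\<close>)
  then show "(fourier f \<circ> u) \<longlonglongrightarrow> fourier f x"
    unfolding fourier_def comp_def by (intro tendsto_intros)
qed

lemma borel_measurable_fourier:
  "integrable lborel f \<Longrightarrow> fourier f \<in> borel_measurable lborel"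
  using borel_measurable_continuous_onI[OF continuous_fourier] by simp

lemma integrable_character_kernel:
  assumes f: "integrable lborel f" and g: "integrable lborel g"
  shows "integrable (lborel \<Otimes>\<^sub>M lborel) (\<lambda>(x, t). wave (x * t) * f t * g x)"
proof (rule lborel_pair.Fubini_integrable)
  have [measurable]: "f \<in> borel_measurable borel" "g \<in> borel_measurable borel" using f g by auto
  show "(\<lambda>(x, t). wave (x * t) * f t * g x) \<in> borel_measurable (lborel \<Otimes>\<^sub>M lborel)"
    by measurable
  show "integrable lborel (\<lambda>x. LINT t|lborel. norm (case (x, t) of (x, t) \<Rightarrow> wave (x * t) * f t * g x))"
    using g by (simp add: norm_mult del: of_real_mult)
  show "AE x in lborel. integrable lborel (\<lambda>t. case (x, t) of (x, t) \<Rightarrow> wave (x * t) * f t * g x)"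
    using integrable_character_mult[OF f] by (auto simp del: of_real_mult)
qed

text \<open>
  Fubini's theorem for the bounded kernel \<open>wave (x * t)\<close>, which is symmetric in \<open>x\<close> and \<open>t\<close>.
\<close>

lemma fourier_multiplication_formula:
  assumes f: "integrable lborel f" and g: "integrable lborel g"
  shows "(LINT x|lborel. fourier f x * g x) = (LINT t|lborel. f t * fourier g t)"
proof -
  let ?c = "complex_of_real (1 / sqrt (2 * pi))"
  have "(LINT x|lborel. fourier f x * g x)
      = (LINT x|lborel. ?c * (LINT t|lborel. wave (x * t) * f t * g x))"
    unfolding fourier_def integral_mult_left_zero
    by (rule Bochner_Integration.integral_cong) (simp_all only: mult.assoc)
  also have "\<dots> = ?c * (LINT x|lborel. LINT t|lborel. wave (x * t) * f t * g x)" by simp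
  also have "(LINT x|lborel. LINT t|lborel. wave (x * t) * f t * g x)
      = (LINT t|lborel. LINT x|lborel. wave (x * t) * f t * g x)"
    by (rule lborel_pair.Fubini_integral[symmetric]) (rule integrable_character_kernel[OF f g])
  also have "?c * \<dots> = (LINT t|lborel. f t * (?c * (LINT x|lborel. wave (t * x) * g x)))"
    by (simp add: mult_ac flip: integral_mult_right_zero)
  finally show ?thesis unfolding fourier_def .
qed

lemma integrable_gauss:
  assumes "0 < e" shows "integrable lborel (\<lambda>x. complex_of_real (exp (- (e * x)\<^sup>2 / 2)))"
proof -
  have "integrable lborel (\<lambda>x. std_normal_density x)"
    by (rule integrable_normal_density) simp
  then have "integrable lborel (\<lambda>x. sqrt (2 * pi) * std_normal_density (0 + e * x))"
    using assms by (intro integrable_mult_right lborel_integrable_real_affine) auto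
  then have "integrable lborel (\<lambda>x. exp (- (e * x)\<^sup>2 / 2))"
    by (simp add: std_normal_density_def)
  then show ?thesis by (rule integrable_of_real)
qed

text \<open>
  The right-hand side is \<open>sqrt (2 \<pi>)\<close> times the density of the normal distribution with standard deviation \<open>e\<close>, so
  it concentrates at zero when \<open>e\<close> tends to zero. The formula rescales the characteristic function of the standard
  normal distribution.
\<close>

lemma fourier_gauss:
  assumes e: "0 < e"
  shows "fourier (\<lambda>x. complex_of_real (exp (- (e * x)\<^sup>2 / 2))) u = complex_of_real (exp (- (u / e)\<^sup>2 / 2) / e)"
proof -
  have "complex_of_real (exp (- (u / e)\<^sup>2 / 2)) = char std_normal_distribution (- u / e)"
    by (simp add: char_std_normal_distribution)
  also have "\<dots> = (LINT x|lborel. std_normal_density x *\<^sub>R exp (\<i> * complex_of_real (- u / e * x)))"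
    unfolding char_def by (subst integral_density) auto
  also have "\<dots> = \<bar>e\<bar> *\<^sub>R (LINT x|lborel. std_normal_density (0 + e * x) *\<^sub>R exp (\<i> * complex_of_real (- u / e * (0 + e * x))))"
    using e by (intro lborel_integral_real_affine) simp
  also have "\<dots> = e *\<^sub>R (LINT x|lborel. complex_of_real (1 / sqrt (2 * pi)) * (wave (u * x) * complex_of_real (exp (- (e * x)\<^sup>2 / 2))))"
    using e by (simp add: std_normal_density_def scaleR_conv_of_real mult_ac)
  also have "\<dots> = e *\<^sub>R fourier (\<lambda>x. complex_of_real (exp (- (e * x)\<^sup>2 / 2))) u"
    unfolding fourier_def by simp
  finally show ?thesis using e by (simp add: scaleR_conv_of_real field_simps)
qed


lemma fourier_modulation:
  "fourier (\<lambda>x. cnj (wave (x * t)) * f x) s = fourier f (s - t)"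
proof -
  have "wave (s * x) * (cnj (wave (x * t)) * f x)
      = wave ((s - t) * x) * f x" for x
  proof -
    have c: "cnj (wave (x * t)) = exp (\<i> * complex_of_real (x * t))"
      by (simp add: exp_cnj)
    have "- \<i> * complex_of_real ((s - t) * x) = - \<i> * complex_of_real (s * x) + \<i> * complex_of_real (x * t)"
      by (simp add: algebra_simps)
    then have "wave ((s - t) * x) = wave (s * x) * exp (\<i> * complex_of_real (x * t))"
      by (simp only: exp_add)
    then show ?thesis by (simp only: c mult.assoc)
  qed
  then show ?thesis unfolding fourier_def by (simp only:)
qed

lemma integrable_bounded_mult:
  fixes f g :: "'a \<Rightarrow> complex"
  assumes "integrable M f" "g \<in> borel_measurable M" "\<And>x. cmod (g x) \<le> B"
  shows "integrable M (\<lambda>x. f x * g x)"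
proof (rule Bochner_Integration.integrable_bound)
  show "integrable M (\<lambda>x. B * cmod (f x))" using assms(1) by simp
  show "(\<lambda>x. f x * g x) \<in> borel_measurable M" using assms by measurable
  show "AE x in M. norm (f x * g x) \<le> norm (B * cmod (f x))"
  proof (intro AE_I2)
    fix x
    have "cmod (f x) * cmod (g x) \<le> cmod (f x) * B" by (intro mult_left_mono assms) simp
    also have "\<dots> \<le> norm (B * cmod (f x))" by (simp add: mult.commute)
    finally show "norm (f x * g x) \<le> norm (B * cmod (f x))" by (simp add: norm_mult)
  qed
qed

text \<open>
  Two applications of the multiplication formula move the transform from \<open>f\<close> and from \<open>cnj f\<close> to the Gaussian weight,
  whose transform is again a Gaussian; the substitution \<open>s = t + e * z\<close> makes its density standard.
\<close>

lemma fourier_gauss_regularized: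
  assumes f: "integrable lborel f" and e: "0 < e"
  shows "(LINT x|lborel. fourier f x * (complex_of_real (exp (- (e * x)\<^sup>2 / 2)) * cnj (fourier f x)))
       = (LINT t|lborel. f t * cnj (LINT z|lborel. std_normal_density z *\<^sub>R f (t + e * z)))"
proof -
  let ?w = "\<lambda>x. complex_of_real (exp (- (e * x)\<^sup>2 / 2))"
  let ?c = "complex_of_real (1 / sqrt (2 * pi))"
  let ?ex = "\<lambda>x t. wave (x * t)"
  have [measurable]: "fourier f \<in> borel_measurable borel" "f \<in> borel_measurable borel"
    using borel_measurable_fourier[OF f] f by auto
  have h: "integrable lborel (\<lambda>x. ?w x * cnj (fourier f x))"
    by (rule integrable_bounded_mult[OF integrable_gauss[OF e]])
       (use fourier_bound[OF f] in auto)
  have ew: "integrable lborel (\<lambda>x. cnj (?ex x t) * ?w x)" for t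
  proof -
    have "integrable lborel (\<lambda>x. ?w x * cnj (?ex x t))"
      by (rule integrable_bounded_mult[OF integrable_gauss[OF e], where B=1]) (auto simp del: of_real_mult)
    then show ?thesis by (simp only: mult.commute)
  qed
  have inner: "fourier (\<lambda>x. ?w x * cnj (fourier f x)) t = cnj (LINT z|lborel. std_normal_density z *\<^sub>R f (t + e * z))" for t
  proof -
    have "cnj (fourier (\<lambda>x. ?w x * cnj (fourier f x)) t) = ?c * cnj (LINT x|lborel. ?ex t x * (?w x * cnj (fourier f x)))"
      unfolding fourier_def by simp
    also have "cnj (LINT x|lborel. ?ex t x * (?w x * cnj (fourier f x))) = (LINT x|lborel. fourier f x * (cnj (?ex x t) * ?w x))"
      by (subst Bochner_Integration.integral_cnj[symmetric], rule Bochner_Integration.integral_cong)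
         (simp_all add: mult_ac)
    also have "\<dots> = (LINT s|lborel. f s * fourier (\<lambda>x. cnj (?ex x t) * ?w x) s)"
      by (rule fourier_multiplication_formula[OF f ew])
    also have "\<dots> = (LINT s|lborel. f s * complex_of_real (exp (- ((s - t) / e)\<^sup>2 / 2) / e))"
      by (simp only: fourier_modulation fourier_gauss[OF e])
    also have "\<dots> = \<bar>e\<bar> *\<^sub>R (LINT z|lborel. f (t + e * z) * complex_of_real (exp (- ((t + e * z - t) / e)\<^sup>2 / 2) / e))"
      using e by (intro lborel_integral_real_affine) simp
    also have "\<dots> = \<bar>e\<bar> *\<^sub>R (LINT z|lborel. (1 / e) *\<^sub>R (complex_of_real (exp (- z\<^sup>2 / 2)) * f (t + e * z)))"
      using e by (intro arg_cong[where f="\<lambda>x. \<bar>e\<bar> *\<^sub>R x"] Bochner_Integration.integral_cong refl)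
        (simp add: scaleR_conv_of_real field_simps)
    also have "\<dots> = (LINT z|lborel. complex_of_real (exp (- z\<^sup>2 / 2)) * f (t + e * z))"
      using e by simp
    also have "?c * \<dots> = (LINT z|lborel. std_normal_density z *\<^sub>R f (t + e * z))"
      by (simp add: std_normal_density_def scaleR_conv_of_real mult.assoc flip: integral_mult_right_zero)
    finally have "cnj (cnj (fourier (\<lambda>x. ?w x * cnj (fourier f x)) t)) = cnj (LINT z|lborel. std_normal_density z *\<^sub>R f (t + e * z))"
      by (rule arg_cong)
    then show ?thesis by (simp only: complex_cnj_cnj)
  qed
  show ?thesis by (simp only: fourier_multiplication_formula[OF f h] inner)
qed

lemma gauss_average_norm_le:
  assumes f [measurable]: "f \<in> borel_measurable borel" and B: "\<And>t. cmod (f t) \<le> B"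
  shows "integrable lborel (\<lambda>z. std_normal_density z *\<^sub>R f (t + e * z))"
    and "cmod (LINT z|lborel. std_normal_density z *\<^sub>R f (t + e * z)) \<le> B"
proof -
  have bnd: "norm (std_normal_density z *\<^sub>R f (t + e * z)) \<le> std_normal_density z * B" for z
    using mult_left_mono[OF B normal_density_nonneg] by simp
  have iB: "integrable lborel (\<lambda>z. std_normal_density z * B)" by (intro integrable_mult_left integrable_normal_density) auto
  show int: "integrable lborel (\<lambda>z. std_normal_density z *\<^sub>R f (t + e * z))"
  proof (rule Bochner_Integration.integrable_bound[OF iB])
    show "AE z in lborel. norm (std_normal_density z *\<^sub>R f (t + e * z)) \<le> norm (std_normal_density z * B)"
      using order_trans[OF bnd abs_ge_self] by (intro AE_I2) simp
  qed measurable
  have "cmod (LINT z|lborel. std_normal_density z *\<^sub>R f (t + e * z)) \<le> (LINT z|lborel. norm (std_normal_density z *\<^sub>R f (t + e * z)))"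
    by (rule integral_norm_bound)
  also have "\<dots> \<le> (LINT z|lborel. std_normal_density z * B)"
    by (rule integral_mono[OF integrable_norm[OF int] iB bnd])
  also have "\<dots> = B" by simp
  finally show "cmod (LINT z|lborel. std_normal_density z *\<^sub>R f (t + e * z)) \<le> B" .
qed

text \<open>
  By Tonelli, the Gaussian average moves \<open>f\<close> in the \<open>L\<^sup>1\<close> norm by at most the Gaussian average of
  \<open>\<parallel>f(\<cdot> + e z) - f\<parallel>\<close>, which tends to zero by dominated convergence.
\<close>

lemma gauss_average_tendsto_L1:
  assumes f: "integrable lborel f" and B: "\<And>t. cmod (f t) \<le> B"
  shows "(\<lambda>k. \<integral>\<^sup>+t. ennreal (cmod ((LINT z|lborel. std_normal_density z *\<^sub>R f (t + inverse (real (Suc k)) * z)) - f t)) \<partial>lborel) \<longlonglongrightarrow> 0"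
proof -
  have [measurable]: "f \<in> borel_measurable borel" using f by auto
  define e where "e k = inverse (real (Suc k))" for k
  define \<omega> where "\<omega> u = (LINT t|lborel. cmod (f (t + u) - f t))" for u
  define F where "F = (LINT t|lborel. cmod (f t))"
  have if': "integrable lborel (\<lambda>t. cmod (f (t + u) - f t))" for u
    using f by (intro integrable_norm Bochner_Integration.integrable_diff integrable_translate)
  have \<omega>0: "0 \<le> \<omega> u" for u unfolding \<omega>_def by simp
  have \<omega>F: "\<omega> u \<le> 2 * F" for u
  proof -
    have "\<omega> u \<le> (LINT t|lborel. cmod (f (t + u)) + cmod (f t))"
      unfolding \<omega>_def using f
      by (intro integral_mono if' Bochner_Integration.integrable_add integrable_norm integrable_translate norm_triangle_ineq4)
    also have "\<dots> = 2 * F"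
      using f integrable_norm[OF integrable_translate[OF f, of u]] integral_translate[of "\<lambda>t. cmod (f t)" u]
      by (simp add: F_def)
    finally show ?thesis .
  qed
  have \<omega>_meas [measurable]: "\<omega> \<in> borel_measurable borel"
  proof -
    have "(\<lambda>u. LINT t|lborel. cmod (f (t + u) - f t)) \<in> borel_measurable borel"
      by (rule lborel.borel_measurable_lebesgue_integral) measurable
    then show ?thesis unfolding \<omega>_def .
  qed
  have \<omega>lim: "(\<lambda>k. \<omega> (e k * z)) \<longlonglongrightarrow> 0" for z
  proof (rule LIMSEQ_I)
    fix r :: real assume "0 < r"
    then obtain d where "0 < d" and d: "\<And>u. \<bar>u\<bar> < d \<Longrightarrow> \<omega> u < r"
      using integrable_imp_L1_translation_continuous[OF f]
      unfolding L1_translation_continuous_def \<omega>_def by blast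
    have "(\<lambda>k. e k * z) \<longlonglongrightarrow> 0 * z"
      unfolding e_def by (intro tendsto_intros LIMSEQ_inverse_real_of_nat)
    then have "eventually (\<lambda>k. norm (e k * z - 0) < d) sequentially"
      using \<open>0 < d\<close> by (auto simp: tendsto_iff dist_norm)
    then obtain K where K: "\<And>k. K \<le> k \<Longrightarrow> \<bar>e k * z\<bar> < d" by (auto simp: eventually_sequentially)
    show "\<exists>K. \<forall>k\<ge>K. norm (\<omega> (e k * z) - 0) < r"
      using d[OF K] \<omega>0 by (intro exI[of _ K]) simp
  qed
  have le: "(\<integral>\<^sup>+t. ennreal (cmod ((LINT z|lborel. std_normal_density z *\<^sub>R f (t + e k * z)) - f t)) \<partial>lborel)
      \<le> (\<integral>\<^sup>+z. ennreal (std_normal_density z * \<omega> (e k * z)) \<partial>lborel)" for k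
  proof -
    have pt: "ennreal (cmod ((LINT z|lborel. std_normal_density z *\<^sub>R f (t + e k * z)) - f t))
        \<le> (\<integral>\<^sup>+z. ennreal (std_normal_density z * cmod (f (t + e k * z) - f t)) \<partial>lborel)" for t
    proof -
      have i1: "integrable lborel (\<lambda>z. std_normal_density z *\<^sub>R f (t + e k * z))"
        by (rule gauss_average_norm_le(1)[of f, OF _ B]) measurable
      have i2: "integrable lborel (\<lambda>z. std_normal_density z *\<^sub>R f t)"
        by (intro integrable_scaleR_left integrable_normal_density) auto
      have "(LINT z|lborel. std_normal_density z *\<^sub>R f (t + e k * z)) - f t
          = (LINT z|lborel. std_normal_density z *\<^sub>R f (t + e k * z)) - (LINT z|lborel. std_normal_density z *\<^sub>R f t)"
        by simp
      also have "\<dots> = (LINT z|lborel. std_normal_density z *\<^sub>R (f (t + e k * z) - f t))"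
        using i1 i2 by (simp add: scaleR_right_diff_distrib)
      finally have eq: "(LINT z|lborel. std_normal_density z *\<^sub>R f (t + e k * z)) - f t
          = (LINT z|lborel. std_normal_density z *\<^sub>R (f (t + e k * z) - f t))" .
      have "integrable lborel (\<lambda>z. std_normal_density z *\<^sub>R (f (t + e k * z) - f t))"
        using Bochner_Integration.integrable_diff[OF i1 i2] by (simp add: scaleR_right_diff_distrib)
      from integral_norm_bound_ennreal[OF this] show ?thesis
        unfolding eq by simp
    qed
    have "(\<integral>\<^sup>+t. ennreal (cmod ((LINT z|lborel. std_normal_density z *\<^sub>R f (t + e k * z)) - f t)) \<partial>lborel)
        \<le> (\<integral>\<^sup>+t. \<integral>\<^sup>+z. ennreal (std_normal_density z * cmod (f (t + e k * z) - f t)) \<partial>lborel \<partial>lborel)"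
      by (intro nn_integral_mono pt)
    also have "\<dots> = (\<integral>\<^sup>+z. \<integral>\<^sup>+t. ennreal (std_normal_density z * cmod (f (t + e k * z) - f t)) \<partial>lborel \<partial>lborel)"
      by (rule lborel_pair.Fubini') measurable
    also have "\<dots> = (\<integral>\<^sup>+z. ennreal (std_normal_density z * \<omega> (e k * z)) \<partial>lborel)"
    proof (rule nn_integral_cong)
      fix z
      have "(\<integral>\<^sup>+t. ennreal (std_normal_density z * cmod (f (t + e k * z) - f t)) \<partial>lborel)
          = ennreal (LINT t|lborel. std_normal_density z * cmod (f (t + e k * z) - f t))"
        by (rule nn_integral_eq_integral) (use if' in auto)
      then show "(\<integral>\<^sup>+t. ennreal (std_normal_density z * cmod (f (t + e k * z) - f t)) \<partial>lborel)
          = ennreal (std_normal_density z * \<omega> (e k * z))" by (simp add: \<omega>_def)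
    qed
    finally show ?thesis .
  qed
  have "(\<lambda>k. \<integral>\<^sup>+z. ennreal (std_normal_density z * \<omega> (e k * z)) \<partial>lborel) \<longlonglongrightarrow> (\<integral>\<^sup>+(z::real). 0 \<partial>lborel)"
  proof (rule nn_integral_dominated_convergence[where w="\<lambda>z. ennreal (std_normal_density z * (2 * F))"])
    show "AE z in lborel. ennreal (std_normal_density z * \<omega> (e k * z)) \<le> ennreal (std_normal_density z * (2 * F))" for k
      by (intro AE_I2 ennreal_leI mult_left_mono \<omega>F) simp
    have "integrable lborel (\<lambda>z. std_normal_density z * (2 * F))"
      by (intro integrable_mult_left integrable_normal_density) auto
    then show "(\<integral>\<^sup>+z. ennreal (std_normal_density z * (2 * F)) \<partial>lborel) < \<infinity>"
      by (simp add: nn_integral_eq_integral F_def)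
    show "AE z in lborel. (\<lambda>k. ennreal (std_normal_density z * \<omega> (e k * z))) \<longlonglongrightarrow> 0"
    proof (intro AE_I2)
      fix z
      have "(\<lambda>k. ennreal (std_normal_density z * \<omega> (e k * z))) \<longlonglongrightarrow> ennreal (std_normal_density z * 0)"
        by (intro tendsto_ennrealI tendsto_mult tendsto_const \<omega>lim)
      then show "(\<lambda>k. ennreal (std_normal_density z * \<omega> (e k * z))) \<longlonglongrightarrow> 0" by simp
    qed
  qed measurable
  then have "(\<lambda>k. \<integral>\<^sup>+z. ennreal (std_normal_density z * \<omega> (e k * z)) \<partial>lborel) \<longlonglongrightarrow> 0" by simp
  from tendsto_sandwich[OF _ _ tendsto_const this, of "\<lambda>k. \<integral>\<^sup>+t. ennreal (cmod ((LINT z|lborel. std_normal_density z *\<^sub>R f (t + e k * z)) - f t)) \<partial>lborel"]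
  show ?thesis using le unfolding e_def by simp
qed

lemma sq_integrable_of_bounded:
  assumes f: "integrable M f" and B: "\<And>t. cmod (f t) \<le> B"
  shows "f \<in> sq_integrable M"
proof -
  have [measurable]: "f \<in> borel_measurable M" using f by auto
  have "integrable M (\<lambda>t. (cmod (f t))\<^sup>2)"
  proof (rule Bochner_Integration.integrable_bound[of M "\<lambda>t. B * cmod (f t)"])
    show "integrable M (\<lambda>t. B * cmod (f t))" using f by simp
    show "AE t in M. norm ((cmod (f t))\<^sup>2) \<le> norm (B * cmod (f t))"
    proof (intro AE_I2)
      fix t
      have "(cmod (f t))\<^sup>2 \<le> B * cmod (f t)" using mult_right_mono[OF B norm_ge_zero] by (simp add: power2_eq_square)
      then show "norm ((cmod (f t))\<^sup>2) \<le> norm (B * cmod (f t))" by simp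
    qed
  qed measurable
  then show ?thesis by (simp add: sq_integrable_def)
qed

text \<open>
  As \<open>e\<close> decreases to zero, the weighted integral of \<open>\<bar>fourier f\<bar>\<^sup>2\<close> increases to the full one, while its other
  expression tends to \<open>\<parallel>f\<parallel>\<^sup>2\<close>, because the Gaussian averages of \<open>f\<close> converge to \<open>f\<close> in \<open>L\<^sup>1\<close> and \<open>f\<close> is bounded.
\<close>

lemma fourier_isometry_bounded:
  assumes f: "integrable lborel f" and B: "\<And>t. cmod (f t) \<le> B"
  shows "fourier f \<in> sq_integrable lborel" "l2norm lborel (fourier f) = l2norm lborel f"
proof -
  have [measurable]: "f \<in> borel_measurable borel" "fourier f \<in> borel_measurable borel"
    using f borel_measurable_fourier[OF f] by auto
  have B0: "0 \<le> B" using order_trans[OF norm_ge_zero B] .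
  define e where "e k = inverse (real (Suc k))" for k
  have e0: "0 < e k" for k by (simp add: e_def)
  define w where "w k x = exp (- (e k * x)\<^sup>2 / 2)" for k x
  define A where "A k t = (LINT z|lborel. std_normal_density z *\<^sub>R f (t + e k * z))" for k t
  have A_meas [measurable]: "A k \<in> borel_measurable borel" for k
    unfolding A_def by (rule lborel.borel_measurable_lebesgue_integral) measurable
  have AB: "cmod (A k t) \<le> B" for k t
    unfolding A_def by (rule gauss_average_norm_le(2)[OF _ B]) measurable
  have wint: "integrable lborel (\<lambda>x. complex_of_real (w k x))" for k
    unfolding w_def by (rule integrable_gauss[OF e0])
  have fw: "integrable lborel (\<lambda>x. (cmod (fourier f x))\<^sup>2 * w k x)" for k
  proof -
    define C where "C = 1 / sqrt (2 * pi) * (LINT t|lborel. cmod (f t))"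
    have "integrable lborel (\<lambda>x. complex_of_real (w k x) * complex_of_real ((cmod (fourier f x))\<^sup>2))"
    proof (rule integrable_bounded_mult[OF wint])
      show "cmod (complex_of_real ((cmod (fourier f x))\<^sup>2)) \<le> C\<^sup>2" for x
        unfolding norm_of_real using fourier_bound[OF f, of x] by (simp add: C_def power_mono)
    qed measurable
    then have "integrable lborel (\<lambda>x. Re (complex_of_real (w k x) * complex_of_real ((cmod (fourier f x))\<^sup>2)))"
      by (rule integrable_Re)
    then show ?thesis by (simp add: mult.commute flip: of_real_mult of_real_power)
  qed
  have reg: "complex_of_real (LINT x|lborel. (cmod (fourier f x))\<^sup>2 * w k x) = (LINT t|lborel. f t * cnj (A k t))" for k
  proof -
    have "complex_of_real (LINT x|lborel. (cmod (fourier f x))\<^sup>2 * w k x)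
        = (LINT x|lborel. complex_of_real ((cmod (fourier f x))\<^sup>2 * w k x))"
      by (rule integral_complex_of_real[symmetric])
    also have "\<dots> = (LINT x|lborel. fourier f x * (complex_of_real (w k x) * cnj (fourier f x)))"
      by (intro Bochner_Integration.integral_cong refl) (simp only: of_real_mult complex_norm_square mult_ac)
    also have "\<dots> = (LINT t|lborel. f t * cnj (A k t))"
      unfolding w_def A_def by (rule fourier_gauss_regularized[OF f e0])
    finally show ?thesis .
  qed
  have fsq: "f \<in> sq_integrable lborel" by (rule sq_integrable_of_bounded[OF f B])
  have ff: "integrable lborel (\<lambda>t. f t * cnj (f t))"
    by (rule integrable_bounded_mult[OF f, of _ B]) (use B in auto)
  have fA: "integrable lborel (\<lambda>t. f t * cnj (A k t))" for k
    by (rule integrable_bounded_mult[OF f, of _ B]) (use AB in auto)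
  have norm_f: "(LINT t|lborel. f t * cnj (f t)) = complex_of_real ((l2norm lborel f)\<^sup>2)"
    using l2ip_self[of lborel f] by (simp add: l2ip_def mult.commute)
  have lim0: "(\<lambda>k. (LINT t|lborel. f t * cnj (A k t)) - (LINT t|lborel. f t * cnj (f t))) \<longlonglongrightarrow> 0"
  proof (rule tendsto_norm_zero_cancel, rule tendsto_ennrealD)
    have le: "ennreal (cmod ((LINT t|lborel. f t * cnj (A k t)) - (LINT t|lborel. f t * cnj (f t))))
        \<le> ennreal B * (\<integral>\<^sup>+t. ennreal (cmod (A k t - f t)) \<partial>lborel)" for k
    proof -
      have "(LINT t|lborel. f t * cnj (A k t)) - (LINT t|lborel. f t * cnj (f t)) = (LINT t|lborel. f t * cnj (A k t) - f t * cnj (f t))"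
        using fA ff by simp
      then have "ennreal (cmod ((LINT t|lborel. f t * cnj (A k t)) - (LINT t|lborel. f t * cnj (f t))))
          \<le> (\<integral>\<^sup>+t. ennreal (cmod (f t * cnj (A k t) - f t * cnj (f t))) \<partial>lborel)"
        using integral_norm_bound_ennreal[OF Bochner_Integration.integrable_diff[OF fA ff]] by simp
      also have "\<dots> \<le> (\<integral>\<^sup>+t. ennreal B * ennreal (cmod (A k t - f t)) \<partial>lborel)"
      proof (rule nn_integral_mono)
        fix t
        have "cmod (f t * cnj (A k t) - f t * cnj (f t)) = cmod (f t) * cmod (A k t - f t)"
          by (simp add: norm_mult flip: right_diff_distrib complex_cnj_diff)
        also have "\<dots> \<le> B * cmod (A k t - f t)" by (intro mult_right_mono B) simp
        finally show "ennreal (cmod (f t * cnj (A k t) - f t * cnj (f t))) \<le> ennreal B * ennreal (cmod (A k t - f t))"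
          using B0 by (simp add: ennreal_leI flip: ennreal_mult)
      qed
      also have "\<dots> = ennreal B * (\<integral>\<^sup>+t. ennreal (cmod (A k t - f t)) \<partial>lborel)"
        by (rule nn_integral_cmult) measurable
      finally show ?thesis .
    qed
    have "(\<lambda>k. ennreal B * (\<integral>\<^sup>+t. ennreal (cmod (A k t - f t)) \<partial>lborel)) \<longlonglongrightarrow> ennreal B * 0"
      unfolding A_def e_def by (intro ennreal_tendsto_cmult gauss_average_tendsto_L1[OF f B]) simp
    then have B_lim: "(\<lambda>k. ennreal B * (\<integral>\<^sup>+t. ennreal (cmod (A k t - f t)) \<partial>lborel)) \<longlonglongrightarrow> 0"
      by (simp only: mult_zero_right)
    show "(\<lambda>k. ennreal (norm ((LINT t|lborel. f t * cnj (A k t)) - (LINT t|lborel. f t * cnj (f t))))) \<longlonglongrightarrow> ennreal 0"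
      unfolding ennreal_0
      by (rule tendsto_sandwich[OF _ _ tendsto_const B_lim])
         (intro always_eventually allI zero_le, intro always_eventually allI le)
  qed auto
  then have "(\<lambda>k. LINT t|lborel. f t * cnj (A k t)) \<longlonglongrightarrow> complex_of_real ((l2norm lborel f)\<^sup>2)"
    unfolding norm_f by (simp add: LIM_zero_iff)
  then have "(\<lambda>k. complex_of_real (LINT x|lborel. (cmod (fourier f x))\<^sup>2 * w k x)) \<longlonglongrightarrow> complex_of_real ((l2norm lborel f)\<^sup>2)"
    by (simp only: reg)
  then have lim: "(\<lambda>k. LINT x|lborel. (cmod (fourier f x))\<^sup>2 * w k x) \<longlonglongrightarrow> (l2norm lborel f)\<^sup>2"
    by (simp only: tendsto_of_real_iff)
  have mono: "AE x in lborel. mono (\<lambda>k. (cmod (fourier f x))\<^sup>2 * w k x)"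
  proof (intro AE_I2 monoI mult_left_mono)
    fix x :: real and j k :: nat assume "j \<le> k"
    then have "e k \<le> e j" unfolding e_def by (intro le_imp_inverse_le) auto
    then have "(e k * x)\<^sup>2 \<le> (e j * x)\<^sup>2"
      unfolding power_mult_distrib by (intro mult_right_mono power_mono) (use e0[of k] in auto)
    then show "w j x \<le> w k x" unfolding w_def by simp
  qed auto
  have pw: "AE x in lborel. (\<lambda>k. (cmod (fourier f x))\<^sup>2 * w k x) \<longlonglongrightarrow> (cmod (fourier f x))\<^sup>2"
  proof (intro AE_I2)
    fix x
    have "(\<lambda>k. (cmod (fourier f x))\<^sup>2 * w k x) \<longlonglongrightarrow> (cmod (fourier f x))\<^sup>2 * exp (- (0 * x)\<^sup>2 / 2)"
      unfolding w_def e_def by (intro tendsto_intros LIMSEQ_inverse_real_of_nat) auto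
    then show "(\<lambda>k. (cmod (fourier f x))\<^sup>2 * w k x) \<longlonglongrightarrow> (cmod (fourier f x))\<^sup>2" by simp
  qed
  have m: "(\<lambda>x. (cmod (fourier f x))\<^sup>2) \<in> borel_measurable lborel" by measurable
  show "fourier f \<in> sq_integrable lborel"
    using integrable_monotone_convergence[OF fw mono pw lim m] by (simp add: sq_integrable_def)
  show "l2norm lborel (fourier f) = l2norm lborel f"
    using integral_monotone_convergence[OF fw mono pw lim m] unfolding l2norm_def[of _ "fourier f"] by simp
qed

text \<open>
  The truncations \<open>s n\<close> of \<open>f\<close> to the sets \<open>{\<bar>f\<bar> \<le> n}\<close> are bounded. They converge to \<open>f\<close> in \<open>L\<^sup>1\<close>, so their transforms
  converge pointwise, and in \<open>L\<^sup>2\<close>; Fatou's lemma combines the two.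
\<close>

lemma fourier_isometry:
  assumes f: "integrable lborel f" and fs: "f \<in> sq_integrable lborel"
  shows "fourier f \<in> sq_integrable lborel" "l2norm lborel (fourier f) = l2norm lborel f"
proof -
  have [measurable]: "f \<in> borel_measurable borel" using f by auto
  define A where "A n = {t. cmod (f t) \<le> real n}" for n
  have A [measurable]: "A n \<in> sets borel" for n unfolding A_def by measurable
  define s where "s n t = indicator (A n) t * f t" for n t
  have s_meas [measurable]: "s n \<in> borel_measurable borel" for n unfolding s_def by measurable
  have s_le: "cmod (s n t) \<le> cmod (f t)" for n t by (simp add: s_def indicator_def)
  have s_bnd: "cmod (s n t) \<le> real n" for n t by (auto simp: s_def indicator_def A_def)
  have s_int: "integrable lborel (s n)" for n
    by (rule Bochner_Integration.integrable_bound[OF f]) (use s_le in auto)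
  have s_sq: "s n \<in> sq_integrable lborel" for n
    by (rule sq_integrable_bound[OF fs _ s_le]) simp
  have s_lim: "(\<lambda>n. s n t) \<longlonglongrightarrow> f t" for t
  proof -
    obtain N where "cmod (f t) \<le> real N" using real_arch_simple by blast
    then have "s n t = f t" if "N \<le> n" for n using that by (simp add: s_def A_def)
    then have "eventually (\<lambda>n. s n t = f t) sequentially" by (auto simp: eventually_sequentially)
    then show ?thesis by (rule tendsto_eventually)
  qed
  have iso: "l2norm lborel (fourier (s n)) = l2norm lborel (s n)" "fourier (s n) \<in> sq_integrable lborel" for n
    using fourier_isometry_bounded[OF s_int s_bnd] by auto
  have iso_diff: "l2norm lborel (\<lambda>x. fourier (s m) x - fourier (s n) x) = l2norm lborel (\<lambda>t. s m t - s n t)" for m n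
  proof -
    have "cmod (s m t - s n t) \<le> real m + real n" for t
      using norm_triangle_ineq4[of "s m t" "s n t"] s_bnd[of m t] s_bnd[of n t] by linarith
    from fourier_isometry_bounded(2)[OF Bochner_Integration.integrable_diff[OF s_int s_int] this]
    show ?thesis unfolding fourier_diff[OF s_int s_int, abs_def] .
  qed
  have four_lim: "(\<lambda>n. fourier (s n) x) \<longlonglongrightarrow> fourier f x" for x
  proof -
    have "(\<lambda>n. LINT t|lborel. wave (x * t) * s n t)
       \<longlonglongrightarrow> (LINT t|lborel. wave (x * t) * f t)"
    proof (rule integral_dominated_convergence[where w="\<lambda>t. cmod (f t)"])
      show "AE t in lborel. (\<lambda>n. wave (x * t) * s n t) \<longlonglongrightarrow> wave (x * t) * f t"
        by (intro AE_I2 tendsto_intros s_lim)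
    qed (use f s_le in \<open>auto simp: norm_mult simp del: of_real_mult\<close>)
    then show ?thesis unfolding fourier_def by (intro tendsto_intros)
  qed
  have fm: "fourier f \<in> borel_measurable lborel" using borel_measurable_fourier[OF f] .
  have s_norm: "l2norm lborel (s n) \<le> l2norm lborel f" for n
    unfolding l2norm_def
    by (intro real_sqrt_le_mono integral_mono sq_integrable_integrable s_sq fs power_mono s_le) auto
  show sq: "fourier f \<in> sq_integrable lborel"
    by (rule l2_Fatou(1)[where s="\<lambda>n. fourier (s n)" and C="l2norm lborel f"])
       (use iso s_norm four_lim fm in auto)
  have s_conv: "(\<lambda>n. l2norm lborel (\<lambda>t. f t - s n t)) \<longlonglongrightarrow> 0"
  proof -
    have "(\<lambda>n. LINT t|lborel. (cmod (f t - s n t))\<^sup>2) \<longlonglongrightarrow> integral\<^sup>L lborel (\<lambda>t::real. 0::real)"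
    proof (rule integral_dominated_convergence[where w="\<lambda>t. (cmod (f t))\<^sup>2"])
      show "AE t in lborel. (\<lambda>n. (cmod (f t - s n t))\<^sup>2) \<longlonglongrightarrow> 0"
      proof (intro AE_I2)
        fix t
        have "(\<lambda>n. (cmod (f t - s n t))\<^sup>2) \<longlonglongrightarrow> (cmod (f t - f t))\<^sup>2" by (intro tendsto_intros s_lim)
        then show "(\<lambda>n. (cmod (f t - s n t))\<^sup>2) \<longlonglongrightarrow> 0" by simp
      qed
      show "AE t in lborel. norm ((cmod (f t - s n t))\<^sup>2) \<le> (cmod (f t))\<^sup>2" for n
        by (intro AE_I2) (simp add: s_def indicator_def)
    qed (use sq_integrable_integrable[OF fs] in auto)
    then have "(\<lambda>n. sqrt (LINT t|lborel. (cmod (f t - s n t))\<^sup>2)) \<longlonglongrightarrow> sqrt 0"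
      by (intro tendsto_real_sqrt) simp
    then show ?thesis by (simp add: l2norm_def)
  qed
  have "(\<lambda>n. l2norm lborel (\<lambda>x. fourier (s n) x - fourier f x)) \<longlonglongrightarrow> 0"
  proof (rule tendsto_sandwich[OF always_eventually always_eventually tendsto_const])
    show "(\<lambda>n. 2 * l2norm lborel (\<lambda>t. f t - s n t)) \<longlonglongrightarrow> 0"
      using tendsto_mult[OF tendsto_const s_conv, of 2] by simp
    show "\<forall>n. l2norm lborel (\<lambda>x. fourier (s n) x - fourier f x) \<le> 2 * l2norm lborel (\<lambda>t. f t - s n t)"
    proof
      fix n
      have "l2norm lborel (\<lambda>x. fourier f x - fourier (s n) x) \<le> 2 * l2norm lborel (\<lambda>t. f t - s n t)"
      proof (rule l2_Fatou(2)[where s="\<lambda>m x. fourier (s m) x - fourier (s n) x"])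
        show "\<forall>\<^sub>F m in sequentially. l2norm lborel (\<lambda>x. fourier (s m) x - fourier (s n) x) \<le> 2 * l2norm lborel (\<lambda>t. f t - s n t)"
          using eventually_ge_at_top[of n]
        proof eventually_elim
          case (elim m)
          have "l2norm lborel (\<lambda>t. s m t - s n t) \<le> l2norm lborel (\<lambda>t. f t - s n t)"
            unfolding l2norm_def
          proof (intro real_sqrt_le_mono integral_mono sq_integrable_integrable sq_integrable_diff s_sq fs power_mono)
            show "cmod (s m t - s n t) \<le> cmod (f t - s n t)" for t
              using elim by (auto simp: s_def indicator_def A_def)
          qed auto
          also have "\<dots> \<le> 2 * l2norm lborel (\<lambda>t. f t - s n t)" by simp
          finally show ?case unfolding iso_diff .
        qed
        show "AE x in lborel. (\<lambda>m. fourier (s m) x - fourier (s n) x) \<longlonglongrightarrow> fourier f x - fourier (s n) x"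
          by (intro AE_I2 tendsto_intros four_lim)
      qed (use iso(2) fm borel_measurable_fourier[OF s_int] in \<open>auto intro!: sq_integrable_diff\<close>)
      then show "l2norm lborel (\<lambda>x. fourier (s n) x - fourier f x) \<le> 2 * l2norm lborel (\<lambda>t. f t - s n t)"
        by (simp add: l2norm_minus_commute[of _ "fourier f"])
    qed
  qed simp
  from l2norm_tendsto[OF iso(2) sq this]
  have "(\<lambda>n. l2norm lborel (s n)) \<longlonglongrightarrow> l2norm lborel (fourier f)" by (simp only: iso(1))
  moreover have "(\<lambda>n. l2norm lborel (s n)) \<longlonglongrightarrow> l2norm lborel f"
    by (rule l2norm_tendsto[OF s_sq fs]) (use s_conv in \<open>simp add: l2norm_minus_commute[of _ f]\<close>)
  ultimately show "l2norm lborel (fourier f) = l2norm lborel f" by (rule LIMSEQ_unique)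
qed

lemma l2norm_add_cmult_sq:
  assumes f: "f \<in> sq_integrable M" and g: "g \<in> sq_integrable M"
  shows "(l2norm M (\<lambda>x. f x + c * g x))\<^sup>2
       = (l2norm M f)\<^sup>2 + (cmod c)\<^sup>2 * (l2norm M g)\<^sup>2 + 2 * Re (c * l2ip M f g)"
proof -
  let ?h = "\<lambda>x. c * g x"
  have h: "?h \<in> sq_integrable M" by (rule sq_integrable_cmult[OF g])
  have "complex_of_real ((l2norm M (\<lambda>x. f x + ?h x))\<^sup>2)
      = l2ip M f f + l2ip M f ?h + (l2ip M ?h f + l2ip M ?h ?h)"
    unfolding l2ip_self[symmetric] l2ip_add_left[OF f h sq_integrable_add[OF f h]]
      l2ip_add_right[OF f f h] l2ip_add_right[OF h f h] by simp
  also have "\<dots> = complex_of_real ((l2norm M f)\<^sup>2 + (cmod c * l2norm M g)\<^sup>2) + (c * l2ip M f g + cnj (c * l2ip M f g))"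
    unfolding l2ip_self l2norm_cmult l2ip_cmult_right l2ip_cmult_left by (simp add: l2ip_cnj)
  finally have "Re (complex_of_real ((l2norm M (\<lambda>x. f x + ?h x))\<^sup>2))
      = Re (complex_of_real ((l2norm M f)\<^sup>2 + (cmod c * l2norm M g)\<^sup>2) + (c * l2ip M f g + cnj (c * l2ip M f g)))"
    by (rule arg_cong)
  then show ?thesis by (simp only: Re_complex_of_real plus_complex.sel complex_cnj power_mult_distrib cnj.sel)
qed

text \<open>
  Polarisation: \<open>\<parallel>f + c g\<parallel>\<close> determines the real part of \<open>c\<close> times the inner product; \<open>c = 1\<close> and \<open>c = \<i>\<close> suffice.
\<close>

lemma Plancherel_identity:
  assumes f: "integrable lborel f" "f \<in> sq_integrable lborel"
    and g: "integrable lborel g" "g \<in> sq_integrable lborel"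
  shows "l2ip lborel (fourier f) (fourier g) = l2ip lborel f g"
proof -
  have key: "Re (c * l2ip lborel (fourier f) (fourier g)) = Re (c * l2ip lborel f g)" for c
  proof -
    have ci: "integrable lborel (\<lambda>t. c * g t)" using g by simp
    have "fourier (\<lambda>t. f t + c * g t) = (\<lambda>x. fourier f x + c * fourier g x)"
      by (rule ext) (simp only: fourier_add[OF f(1) ci] fourier_cmult)
    then have "l2norm lborel (\<lambda>x. fourier f x + c * fourier g x) = l2norm lborel (\<lambda>t. f t + c * g t)"
      using fourier_isometry(2)[of "\<lambda>t. f t + c * g t"] f g ci by (simp add: sq_integrable_add sq_integrable_cmult)
    then show ?thesis
      using l2norm_add_cmult_sq[OF f(2) g(2), of c]
        l2norm_add_cmult_sq[OF fourier_isometry(1)[OF f] fourier_isometry(1)[OF g], of c]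
        fourier_isometry(2)[OF f] fourier_isometry(2)[OF g] by simp
  qed
  show ?thesis using key[of 1] key[of \<i>] by (simp add: complex_eq_iff)
qed

definition cutoff :: "nat \<Rightarrow> (real \<Rightarrow> complex) \<Rightarrow> real \<Rightarrow> complex" where
  "cutoff n f t = indicator {- real n..real n} t * f t"

lemma cutoff_sq_integrable: "f \<in> sq_integrable lborel \<Longrightarrow> cutoff n f \<in> sq_integrable lborel"
  unfolding cutoff_def[abs_def] by (rule sq_integrable_indicator) auto

lemma integrable_sq_integrable_interval:
  fixes f :: "real \<Rightarrow> complex"
  assumes f: "f \<in> sq_integrable lborel"
  shows "integrable lborel (\<lambda>t. indicator {a..b} t * f t)"
proof -
  have "(indicator {a..b} :: real \<Rightarrow> complex) \<in> sq_integrable lborel"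
  proof -
    have "integrable lborel (indicator {a..b} :: real \<Rightarrow> real)"
      by (simp add: emeasure_lborel_Icc_eq)
    moreover have "(\<lambda>x. (cmod (indicator {a..b} x))\<^sup>2) = (indicator {a..b} :: real \<Rightarrow> real)"
      by (auto simp: indicator_def)
    ultimately show ?thesis by (simp add: sq_integrable_def)
  qed
  from integrable_mult[OF this f] show ?thesis .
qed

lemma cutoff_integrable: "f \<in> sq_integrable lborel \<Longrightarrow> integrable lborel (cutoff n f)"
  unfolding cutoff_def[abs_def] by (rule integrable_sq_integrable_interval)

lemma cutoff_tendsto:
  assumes f: "f \<in> sq_integrable lborel"
  shows "(\<lambda>n. l2norm lborel (\<lambda>t. cutoff n f t - f t)) \<longlonglongrightarrow> 0"
proof -
  have [measurable]: "f \<in> borel_measurable borel" using sq_integrable_measurable[OF f] by simp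
  have "(\<lambda>n. LINT t|lborel. (cmod (cutoff n f t - f t))\<^sup>2) \<longlonglongrightarrow> integral\<^sup>L lborel (\<lambda>t::real. 0::real)"
  proof (rule integral_dominated_convergence[where w="\<lambda>t. (cmod (f t))\<^sup>2"])
    show "AE t in lborel. (\<lambda>n. (cmod (cutoff n f t - f t))\<^sup>2) \<longlonglongrightarrow> 0"
    proof (intro AE_I2 tendsto_eventually)
      fix t
      obtain N where N: "\<bar>t\<bar> \<le> real N" using real_arch_simple by blast
      show "eventually (\<lambda>n. (cmod (cutoff n f t - f t))\<^sup>2 = 0) sequentially"
        using eventually_ge_at_top[of N]
        by eventually_elim (use N in \<open>auto simp: cutoff_def indicator_def abs_le_iff\<close>)
    qed
    show "AE t in lborel. norm ((cmod (cutoff n f t - f t))\<^sup>2) \<le> (cmod (f t))\<^sup>2" for n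
      by (intro AE_I2) (simp add: cutoff_def indicator_def)
    show "(\<lambda>t. (cmod (cutoff n f t - f t))\<^sup>2) \<in> borel_measurable lborel" for n
      unfolding cutoff_def by measurable
  qed (use sq_integrable_integrable[OF f] in auto)
  then have "(\<lambda>n. sqrt (LINT t|lborel. (cmod (cutoff n f t - f t))\<^sup>2)) \<longlonglongrightarrow> sqrt 0"
    by (intro tendsto_real_sqrt) simp
  then show ?thesis by (simp add: l2norm_def)
qed

text \<open>
  The integral defining \<open>fourier f\<close> need not exist for square integrable \<open>f\<close>. The limit in norm is determined only
  up to a null set, hence the choice of a representative.
\<close>

definition plancherel :: "(real \<Rightarrow> complex) \<Rightarrow> real \<Rightarrow> complex" where
  "plancherel f = (SOME g. g \<in> sq_integrable lborel \<and>
     (\<lambda>n. l2norm lborel (\<lambda>x. fourier (cutoff n f) x - g x)) \<longlonglongrightarrow> 0)"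

lemma fourier_cutoff_sq: "f \<in> sq_integrable lborel \<Longrightarrow> fourier (cutoff n f) \<in> sq_integrable lborel"
  by (rule fourier_isometry(1)[OF cutoff_integrable cutoff_sq_integrable])

lemma plancherel:
  assumes f: "f \<in> sq_integrable lborel"
  shows "plancherel f \<in> sq_integrable lborel"
    and "(\<lambda>n. l2norm lborel (\<lambda>x. fourier (cutoff n f) x - plancherel f x)) \<longlonglongrightarrow> 0"
proof -
  have iso: "l2norm lborel (\<lambda>x. fourier (cutoff m f) x - fourier (cutoff n f) x) = l2norm lborel (\<lambda>t. cutoff m f t - cutoff n f t)" for m n
    using fourier_isometry(2)[OF Bochner_Integration.integrable_diff sq_integrable_diff,
        OF cutoff_integrable[OF f] cutoff_integrable[OF f] cutoff_sq_integrable[OF f] cutoff_sq_integrable[OF f], of m n]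
    unfolding fourier_diff[OF cutoff_integrable[OF f] cutoff_integrable[OF f], abs_def] .
  have "\<exists>g. g \<in> sq_integrable lborel \<and> (\<lambda>n. l2norm lborel (\<lambda>x. fourier (cutoff n f) x - g x)) \<longlonglongrightarrow> 0"
  proof (rule Riesz_Fischer[where M=lborel and s="\<lambda>n. fourier (cutoff n f)"])
    fix e :: real assume "0 < e"
    then have "eventually (\<lambda>n. l2norm lborel (\<lambda>t. cutoff n f t - f t) < e / 2) sequentially"
      using order_tendstoD(2)[OF cutoff_tendsto[OF f], of "e/2"] by simp
    then obtain N where N: "\<And>n. N \<le> n \<Longrightarrow> l2norm lborel (\<lambda>t. cutoff n f t - f t) < e / 2"
      by (auto simp: eventually_sequentially)
    have "l2norm lborel (\<lambda>x. fourier (cutoff m f) x - fourier (cutoff n f) x) < e" if "N \<le> m" "N \<le> n" for m n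
      using l2norm_triangle_diff[OF cutoff_sq_integrable[OF f, of m] f cutoff_sq_integrable[OF f, of n]]
        N[OF that(1)] N[OF that(2)] l2norm_minus_commute[of lborel f "cutoff n f"] unfolding iso by linarith
    then show "\<exists>N. \<forall>m\<ge>N. \<forall>n\<ge>N. l2norm lborel (\<lambda>x. fourier (cutoff m f) x - fourier (cutoff n f) x) < e" by blast
  qed (use fourier_cutoff_sq[OF f] in auto)
  from someI_ex[OF this]
  show "plancherel f \<in> sq_integrable lborel"
    and "(\<lambda>n. l2norm lborel (\<lambda>x. fourier (cutoff n f) x - plancherel f x)) \<longlonglongrightarrow> 0"
    unfolding plancherel_def by auto
qed

lemma plancherel_inner:
  assumes f: "f \<in> sq_integrable lborel" and g: "g \<in> sq_integrable lborel"
  shows "l2ip lborel (plancherel f) (plancherel g) = l2ip lborel f g"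
proof (rule LIMSEQ_unique)
  show "(\<lambda>n. l2ip lborel (fourier (cutoff n f)) (fourier (cutoff n g))) \<longlonglongrightarrow> l2ip lborel (plancherel f) (plancherel g)"
    by (intro l2ip_tendsto plancherel f g fourier_cutoff_sq)
  show "(\<lambda>n. l2ip lborel (fourier (cutoff n f)) (fourier (cutoff n g))) \<longlonglongrightarrow> l2ip lborel f g"
    using l2ip_tendsto[OF cutoff_sq_integrable[OF f] f cutoff_sq_integrable[OF g] g cutoff_tendsto[OF f] cutoff_tendsto[OF g]]
    by (simp add: Plancherel_identity[OF cutoff_integrable[OF f] cutoff_sq_integrable[OF f] cutoff_integrable[OF g] cutoff_sq_integrable[OF g]])
qed

lemma plancherel_eq_fourier:
  assumes f: "integrable lborel f" and fs: "f \<in> sq_integrable lborel"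
  shows "AE x in lborel. plancherel f x = fourier f x"
proof -
  have sq: "fourier f \<in> sq_integrable lborel" using fourier_isometry(1)[OF f fs] .
  have iso: "l2norm lborel (\<lambda>x. fourier (cutoff n f) x - fourier f x) = l2norm lborel (\<lambda>t. cutoff n f t - f t)" for n
    using fourier_isometry(2)[OF Bochner_Integration.integrable_diff sq_integrable_diff,
        OF cutoff_integrable[OF fs] f cutoff_sq_integrable[OF fs] fs, of n]
    unfolding fourier_diff[OF cutoff_integrable[OF fs] f, abs_def] .
  have "l2norm lborel (\<lambda>x. plancherel f x - fourier f x) \<le> 0"
  proof (rule LIMSEQ_le_const)
    show "(\<lambda>n. l2norm lborel (\<lambda>x. fourier (cutoff n f) x - plancherel f x) + l2norm lborel (\<lambda>t. cutoff n f t - f t)) \<longlonglongrightarrow> 0"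
      using tendsto_add[OF plancherel(2)[OF fs] cutoff_tendsto[OF fs]] by simp
    show "\<exists>N. \<forall>n\<ge>N. l2norm lborel (\<lambda>x. plancherel f x - fourier f x)
        \<le> l2norm lborel (\<lambda>x. fourier (cutoff n f) x - plancherel f x) + l2norm lborel (\<lambda>t. cutoff n f t - f t)"
      using l2norm_triangle_diff[OF plancherel(1)[OF fs] fourier_cutoff_sq[OF fs] sq]
      unfolding iso l2norm_minus_commute[of lborel "plancherel f"] by blast
  qed
  then have "l2norm lborel (\<lambda>x. plancherel f x - fourier f x) = 0"
    using l2norm_nonneg by (rule order_antisym)
  from l2norm_eq_0_AE[OF sq_integrable_diff[OF plancherel(1)[OF fs] sq] this]
  show ?thesis by simp
qed

lemma l2norm_cnj_diff: "l2norm M (\<lambda>x. cnj (f x) - cnj (g x)) = l2norm M (\<lambda>x. f x - g x)"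
  unfolding l2norm_def by (simp flip: complex_cnj_diff)

text \<open>
  The multiplication formula passes to the limit and says that \<open>g \<mapsto> cnj (plancherel (cnj g))\<close> is adjoint
  to \<open>plancherel\<close>. Both maps are isometric, so the adjoint is also a right inverse.
\<close>

lemma plancherel_adjoint:
  assumes f: "f \<in> sq_integrable lborel" and g: "g \<in> sq_integrable lborel"
  shows "l2ip lborel g (plancherel f) = l2ip lborel (\<lambda>x. cnj (plancherel (\<lambda>t. cnj (g t)) x)) f"
proof -
  let ?g = "\<lambda>t. cnj (g t)"
  have g': "?g \<in> sq_integrable lborel" by (rule sq_integrable_cnj[OF g])
  have cg: "cutoff n g = (\<lambda>t. cnj (cutoff n ?g t))" for n
    by (auto simp: cutoff_def indicator_def)
  have eq: "l2ip lborel (cutoff n g) (fourier (cutoff n f)) = l2ip lborel (\<lambda>x. cnj (fourier (cutoff n ?g) x)) (cutoff n f)" for n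
    using fourier_multiplication_formula[OF cutoff_integrable[OF f] cutoff_integrable[OF g'], of n n]
    unfolding l2ip_def cg by (simp add: mult.commute)
  show ?thesis
  proof (rule LIMSEQ_unique)
    show "(\<lambda>n. l2ip lborel (cutoff n g) (fourier (cutoff n f))) \<longlonglongrightarrow> l2ip lborel g (plancherel f)"
      by (intro l2ip_tendsto cutoff_sq_integrable cutoff_tendsto fourier_cutoff_sq plancherel f g)
    show "(\<lambda>n. l2ip lborel (cutoff n g) (fourier (cutoff n f))) \<longlonglongrightarrow> l2ip lborel (\<lambda>x. cnj (plancherel ?g x)) f"
      unfolding eq
      by (intro l2ip_tendsto cutoff_sq_integrable cutoff_tendsto fourier_cutoff_sq plancherel sq_integrable_cnj f g')
         (use plancherel(2)[OF g'] in \<open>simp add: l2norm_cnj_diff\<close>)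
  qed
qed

lemma plancherel_norm:
  assumes "f \<in> sq_integrable lborel" shows "l2norm lborel (plancherel f) = l2norm lborel f"
proof -
  have "complex_of_real ((l2norm lborel (plancherel f))\<^sup>2) = complex_of_real ((l2norm lborel f)\<^sup>2)"
    using plancherel_inner[OF assms assms] unfolding l2ip_self .
  then show ?thesis by (simp only: of_real_eq_iff power2_eq_iff_nonneg[OF l2norm_nonneg l2norm_nonneg])
qed

lemma plancherel_surj:
  assumes g: "g \<in> sq_integrable lborel"
  defines "f \<equiv> \<lambda>x. cnj (plancherel (\<lambda>t. cnj (g t)) x)"
  shows "f \<in> sq_integrable lborel" "AE x in lborel. plancherel f x = g x"
proof -
  have g': "(\<lambda>t. cnj (g t)) \<in> sq_integrable lborel" by (rule sq_integrable_cnj[OF g])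
  show f: "f \<in> sq_integrable lborel"
    unfolding f_def by (intro sq_integrable_cnj plancherel(1) g)
  have nf: "l2norm lborel f = l2norm lborel g"
    unfolding f_def using plancherel_norm[OF g'] by (simp add: l2norm_cnj)
  have "l2ip lborel g (plancherel f) = complex_of_real ((l2norm lborel g)\<^sup>2)"
    using plancherel_adjoint[OF f g] unfolding f_def[symmetric] l2ip_self nf .
  then have "(l2norm lborel (\<lambda>x. g x + (- 1) * plancherel f x))\<^sup>2 = 0"
    unfolding l2norm_add_cmult_sq[OF g plancherel(1)[OF f]] plancherel_norm[OF f] nf by simp
  then have "l2norm lborel (\<lambda>x. plancherel f x - g x) = 0"
    by (simp add: l2norm_minus_commute[of _ "plancherel f"])
  from l2norm_eq_0_AE[OF sq_integrable_diff[OF plancherel(1)[OF f] g] this]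
  show "AE x in lborel. plancherel f x = g x" by simp
qed

text \<open>
  The operator that \<open>plancherel\<close> induces on classes has both properties, so the operator chosen in the
  definition has them too.
\<close>

theorem Plancherel:
  "unitary_L2 lborel lborel fourier_plancherel" (is ?U)
  "f \<in> sq_integrable lborel \<Longrightarrow> integrable lborel f \<Longrightarrow>
     fourier_plancherel (cls lborel f) = cls lborel (fourier f)"
proof -
  define F where "F \<phi> = cls lborel (plancherel (rep \<phi>))" for \<phi> :: "(real \<Rightarrow> complex) set"
  have FL2: "F \<phi> \<in> L2 lborel" if "\<phi> \<in> L2 lborel" for \<phi>
    unfolding F_def by (intro cls_in_L2 plancherel(1) rep_sq_integrable that)
  have inner: "inner_L2 lborel (F \<psi>) (F \<phi>) = inner_L2 lborel \<psi> \<phi>" if "\<psi> \<in> L2 lborel" "\<phi> \<in> L2 lborel" for \<psi> \<phi>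
    unfolding F_def inner_L2_cls[OF plancherel(1)[OF rep_sq_integrable[OF that(1)]] plancherel(1)[OF rep_sq_integrable[OF that(2)]]]
      plancherel_inner[OF rep_sq_integrable[OF that(1)] rep_sq_integrable[OF that(2)]]
    by (rule inner_L2_eq[symmetric])
  have Fcls: "F (cls lborel f) = cls lborel (fourier f)" if f: "f \<in> sq_integrable lborel" "integrable lborel f" for f
  proof -
    let ?r = "rep (cls lborel f)"
    have r: "?r \<in> sq_integrable lborel" using f by (intro rep_sq_integrable cls_in_L2)
    have ae: "AE x in lborel. ?r x = f x" by (rule rep_cls[OF f(1)])
    have m: "?r \<in> borel_measurable lborel" "f \<in> borel_measurable lborel"
      using sq_integrable_measurable[OF r] sq_integrable_measurable[OF f(1)] by auto
    have ri: "integrable lborel ?r" using f(2) integrable_cong_AE[OF m ae] by simp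
    have "fourier ?r = fourier f" by (rule ext) (rule fourier_cong_AE[OF m ae])
    then have "AE x in lborel. plancherel ?r x = fourier f x"
      using plancherel_eq_fourier[OF ri r] by simp
    then show ?thesis
      unfolding F_def by (intro cls_eqI plancherel(1) r fourier_isometry(1) f)
  qed
  have inj: "inj_on F (L2 lborel)"
  proof (rule inj_onI)
    fix a b assume a: "a \<in> L2 lborel" and b: "b \<in> L2 lborel" and ab: "F a = F b"
    show "a = b"
    proof (rule L2_eqI[OF a b])
      fix \<psi> :: "(real \<Rightarrow> complex) set" assume p: "\<psi> \<in> L2 lborel"
      show "inner_L2 lborel \<psi> a = inner_L2 lborel \<psi> b"
        using inner[OF p a] inner[OF p b] ab by simp
    qed
  qed
  have surj: "\<exists>\<phi>\<in>L2 lborel. F \<phi> = \<gamma>" if \<gamma>: "\<gamma> \<in> L2 lborel" for \<gamma>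
  proof -
    define g where "g = rep \<gamma>"
    have g: "g \<in> sq_integrable lborel" unfolding g_def by (rule rep_sq_integrable[OF \<gamma>])
    define f where "f = (\<lambda>x. cnj (plancherel (\<lambda>t. cnj (g t)) x))"
    have f: "f \<in> sq_integrable lborel" "AE x in lborel. plancherel f x = g x"
      using plancherel_surj[OF g] unfolding f_def by auto
    have L: "cls lborel f \<in> L2 lborel" by (rule cls_in_L2[OF f(1)])
    let ?r = "rep (cls lborel f)"
    have r: "?r \<in> sq_integrable lborel" by (rule rep_sq_integrable[OF L])
    have m: "?r \<in> borel_measurable lborel" "f \<in> borel_measurable lborel"
      using sq_integrable_measurable[OF r] sq_integrable_measurable[OF f(1)] by auto
    have ae: "AE x in lborel. ?r x = f x" by (rule rep_cls[OF f(1)])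
    have "AE t in lborel. cutoff n ?r t = cutoff n f t" for n
      using ae by eventually_elim (simp add: cutoff_def)
    then have "fourier (cutoff n ?r) = fourier (cutoff n f)" for n
      by (intro ext fourier_cong_AE sq_integrable_measurable cutoff_sq_integrable r f(1))
    then have "plancherel ?r = plancherel f" unfolding plancherel_def by simp
    then have "F (cls lborel f) = cls lborel g"
      unfolding F_def using f by (intro cls_eqI plancherel(1) r g) simp
    then show ?thesis using L cls_rep[OF \<gamma>] unfolding g_def by auto
  qed
  have "unitary_L2 lborel lborel F"
    unfolding unitary_L2_def bij_betw_def using inj inner FL2 surj by (auto simp: image_iff) metis
  then have "\<exists>F. unitary_L2 lborel lborel F \<and>
    (\<forall>f \<in> sq_integrable lborel. integrable lborel f \<longrightarrow> F (cls lborel f) = cls lborel (fourier f))"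
    using Fcls by blast
  from someI_ex[OF this]
  have "unitary_L2 lborel lborel fourier_plancherel \<and>
    (\<forall>f \<in> sq_integrable lborel. integrable lborel f \<longrightarrow> fourier_plancherel (cls lborel f) = cls lborel (fourier f))"
    unfolding fourier_plancherel_def fourier_def[abs_def] .
  then show ?U and "f \<in> sq_integrable lborel \<Longrightarrow> integrable lborel f \<Longrightarrow>
     fourier_plancherel (cls lborel f) = cls lborel (fourier f)" by auto
qed

section \<open>Complex measures with a density\<close>

text \<open>
  Identifying the set function with a measure that is already known rules out the degenerate case of
  \<open>measure_of\<close> and replaces a proof of countable additivity.
\<close>

lemma measure_of_eqI:
  assumes "sets N = sets borel" "\<And>A. A \<in> sets borel \<Longrightarrow> \<mu> A = emeasure N A"
  shows "measure_of UNIV (sets borel) \<mu> = (N :: real measure)"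
proof -
  have sp: "space N = UNIV" using sets_eq_imp_space_eq[OF assms(1)] by simp
  have "measure_of UNIV (sets borel) \<mu> = measure_of UNIV (sets borel) (emeasure N)"
    by (rule measure_of_eq) (use assms(2) sets.sigma_sets_eq[of borel] in auto)
  also have "\<dots> = measure_of (space N) (sets N) (emeasure N)" by (simp add: sp assms(1))
  also have "\<dots> = N" by (rule measure_of_of_measure)
  finally show ?thesis .
qed

lemma integrable_indicator_mult:
  fixes h :: "real \<Rightarrow> complex"
  assumes "integrable lborel h" "B \<in> sets borel"
  shows "integrable lborel (\<lambda>x. indicator B x * h x)"
proof (rule Bochner_Integration.integrable_bound[OF assms(1)])
  have [measurable]: "h \<in> borel_measurable borel" "B \<in> sets borel" using assms by auto
  show "(\<lambda>x. indicator B x * h x) \<in> borel_measurable lborel" by measurable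
qed (auto simp: indicator_def)

lemma integrable_indicator_mult_real:
  fixes k :: "real \<Rightarrow> real"
  assumes "integrable lborel k" "B \<in> sets borel"
  shows "integrable lborel (\<lambda>x. indicator B x * k x)"
  using integrable_mult_indicator[OF _ assms(1), of B] assms(2) by simp

text \<open>
  The supremum is attained at the part of \<open>A\<close> where the density is nonnegative; \<open>ennreal\<close> cuts off negative values.
\<close>

lemma pos_part_density:
  fixes k :: "real \<Rightarrow> real"
  assumes k: "integrable lborel k"
    and \<nu>: "\<And>B. B \<in> sets borel \<Longrightarrow> \<nu> B = (LINT x|lborel. indicator B x * k x)"
  shows "pos_part \<nu> = density lborel (\<lambda>x. ennreal (k x))"
  unfolding pos_part_def
proof (rule measure_of_eqI)
  have [measurable]: "k \<in> borel_measurable borel" using k by auto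
  have val: "(\<integral>\<^sup>+x. ennreal (k x) * indicator B x \<partial>lborel) = ennreal (\<nu> B)"
    if "B \<in> sets borel" "\<And>x. x \<in> B \<Longrightarrow> 0 \<le> k x" for B
  proof -
    have "(\<integral>\<^sup>+x. ennreal (k x) * indicator B x \<partial>lborel) = (\<integral>\<^sup>+x. ennreal (indicator B x * k x) \<partial>lborel)"
      by (intro nn_integral_cong) (auto simp: indicator_def)
    also have "\<dots> = ennreal (\<nu> B)"
      unfolding \<nu>[OF that(1)]
      by (rule nn_integral_eq_integral[OF integrable_indicator_mult_real[OF k that(1)]])
         (use that in \<open>auto simp: indicator_def\<close>)
    finally show ?thesis .
  qed
  fix A :: "real set" assume A: "A \<in> sets borel"
  show "(SUP B\<in>{B \<in> sets borel. B \<subseteq> A}. ennreal (\<nu> B)) = emeasure (density lborel (\<lambda>x. ennreal (k x))) A"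
  proof (rule antisym)
    show "(SUP B\<in>{B \<in> sets borel. B \<subseteq> A}. ennreal (\<nu> B)) \<le> emeasure (density lborel (\<lambda>x. ennreal (k x))) A"
    proof (rule SUP_least)
      fix B assume "B \<in> {B \<in> sets borel. B \<subseteq> A}"
      then have B: "B \<in> sets borel" "B \<subseteq> A" by auto
      let ?C = "B \<inter> {x. 0 \<le> k x}"
      have C: "?C \<in> sets borel" using B(1) by measurable
      have "\<nu> B \<le> \<nu> ?C"
        unfolding \<nu>[OF B(1)] \<nu>[OF C]
        by (intro integral_mono integrable_indicator_mult_real k B C) (auto simp: indicator_def)
      then have "ennreal (\<nu> B) \<le> ennreal (\<nu> ?C)" by (rule ennreal_leI)
      also have "\<dots> = (\<integral>\<^sup>+x. ennreal (k x) * indicator ?C x \<partial>lborel)"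
        by (rule val[symmetric, OF C]) auto
      also have "\<dots> \<le> (\<integral>\<^sup>+x. ennreal (k x) * indicator A x \<partial>lborel)"
        using B(2) by (intro nn_integral_mono) (auto simp: indicator_def)
      also have "\<dots> = emeasure (density lborel (\<lambda>x. ennreal (k x))) A"
        using A by (simp add: emeasure_density)
      finally show "ennreal (\<nu> B) \<le> emeasure (density lborel (\<lambda>x. ennreal (k x))) A" .
    qed
    let ?C = "A \<inter> {x. 0 \<le> k x}"
    have C: "?C \<in> sets borel" using A by measurable
    have "emeasure (density lborel (\<lambda>x. ennreal (k x))) A = (\<integral>\<^sup>+x. ennreal (k x) * indicator A x \<partial>lborel)"
      using A by (simp add: emeasure_density)
    also have "\<dots> = (\<integral>\<^sup>+x. ennreal (k x) * indicator ?C x \<partial>lborel)"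
      by (intro nn_integral_cong) (auto simp: indicator_def ennreal_neg)
    also have "\<dots> = ennreal (\<nu> ?C)" by (rule val[OF C]) auto
    also have "\<dots> \<le> (SUP B\<in>{B \<in> sets borel. B \<subseteq> A}. ennreal (\<nu> B))"
      by (rule SUP_upper) (use C in auto)
    finally show "emeasure (density lborel (\<lambda>x. ennreal (k x))) A \<le> (SUP B\<in>{B \<in> sets borel. B \<subseteq> A}. ennreal (\<nu> B))" .
  qed
qed simp

lemma signed_integral_density:
  fixes k f :: "real \<Rightarrow> real"
  assumes k: "integrable lborel k" and fk: "integrable lborel (\<lambda>x. f x * k x)"
    and f [measurable]: "f \<in> borel_measurable borel"
    and \<nu>: "\<And>B. B \<in> sets borel \<Longrightarrow> \<nu> B = (LINT x|lborel. indicator B x * k x)"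
  shows "signed_integral \<nu> f = (LINT x|lborel. f x * k x)"
proof -
  have [measurable]: "k \<in> borel_measurable borel" using k by auto
  have p: "pos_part \<nu> = density lborel (\<lambda>x. ennreal (max 0 (k x)))"
  proof -
    have "pos_part \<nu> = density lborel (\<lambda>x. ennreal (k x))"
      by (rule pos_part_density) (use k \<nu> in auto)
    also have "(\<lambda>x. ennreal (k x)) = (\<lambda>x. ennreal (max 0 (k x)))"
      by (auto simp: max_def ennreal_neg)
    finally show ?thesis .
  qed
  have m: "pos_part (\<lambda>B. - \<nu> B) = density lborel (\<lambda>x. ennreal (max 0 (- k x)))"
  proof -
    have "pos_part (\<lambda>B. - \<nu> B) = density lborel (\<lambda>x. ennreal (- k x))"
      by (rule pos_part_density) (use k \<nu> in auto)
    also have "(\<lambda>x. ennreal (- k x)) = (\<lambda>x. ennreal (max 0 (- k x)))"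
      by (auto simp: max_def ennreal_neg)
    finally show ?thesis .
  qed
  have ip: "integrable lborel (\<lambda>x. max 0 (k x) * f x)" "integrable lborel (\<lambda>x. max 0 (- k x) * f x)"
    by (auto intro!: Bochner_Integration.integrable_bound[OF fk] AE_I2 simp: max_def abs_mult mult_nonneg_nonpos)
  have "signed_integral \<nu> f = (LINT x|lborel. max 0 (k x) * f x) - (LINT x|lborel. max 0 (- k x) * f x)"
    unfolding signed_integral_def p m by (simp add: integral_real_density)
  also have "\<dots> = (LINT x|lborel. max 0 (k x) * f x - max 0 (- k x) * f x)" using ip by simp
  also have "\<dots> = (LINT x|lborel. f x * k x)"
    by (intro Bochner_Integration.integral_cong) (auto simp: max_def)
  finally show ?thesis .
qed

lemma complex_measure_integral_density:
  assumes h: "integrable lborel h" and fh: "integrable lborel (\<lambda>x. complex_of_real (f x) * h x)"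
    and f: "f \<in> borel_measurable borel"
    and \<mu>: "\<And>B. B \<in> sets borel \<Longrightarrow> \<mu> B = (LINT x|lborel. indicator B x * h x)"
  shows "complex_measure_integral \<mu> f = (LINT x|lborel. complex_of_real (f x) * h x)"
proof -
  have RI: "Re (\<mu> B) = (LINT x|lborel. indicator B x * Re (h x))"
           "Im (\<mu> B) = (LINT x|lborel. indicator B x * Im (h x))" if "B \<in> sets borel" for B
  proof -
    have i: "integrable lborel (\<lambda>x. indicator B x * h x)" by (rule integrable_indicator_mult[OF h that])
    have "Re (\<mu> B) = (LINT x|lborel. Re (indicator B x * h x))"
         "Im (\<mu> B) = (LINT x|lborel. Im (indicator B x * h x))"
      unfolding \<mu>[OF that] by (simp_all only: integral_Re[OF i] integral_Im[OF i])
    moreover have "Re (indicator B x * h x) = indicator B x * Re (h x)" "Im (indicator B x * h x) = indicator B x * Im (h x)" for x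
      by (auto simp: indicator_def)
    ultimately show "Re (\<mu> B) = (LINT x|lborel. indicator B x * Re (h x))"
           "Im (\<mu> B) = (LINT x|lborel. indicator B x * Im (h x))" by simp_all
  qed
  have "signed_integral (\<lambda>B. Re (\<mu> B)) f = (LINT x|lborel. f x * Re (h x))"
    by (rule signed_integral_density[OF integrable_Re[OF h] _ f RI(1)])
       (use integrable_Re[OF fh] in simp)
  also have "\<dots> = Re (LINT x|lborel. complex_of_real (f x) * h x)"
    using integral_Re[OF fh] by simp
  finally have R: "signed_integral (\<lambda>B. Re (\<mu> B)) f = Re (LINT x|lborel. complex_of_real (f x) * h x)" .
  have "signed_integral (\<lambda>B. Im (\<mu> B)) f = (LINT x|lborel. f x * Im (h x))"
    by (rule signed_integral_density[OF integrable_Im[OF h] _ f RI(2)])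
       (use integrable_Im[OF fh] in simp)
  also have "\<dots> = Im (LINT x|lborel. complex_of_real (f x) * h x)"
    using integral_Im[OF fh] by simp
  finally have I: "signed_integral (\<lambda>B. Im (\<mu> B)) f = Im (LINT x|lborel. complex_of_real (f x) * h x)" .
  show ?thesis unfolding complex_measure_integral_def R I by simp
qed

text \<open>
  Cut the line into countably many pieces on each of which the phase of \<open>h\<close> stays within \<open>\<epsilon>\<close> of a
  constant \<open>d\<close>. On such a piece \<open>(1 - \<epsilon>) \<bar>h\<bar> \<le> Re (cnj d * h)\<close>, so there is hardly any cancellation in
  the integral of \<open>h\<close>.
\<close>

lemma nearly_constant_phase_partition:
  assumes h: "integrable lborel h" and A: "A \<in> sets borel" and e: "0 < e" "e < 1"
  shows "\<exists>B :: nat \<Rightarrow> real set. range B \<subseteq> sets borel \<and> disjoint_family B \<and> (\<Union>i. B i) = A \<and>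
    (\<forall>i. (1 - e) * (LINT x|lborel. indicator (B i) x * cmod (h x)) \<le> (1 + e) * cmod (LINT x|lborel. indicator (B i) x * h x))"
proof -
  have [measurable]: "h \<in> borel_measurable borel" "A \<in> sets borel" using h A by auto
  obtain D :: "complex set" where D: "countable D" "\<And>X. open X \<Longrightarrow> X \<noteq> {} \<Longrightarrow> \<exists>d\<in>D. d \<in> X"
    using countable_dense_exists by blast
  have "D \<noteq> {}" using D(2)[of UNIV] by auto
  define d where "d = from_nat_into D"
  have d: "\<exists>k. dist z (d k) < e" for z
  proof -
    obtain y where "y \<in> D" "y \<in> ball z e" using D(2)[of "ball z e"] e by auto
    moreover obtain k where "d k = y" using from_nat_into_surj[OF D(1) \<open>y \<in> D\<close>] unfolding d_def by auto
    ultimately show ?thesis by (auto simp: dist_commute)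
  qed
  define C where "C k = {x. dist (sgn (h x)) (d k) < e}" for k
  have [measurable]: "(\<lambda>x. sgn (h x)) \<in> borel_measurable borel"
    unfolding sgn_div_norm by measurable
  have C [measurable]: "C k \<in> sets borel" for k unfolding C_def by measurable
  define B where "B k = A \<inter> disjointed C k" for k
  have UC: "(\<Union>k. C k) = UNIV" using d unfolding C_def by auto
  have "range C \<subseteq> sets borel" using C by auto
  then have "range (disjointed C) \<subseteq> sets borel" by (rule sets.range_disjointed_sets)
  then have Bm: "B k \<in> sets borel" for k
    unfolding B_def using A by (intro sets.Int) auto
  have disj: "disjoint_family B"
    using disjoint_family_disjointed[of C] unfolding B_def disjoint_family_on_def by blast
  have UB: "(\<Union>k. B k) = A" unfolding B_def using UC UN_disjointed_eq[of C] by auto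
  have main: "(1 - e) * (LINT x|lborel. indicator (B k) x * cmod (h x)) \<le> (1 + e) * cmod (LINT x|lborel. indicator (B k) x * h x)" for k
  proof (cases "\<exists>x\<in>B k. h x \<noteq> 0")
    case False
    then have "indicator (B k) x * cmod (h x) = 0" for x by (auto simp: indicator_def)
    then have "(LINT x|lborel. indicator (B k) x * cmod (h x)) = 0"
      by (simp only: Bochner_Integration.integral_zero)
    then show ?thesis using e by simp
  next
    case True
    have near: "cmod (sgn (h x) - d k) < e" if "x \<in> B k" for x
      using that disjointed_subset[of C k] unfolding B_def C_def by (auto simp: dist_norm)
    from True obtain x where x: "x \<in> B k" "h x \<noteq> 0" by blast
    have "cmod (d k) \<le> 1 + e"
      using near[OF x(1)] x(2) norm_triangle_ineq2[of "d k" "sgn (h x)"]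
      by (simp add: norm_sgn norm_minus_commute)
    have i1: "integrable lborel (\<lambda>x. indicator (B k) x * h x)" by (rule integrable_indicator_mult[OF h Bm])
    have i2: "integrable lborel (\<lambda>x. indicator (B k) x * cmod (h x))"
      by (rule integrable_indicator_mult_real[OF integrable_norm[OF h] Bm])
    have "(1 - e) * (LINT x|lborel. indicator (B k) x * cmod (h x)) = (LINT x|lborel. (1 - e) * (indicator (B k) x * cmod (h x)))" by simp
    also have "\<dots> \<le> (LINT x|lborel. Re (cnj (d k) * (indicator (B k) x * h x)))"
    proof (intro integral_mono integrable_Re integrable_mult_right impI i1 i2)
      fix x :: real
      show "(1 - e) * (indicator (B k) x * cmod (h x)) \<le> Re (cnj (d k) * (indicator (B k) x * h x))"
      proof (cases "x \<in> B k \<and> h x \<noteq> 0")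
        case False
        then show ?thesis by (auto simp: indicator_def)
      next
        case True
        let ?s = "sgn (h x)"
        have hs: "h x = complex_of_real (cmod (h x)) * ?s" using True by (simp add: sgn_eq)
        have ss: "cnj ?s * ?s = 1"
          using complex_norm_square[of ?s] True by (simp add: norm_sgn mult.commute)
        have "cmod (cnj (?s - d k) * ?s) < e"
          using near True by (simp add: norm_mult norm_sgn del: complex_cnj_diff)
        then have "Re (cnj (?s - d k) * ?s) \<le> e" using complex_Re_le_cmod[of "cnj (?s - d k) * ?s"] by linarith
        moreover have "cnj (?s - d k) * ?s = 1 - cnj (d k) * ?s" by (simp add: left_diff_distrib ss)
        ultimately have "Re (1 - cnj (d k) * ?s) \<le> e" by (simp only:)
        then have "1 - e \<le> Re (cnj (d k) * ?s)" unfolding minus_complex.sel one_complex.sel by linarith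
        then have "cmod (h x) * (1 - e) \<le> cmod (h x) * Re (cnj (d k) * ?s)" by (intro mult_left_mono) auto
        also have "\<dots> = Re (complex_of_real (cmod (h x)) * (cnj (d k) * ?s))"
          by (simp only: times_complex.sel Re_complex_of_real Im_complex_of_real mult_zero_left diff_zero)
        also have "complex_of_real (cmod (h x)) * (cnj (d k) * ?s) = cnj (d k) * h x"
          by (subst (2) hs) (simp only: mult_ac)
        finally show ?thesis using True by (simp add: mult.commute)
      qed
    qed
    also have "\<dots> = Re (cnj (d k) * (LINT x|lborel. indicator (B k) x * h x))"
      using i1 by (subst integral_Re) auto
    also have "\<dots> \<le> cmod (cnj (d k) * (LINT x|lborel. indicator (B k) x * h x))" by (rule complex_Re_le_cmod)
    also have "\<dots> \<le> (1 + e) * cmod (LINT x|lborel. indicator (B k) x * h x)"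
      unfolding norm_mult complex_mod_cnj by (intro mult_right_mono \<open>cmod (d k) \<le> 1 + e\<close>) simp
    finally show ?thesis .
  qed
  show ?thesis using Bm disj UB main by (intro exI[of _ B]) auto
qed

lemma total_variation_density:
  assumes h: "integrable lborel h"
    and \<mu>: "\<And>B. B \<in> sets borel \<Longrightarrow> \<mu> B = (LINT x|lborel. indicator B x * h x)"
  shows "total_variation \<mu> = density lborel (\<lambda>x. ennreal (cmod (h x)))"
  unfolding total_variation_def
proof (rule measure_of_eqI)
  have [measurable]: "h \<in> borel_measurable borel" using h by auto
  let ?N = "density lborel (\<lambda>x. ennreal (cmod (h x)))"
  have N: "emeasure ?N B = ennreal (LINT x|lborel. indicator B x * cmod (h x))" if "B \<in> sets borel" for B
  proof -
    have "emeasure ?N B = (\<integral>\<^sup>+x. ennreal (cmod (h x)) * indicator B x \<partial>lborel)"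
      using that by (simp add: emeasure_density)
    also have "\<dots> = (\<integral>\<^sup>+x. ennreal (indicator B x * cmod (h x)) \<partial>lborel)"
      by (intro nn_integral_cong) (auto simp: indicator_def)
    also have "\<dots> = ennreal (LINT x|lborel. indicator B x * cmod (h x))"
      by (rule nn_integral_eq_integral[OF integrable_indicator_mult_real[OF integrable_norm[OF h] that]]) auto
    finally show ?thesis .
  qed
  have le: "ennreal (cmod (\<mu> B)) \<le> emeasure ?N B" if B: "B \<in> sets borel" for B
  proof -
    have "cmod (\<mu> B) \<le> (LINT x|lborel. cmod (indicator B x * h x))" unfolding \<mu>[OF B] by (rule integral_norm_bound)
    also have "\<dots> = (LINT x|lborel. indicator B x * cmod (h x))"
      by (intro Bochner_Integration.integral_cong) (auto simp: indicator_def)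
    finally show ?thesis unfolding N[OF B] by (rule ennreal_leI)
  qed
  fix A :: "real set" assume A: "A \<in> sets borel"
  let ?P = "{B :: nat \<Rightarrow> real set. range B \<subseteq> sets borel \<and> disjoint_family B \<and> (\<Union>i. B i) = A}"
  let ?S = "SUP B\<in>?P. \<Sum>i. ennreal (cmod (\<mu> (B i)))"
  show "?S = emeasure ?N A"
  proof (rule antisym)
    show "?S \<le> emeasure ?N A"
    proof (rule SUP_least)
      fix B assume "B \<in> ?P"
      then have B: "range B \<subseteq> sets borel" "disjoint_family B" "(\<Union>i. B i) = A" by auto
      have "(\<Sum>i. ennreal (cmod (\<mu> (B i)))) \<le> (\<Sum>i. emeasure ?N (B i))"
        using B(1) by (intro suminf_le le) auto
      also have "\<dots> = emeasure ?N A"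
        using suminf_emeasure[of B ?N] B by simp
      finally show "(\<Sum>i. ennreal (cmod (\<mu> (B i)))) \<le> emeasure ?N A" .
    qed
    define a where "a = (LINT x|lborel. indicator A x * cmod (h x))"
    have a0: "0 \<le> a" unfolding a_def by simp
    have Na: "emeasure ?N A = ennreal a" unfolding a_def by (rule N[OF A])
    show "emeasure ?N A \<le> ?S"
    proof (cases "?S = \<infinity>")
      case False
      then have "?S < top" by (simp only: less_top infinity_ennreal_def)
      then have s: "?S = ennreal (enn2real ?S)" by (rule ennreal_enn2real[symmetric])
      define s where "s = enn2real ?S"
      note s = s[folded s_def]
      have s0: "0 \<le> s" unfolding s_def by simp
      have key: "(1 - e) * a \<le> (1 + e) * s" if e: "0 < e" "e < 1" for e
      proof -
        obtain B :: "nat \<Rightarrow> real set" where B: "range B \<subseteq> sets borel" "disjoint_family B" "(\<Union>i. B i) = A"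
          and Bi: "\<And>i. (1 - e) * (LINT x|lborel. indicator (B i) x * cmod (h x)) \<le> (1 + e) * cmod (LINT x|lborel. indicator (B i) x * h x)"
          using nearly_constant_phase_partition[OF h A e] by blast
        have Bb: "B i \<in> sets borel" for i using B(1) by auto
        have "ennreal ((1 - e) * a) = ennreal (1 - e) * emeasure ?N A"
          unfolding Na using e a0 by (simp add: ennreal_mult)
        also have "\<dots> = ennreal (1 - e) * (\<Sum>i. emeasure ?N (B i))"
          using suminf_emeasure[of B ?N] B by simp
        also have "\<dots> = (\<Sum>i. ennreal (1 - e) * emeasure ?N (B i))" by simp
        also have "\<dots> \<le> (\<Sum>i. ennreal (1 + e) * ennreal (cmod (\<mu> (B i))))"
        proof (intro suminf_le)
          fix i
          have "ennreal ((1 - e) * (LINT x|lborel. indicator (B i) x * cmod (h x))) \<le> ennreal ((1 + e) * cmod (\<mu> (B i)))"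
            unfolding \<mu>[OF Bb] by (intro ennreal_leI Bi)
          then show "ennreal (1 - e) * emeasure ?N (B i) \<le> ennreal (1 + e) * ennreal (cmod (\<mu> (B i)))"
            unfolding N[OF Bb] using e by (simp add: ennreal_mult)
        qed auto
        also have "\<dots> = ennreal (1 + e) * (\<Sum>i. ennreal (cmod (\<mu> (B i))))" by simp
        also have "\<dots> \<le> ennreal (1 + e) * ?S"
          by (intro mult_left_mono SUP_upper) (use B in auto)
        also have "\<dots> = ennreal ((1 + e) * s)" unfolding s using e s0 by (simp add: ennreal_mult)
        finally show ?thesis using e s0 by (simp add: ennreal_le_iff)
      qed
      have "a \<le> s"
      proof (rule ccontr)
        assume "\<not> a \<le> s"
        then have as: "s < a" by simp
        \<comment> \<open>If \<open>s < a\<close>, this \<open>e\<close> turns \<open>a - s \<le> e * (a + s)\<close> into \<open>a - s \<le> (a - s) / 2\<close>.\<close>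
        define e where "e = (a - s) / (2 * (a + s))"
        have pos: "0 < a + s" using as s0 by linarith
        have e: "0 < e" "e < 1" unfolding e_def using as s0 pos by (auto simp: field_simps)
        have "a - s \<le> e * (a + s)" using key[OF e] by (simp add: algebra_simps)
        also have "\<dots> = (a - s) / 2" unfolding e_def using pos by (simp add: field_simps)
        finally show False using as by simp
      qed
      then show ?thesis unfolding Na s by (rule ennreal_leI)
    next
      case True
      then show ?thesis by (simp only: infinity_ennreal_def top_greatest)
    qed
  qed
qed simp

lemma positive_measure_density:
  assumes h: "integrable lborel h" and pos: "\<And>x. 0 \<le> h x"
    and \<mu>: "\<And>B. B \<in> sets borel \<Longrightarrow> \<mu> B = complex_of_real (LINT x|lborel. indicator B x * h x)"
  shows "positive_measure \<mu> = density lborel (\<lambda>x. ennreal (h x))"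
  unfolding positive_measure_def
proof (rule measure_of_eqI)
  have [measurable]: "h \<in> borel_measurable borel" using h by auto
  fix A :: "real set" assume A: "A \<in> sets borel"
  have "emeasure (density lborel (\<lambda>x. ennreal (h x))) A = (\<integral>\<^sup>+x. ennreal (h x) * indicator A x \<partial>lborel)"
    using A by (simp add: emeasure_density)
  also have "\<dots> = (\<integral>\<^sup>+x. ennreal (indicator A x * h x) \<partial>lborel)"
    by (intro nn_integral_cong) (auto simp: indicator_def)
  also have "\<dots> = ennreal (LINT x|lborel. indicator A x * h x)"
    by (rule nn_integral_eq_integral[OF integrable_indicator_mult_real[OF h A]]) (use pos in auto)
  finally show "ennreal (Re (\<mu> A)) = emeasure (density lborel (\<lambda>x. ennreal (h x))) A"
    unfolding \<mu>[OF A] by simp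
qed simp

section \<open>The momentum observable in the Fourier picture\<close>

abbreviation (input) seg :: "real \<Rightarrow> real measure" where
  "seg \<equiv> interval_measure_space"

definition zero_ext :: "real \<Rightarrow> (real \<Rightarrow> complex) \<Rightarrow> real \<Rightarrow> complex" where
  "zero_ext l f t = indicator {0..l} t * f t"

text \<open>
  The continuous representative of the Fourier transform of \<open>\<phi>\<close> extended by zero.
\<close>

definition hat :: "real \<Rightarrow> (real \<Rightarrow> complex) set \<Rightarrow> real \<Rightarrow> complex" where
  "hat l \<phi> = fourier (zero_ext l (rep \<phi>))"

lemma scaleR_indicator_complex: "indicator A x *\<^sub>R (z::complex) = indicator A x * z"
  by (simp add: indicator_def)

lemma space_interval [simp]: "space (seg l) = {0..l}"
  by (simp add: interval_measure_space_def space_restrict_space)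

lemma interval_measurable_iff:
  "f \<in> borel_measurable (seg l) \<longleftrightarrow> zero_ext l f \<in> borel_measurable borel"
  unfolding interval_measure_space_def
  by (subst borel_measurable_restrict_space_iff) (auto simp: scaleR_indicator_complex zero_ext_def[abs_def])

lemma interval_integral:
  fixes f :: "real \<Rightarrow> complex"
  shows "(LINT t|seg l. f t) = (LINT t|lborel. zero_ext l f t)"
  unfolding interval_measure_space_def
  by (subst integral_restrict_space) (auto simp: scaleR_indicator_complex zero_ext_def[abs_def])

lemma interval_AE_iff:
  "(AE t in seg l. P t) \<longleftrightarrow> (AE t in lborel. t \<in> {0..l} \<longrightarrow> P t)"
  unfolding interval_measure_space_def by (subst AE_restrict_space_iff) auto

lemma cmod_zero_ext_sq: "(cmod (zero_ext l f t))\<^sup>2 = indicator {0..l} t *\<^sub>R (cmod (f t))\<^sup>2"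
  by (simp add: zero_ext_def indicator_def)

lemma zero_ext_sq_integrable_iff:
  "zero_ext l f \<in> sq_integrable lborel \<longleftrightarrow> f \<in> sq_integrable (seg l)"
proof -
  have "integrable (seg l) (\<lambda>t. (cmod (f t))\<^sup>2) \<longleftrightarrow> integrable lborel (\<lambda>t. (cmod (zero_ext l f t))\<^sup>2)"
    unfolding interval_measure_space_def cmod_zero_ext_sq by (rule integrable_restrict_space) simp
  then show ?thesis unfolding sq_integrable_def by (simp add: interval_measurable_iff)
qed

lemma zero_ext_sq_integrable: "f \<in> sq_integrable (seg l) \<Longrightarrow> zero_ext l f \<in> sq_integrable lborel"
  by (simp add: zero_ext_sq_integrable_iff)

lemma restrict_sq_integrable:
  assumes "f \<in> sq_integrable lborel" shows "f \<in> sq_integrable (seg l)"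
  unfolding zero_ext_sq_integrable_iff[symmetric] zero_ext_def[abs_def] by (rule sq_integrable_indicator[OF assms]) simp

lemma l2norm_interval: "l2norm (seg l) f = l2norm lborel (zero_ext l f)"
  unfolding l2norm_def interval_measure_space_def cmod_zero_ext_sq by (subst integral_restrict_space) auto

lemma l2ip_interval: "l2ip (seg l) f g = l2ip lborel (zero_ext l f) g"
  unfolding l2ip_def interval_integral
  by (intro Bochner_Integration.integral_cong) (auto simp: zero_ext_def indicator_def)

lemma zero_ext_idem [simp]: "zero_ext l (zero_ext l f) = zero_ext l f"
  by (auto simp: zero_ext_def indicator_def)

lemma l2ip_zero_ext: "l2ip lborel (zero_ext l f) g = l2ip lborel (zero_ext l f) (zero_ext l g)"
  unfolding l2ip_def by (intro Bochner_Integration.integral_cong) (auto simp: zero_ext_def indicator_def)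

lemma zero_ext_integrable:
  assumes "f \<in> sq_integrable (seg l)" shows "integrable lborel (zero_ext l f)"
  using integrable_sq_integrable_interval[OF zero_ext_sq_integrable[OF assms], of 0 l]
  unfolding zero_ext_def[symmetric] zero_ext_idem .

lemma extend_zero_eq: "extend_zero l \<phi> = cls lborel (zero_ext l (rep \<phi>))"
  by (simp add: extend_zero_def zero_ext_def[abs_def])

lemma rep_zero_ext:
  assumes "\<phi> \<in> L2 (seg l)"
  shows "zero_ext l (rep \<phi>) \<in> sq_integrable lborel" "integrable lborel (zero_ext l (rep \<phi>))"
  using rep_sq_integrable[OF assms] by (auto intro: zero_ext_sq_integrable zero_ext_integrable)

lemma extend_zero_in_L2: "\<phi> \<in> L2 (seg l) \<Longrightarrow> extend_zero l \<phi> \<in> L2 lborel"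
  unfolding extend_zero_eq by (intro cls_in_L2 rep_zero_ext)

lemma hat_sq_integrable: "\<phi> \<in> L2 (seg l) \<Longrightarrow> hat l \<phi> \<in> sq_integrable lborel"
  unfolding hat_def by (intro fourier_isometry(1) rep_zero_ext)

lemma hat_measurable: "\<phi> \<in> L2 (seg l) \<Longrightarrow> hat l \<phi> \<in> borel_measurable borel"
  using sq_integrable_measurable[OF hat_sq_integrable] by simp

lemma fourier_plancherel_extend_zero:
  "\<phi> \<in> L2 (seg l) \<Longrightarrow> fourier_plancherel (extend_zero l \<phi>) = cls lborel (hat l \<phi>)"
  unfolding hat_def extend_zero_eq by (intro Plancherel(2) rep_zero_ext)

lemma hat_Parseval:
  assumes "\<psi> \<in> L2 (seg l)" "\<phi> \<in> L2 (seg l)"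
  shows "l2ip lborel (hat l \<psi>) (hat l \<phi>) = inner_L2 (seg l) \<psi> \<phi>"
  unfolding hat_def Plancherel_identity[OF rep_zero_ext(2,1)[OF assms(1)] rep_zero_ext(2,1)[OF assms(2)]]
    inner_L2_eq l2ip_interval l2ip_zero_ext[symmetric] ..

lemma zero_ext_cong_AE:
  assumes "AE t in seg l. f t = g t" shows "AE t in lborel. zero_ext l f t = zero_ext l g t"
  using assms unfolding interval_AE_iff by eventually_elim (auto simp: zero_ext_def indicator_def)

lemma fourier_zero_ext_cong_AE:
  assumes "f \<in> sq_integrable (seg l)" "g \<in> sq_integrable (seg l)"
    and "AE t in seg l. f t = g t"
  shows "fourier (zero_ext l f) = fourier (zero_ext l g)"
  using assms by (intro ext fourier_cong_AE zero_ext_cong_AE sq_integrable_measurable zero_ext_sq_integrable)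

lemma hat_cls:
  assumes "f \<in> sq_integrable (seg l)"
  shows "hat l (cls (seg l) f) = fourier (zero_ext l f)"
  unfolding hat_def
  by (intro fourier_zero_ext_cong_AE rep_sq_integrable cls_in_L2 rep_cls assms)

text \<open>
  The adjoint of a unitary operator is its inverse.
\<close>

lemma adjoint_fourier_plancherel:
  assumes "\<gamma> \<in> L2 lborel"
  shows "adjoint_L2 lborel lborel fourier_plancherel \<gamma> \<in> L2 lborel"
    and "\<psi> \<in> L2 lborel \<Longrightarrow> inner_L2 lborel \<psi> (adjoint_L2 lborel lborel fourier_plancherel \<gamma>)
           = inner_L2 lborel (fourier_plancherel \<psi>) \<gamma>"
proof -
  have bij: "bij_betw fourier_plancherel (L2 lborel) (L2 lborel)"
    and inner: "\<And>\<psi> \<phi>. \<psi> \<in> L2 lborel \<Longrightarrow> \<phi> \<in> L2 lborel \<Longrightarrow>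
      inner_L2 lborel (fourier_plancherel \<psi>) (fourier_plancherel \<phi>) = inner_L2 lborel \<psi> \<phi>"
    using Plancherel(1) by (auto simp: unitary_L2_def)
  obtain \<eta> where \<eta>: "\<eta> \<in> L2 lborel" "fourier_plancherel \<eta> = \<gamma>"
  proof -
    have "\<gamma> \<in> fourier_plancherel ` L2 lborel" using bij assms by (simp add: bij_betw_def)
    then show ?thesis using that by auto
  qed
  have eq: "adjoint_L2 lborel lborel fourier_plancherel \<gamma> = \<eta>"
    using inner \<eta> by (intro adjoint_L2_eqI) auto
  show "adjoint_L2 lborel lborel fourier_plancherel \<gamma> \<in> L2 lborel" using eq \<eta> by simp
  show "\<psi> \<in> L2 lborel \<Longrightarrow> inner_L2 lborel \<psi> (adjoint_L2 lborel lborel fourier_plancherel \<gamma>)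
           = inner_L2 lborel (fourier_plancherel \<psi>) \<gamma>"
    unfolding eq using inner \<eta> by auto
qed

text \<open>
  The adjoint of extension by zero is restriction to the interval, which does not change the representative.
\<close>

lemma adjoint_extend_zero:
  assumes "\<xi> \<in> L2 lborel"
  shows "adjoint_L2 (seg l) lborel (extend_zero l) \<xi> = cls (seg l) (rep \<xi>)"
proof (rule adjoint_L2_eqI)
  have r: "rep \<xi> \<in> sq_integrable lborel" by (rule rep_sq_integrable[OF assms])
  have ri: "rep \<xi> \<in> sq_integrable (seg l)" by (rule restrict_sq_integrable[OF r])
  show "cls (seg l) (rep \<xi>) \<in> L2 (seg l)" by (rule cls_in_L2[OF ri])
  fix \<psi> assume \<psi>: "\<psi> \<in> L2 (seg l)"
  have "inner_L2 (seg l) \<psi> (cls (seg l) (rep \<xi>)) = l2ip lborel (zero_ext l (rep \<psi>)) (rep \<xi>)"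
    unfolding inner_L2_rep_cls[OF \<psi> ri] l2ip_interval ..
  also have "\<dots> = inner_L2 lborel (extend_zero l \<psi>) \<xi>"
    using inner_L2_cls[OF rep_zero_ext(1)[OF \<psi>] r] unfolding extend_zero_eq cls_rep[OF assms] by simp
  finally show "inner_L2 (seg l) \<psi> (cls (seg l) (rep \<xi>)) = inner_L2 lborel (extend_zero l \<psi>) \<xi>" .
qed

text \<open>
  Both adjoints move to the left argument of the inner product, where they leave \<open>hat l \<psi>\<close>.
\<close>

lemma matrix_measure_momentum:
  assumes \<psi>: "\<psi> \<in> L2 (seg l)" and \<phi>: "\<phi> \<in> L2 (seg l)"
    and Y: "Y \<in> sets borel"
  shows "matrix_measure (seg l) (momentum_povm l) \<psi> \<phi> Y
       = (LINT x|lborel. indicator Y x * (cnj (hat l \<psi> x) * hat l \<phi> x))"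
proof -
  let ?I = "seg l"
  have h: "hat l \<phi> \<in> sq_integrable lborel" "hat l \<psi> \<in> sq_integrable lborel"
    using \<psi> \<phi> by (auto intro: hat_sq_integrable)
  let ?g = "\<lambda>x. indicator Y x * rep (cls lborel (hat l \<phi>)) x"
  have r: "rep (cls lborel (hat l \<phi>)) \<in> sq_integrable lborel" by (intro rep_sq_integrable cls_in_L2 h)
  have g: "?g \<in> sq_integrable lborel"
    by (rule sq_integrable_indicator[OF r]) (use Y in simp)
  have pos: "position_line Y (fourier_plancherel (extend_zero l \<phi>)) = cls lborel ?g"
    unfolding fourier_plancherel_extend_zero[OF \<phi>] position_line_def ..
  define \<xi> where "\<xi> = momentum_line Y (extend_zero l \<phi>)"
  have \<xi>_eq: "\<xi> = adjoint_L2 lborel lborel fourier_plancherel (cls lborel ?g)"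
    unfolding \<xi>_def momentum_line_def by (simp add: pos)
  have \<xi>: "\<xi> \<in> L2 lborel" unfolding \<xi>_eq by (intro adjoint_fourier_plancherel(1) cls_in_L2 g)
  have "matrix_measure ?I (momentum_povm l) \<psi> \<phi> Y = inner_L2 ?I \<psi> (cls ?I (rep \<xi>))"
    unfolding matrix_measure_def momentum_povm_def by (simp add: adjoint_extend_zero[OF \<xi>] flip: \<xi>_def)
  also have "\<dots> = l2ip lborel (zero_ext l (rep \<psi>)) (rep \<xi>)"
    unfolding inner_L2_rep_cls[OF \<psi> restrict_sq_integrable[OF rep_sq_integrable[OF \<xi>]]] l2ip_interval ..
  also have "\<dots> = inner_L2 lborel (extend_zero l \<psi>) \<xi>"
    using inner_L2_cls[OF rep_zero_ext(1)[OF \<psi>] rep_sq_integrable[OF \<xi>]] unfolding extend_zero_eq cls_rep[OF \<xi>] by simp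
  also have "\<dots> = inner_L2 lborel (cls lborel (hat l \<psi>)) (cls lborel ?g)"
    unfolding \<xi>_eq fourier_plancherel_extend_zero[OF \<psi>, symmetric]
    by (intro adjoint_fourier_plancherel(2) cls_in_L2 g extend_zero_in_L2 \<psi>)
  also have "\<dots> = l2ip lborel (hat l \<psi>) ?g" by (rule inner_L2_cls[OF h(2) g])
  also have "\<dots> = l2ip lborel (hat l \<psi>) (\<lambda>x. indicator Y x * hat l \<phi> x)"
  proof (rule l2ip_cong_AE)
    show "AE x in lborel. ?g x = indicator Y x * hat l \<phi> x"
      using rep_cls[OF h(1)] by eventually_elim simp
    show "(\<lambda>x. indicator Y x * hat l \<phi> x) \<in> borel_measurable lborel"
      by (rule sq_integrable_measurable[OF sq_integrable_indicator[OF h(1)]]) (use Y in simp)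
  qed (use sq_integrable_measurable[OF g] sq_integrable_measurable[OF h(2)] in auto)
  also have "\<dots> = (LINT x|lborel. indicator Y x * (cnj (hat l \<psi> x) * hat l \<phi> x))"
    unfolding l2ip_def by (simp add: mult.left_commute)
  finally show ?thesis .
qed

lemma moment_condition_iff:
  assumes \<psi>: "\<psi> \<in> L2 (seg l)" and \<phi>: "\<phi> \<in> L2 (seg l)"
  shows "(\<integral>\<^sup>+ x. ennreal (\<bar>x\<bar> ^ n) \<partial>total_variation (matrix_measure (seg l) (momentum_povm l) \<psi> \<phi>)) < \<infinity>
     \<longleftrightarrow> integrable lborel (\<lambda>x. complex_of_real (x ^ n) * (cnj (hat l \<psi> x) * hat l \<phi> x))"
proof -
  have [measurable]: "hat l \<phi> \<in> borel_measurable borel" "hat l \<psi> \<in> borel_measurable borel"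
    using \<psi> \<phi> by (auto intro: hat_measurable)
  have h: "integrable lborel (\<lambda>x. cnj (hat l \<psi> x) * hat l \<phi> x)"
    by (intro integrable_cnj_mult hat_sq_integrable \<psi> \<phi>)
  have "total_variation (matrix_measure (seg l) (momentum_povm l) \<psi> \<phi>)
      = density lborel (\<lambda>x. ennreal (cmod (cnj (hat l \<psi> x) * hat l \<phi> x)))"
    by (rule total_variation_density[OF h]) (rule matrix_measure_momentum[OF \<psi> \<phi>])
  then have "(\<integral>\<^sup>+ x. ennreal (\<bar>x\<bar> ^ n) \<partial>total_variation (matrix_measure (seg l) (momentum_povm l) \<psi> \<phi>))
     = (\<integral>\<^sup>+ x. ennreal (cmod (cnj (hat l \<psi> x) * hat l \<phi> x)) * ennreal (\<bar>x\<bar> ^ n) \<partial>lborel)"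
    by (simp add: nn_integral_density)
  also have "\<dots> = (\<integral>\<^sup>+ x. ennreal (cmod (complex_of_real (x ^ n) * (cnj (hat l \<psi> x) * hat l \<phi> x))) \<partial>lborel)"
    by (intro nn_integral_cong) (simp add: norm_mult norm_power power_abs mult_ac flip: ennreal_mult')
  finally show ?thesis by (simp add: integrable_iff_bounded)
qed

lemma moment_condition_tilde_iff:
  assumes \<phi>: "\<phi> \<in> L2 (seg l)"
  shows "(\<integral>\<^sup>+ x. ennreal (x ^ (2 * n)) \<partial>positive_measure (matrix_measure (seg l) (momentum_povm l) \<phi> \<phi>)) < \<infinity>
     \<longleftrightarrow> (\<lambda>x. complex_of_real (x ^ n) * hat l \<phi> x) \<in> sq_integrable lborel"
proof -
  have [measurable]: "hat l \<phi> \<in> borel_measurable borel" using \<phi> by (rule hat_measurable)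
  have h: "integrable lborel (\<lambda>x. (cmod (hat l \<phi> x))\<^sup>2)"
    by (intro sq_integrable_integrable hat_sq_integrable \<phi>)
  have "positive_measure (matrix_measure (seg l) (momentum_povm l) \<phi> \<phi>)
      = density lborel (\<lambda>x. ennreal ((cmod (hat l \<phi> x))\<^sup>2))"
  proof (rule positive_measure_density[OF h])
    fix B :: "real set" assume B: "B \<in> sets borel"
    have "matrix_measure (seg l) (momentum_povm l) \<phi> \<phi> B
        = (LINT x|lborel. complex_of_real (indicator B x * (cmod (hat l \<phi> x))\<^sup>2))"
      unfolding matrix_measure_momentum[OF \<phi> \<phi> B]
      by (intro Bochner_Integration.integral_cong refl)
         (simp only: mult.commute[of "cnj _"] complex_norm_square[symmetric], simp add: indicator_def)
    also have "\<dots> = complex_of_real (LINT x|lborel. indicator B x * (cmod (hat l \<phi> x))\<^sup>2)"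
      by (rule integral_complex_of_real)
    finally show "matrix_measure (seg l) (momentum_povm l) \<phi> \<phi> B
        = complex_of_real (LINT x|lborel. indicator B x * (cmod (hat l \<phi> x))\<^sup>2)" .
  qed simp
  then have "(\<integral>\<^sup>+ x. ennreal (x ^ (2 * n)) \<partial>positive_measure (matrix_measure (seg l) (momentum_povm l) \<phi> \<phi>))
     = (\<integral>\<^sup>+ x. ennreal ((cmod (hat l \<phi> x))\<^sup>2) * ennreal (x ^ (2 * n)) \<partial>lborel)"
    by (simp add: nn_integral_density)
  also have "\<dots> = (\<integral>\<^sup>+ x. ennreal ((cmod (complex_of_real (x ^ n) * hat l \<phi> x))\<^sup>2) \<partial>lborel)"
  proof (rule nn_integral_cong)
    fix x
    have "ennreal ((cmod (hat l \<phi> x))\<^sup>2) * ennreal (x ^ (2 * n)) = ennreal ((cmod (hat l \<phi> x))\<^sup>2 * x ^ (2 * n))"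
      by (rule ennreal_mult[symmetric]) (simp_all add: power_even_eq)
    also have "(cmod (hat l \<phi> x))\<^sup>2 * x ^ (2 * n) = (cmod (complex_of_real (x ^ n) * hat l \<phi> x))\<^sup>2"
      by (simp only: norm_mult norm_of_real power_mult_distrib power2_abs power_even_eq) (rule mult.commute)
    finally show "ennreal ((cmod (hat l \<phi> x))\<^sup>2) * ennreal (x ^ (2 * n)) = ennreal ((cmod (complex_of_real (x ^ n) * hat l \<phi> x))\<^sup>2)" .
  qed
  finally show ?thesis by (simp add: sq_integrable_iff_nn)
qed

lemma moment_integral:
  assumes \<psi>: "\<psi> \<in> L2 (seg l)" and \<phi>: "\<phi> \<in> L2 (seg l)"
    and int: "integrable lborel (\<lambda>x. complex_of_real (x ^ n) * (cnj (hat l \<psi> x) * hat l \<phi> x))"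
  shows "complex_measure_integral (matrix_measure (seg l) (momentum_povm l) \<psi> \<phi>) (\<lambda>x. x ^ n)
     = (LINT x|lborel. complex_of_real (x ^ n) * (cnj (hat l \<psi> x) * hat l \<phi> x))"
  by (rule complex_measure_integral_density[OF _ int])
     (auto intro!: integrable_cnj_mult hat_sq_integrable \<psi> \<phi> matrix_measure_momentum)

section \<open>Weakly finite first moments\<close>

definition diffquot :: "real \<Rightarrow> (real \<Rightarrow> complex) \<Rightarrow> real \<Rightarrow> complex" where
  "diffquot h f t = complex_of_real (1 / h) * (f (t + h) - f t)"

lemma sq_integrable_translate:
  fixes f :: "real \<Rightarrow> complex"
  assumes f: "f \<in> sq_integrable lborel" shows "(\<lambda>t. f (t + h)) \<in> sq_integrable lborel"
proof -
  have [measurable]: "f \<in> borel_measurable borel" using sq_integrable_measurable[OF f] by simp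
  have "integrable lborel (\<lambda>t. (cmod (f (t + h)))\<^sup>2)"
    using integrable_translate[OF sq_integrable_integrable[OF f]] .
  then show ?thesis by (simp add: sq_integrable_def)
qed

lemma diffquot_sq_integrable:
  "f \<in> sq_integrable lborel \<Longrightarrow> diffquot h f \<in> sq_integrable lborel"
  unfolding diffquot_def[abs_def]
  by (intro sq_integrable_cmult sq_integrable_diff sq_integrable_translate)

lemma diffquot_integrable:
  "integrable lborel f \<Longrightarrow> integrable lborel (diffquot h f)"
  unfolding diffquot_def[abs_def]
  by (intro integrable_mult_right Bochner_Integration.integrable_diff integrable_translate)

lemma fourier_translate: "fourier (\<lambda>t. f (t + h)) x = exp (\<i> * complex_of_real (x * h)) * fourier f x"
proof -
  let ?F = "\<lambda>t. wave (x * (t - h)) * f t"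
  have "(LINT t|lborel. wave (x * t) * f (t + h)) = (LINT t|lborel. ?F (t + h))"
    by simp
  also have "\<dots> = (LINT t|lborel. ?F t)" by (rule integral_translate)
  also have "\<dots> = (LINT t|lborel. exp (\<i> * complex_of_real (x * h)) * (wave (x * t) * f t))"
  proof (intro Bochner_Integration.integral_cong refl)
    fix t
    have "- \<i> * complex_of_real (x * (t - h)) = \<i> * complex_of_real (x * h) + - \<i> * complex_of_real (x * t)"
      by (simp add: algebra_simps)
    then have "wave (x * (t - h)) = exp (\<i> * complex_of_real (x * h)) * wave (x * t)"
      by (simp only: exp_add)
    then show "?F t = exp (\<i> * complex_of_real (x * h)) * (wave (x * t) * f t)"
      by (simp only: mult.assoc)
  qed
  also have "\<dots> = exp (\<i> * complex_of_real (x * h)) * (LINT t|lborel. wave (x * t) * f t)"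
    by (rule integral_mult_right_zero)
  finally show ?thesis unfolding fourier_def by (simp only: mult.left_commute)
qed

lemma fourier_diffquot:
  assumes f: "integrable lborel f"
  shows "fourier (diffquot h f) x = (exp (\<i> * complex_of_real (x * h)) - 1) / complex_of_real h * fourier f x"
proof -
  have "fourier (diffquot h f) x = complex_of_real (1 / h) * (fourier (\<lambda>t. f (t + h)) x - fourier f x)"
    unfolding diffquot_def[abs_def] by (simp only: fourier_cmult fourier_diff[OF integrable_translate[OF f] f])
  then show ?thesis unfolding fourier_translate by (simp add: field_simps)
qed

lemma diffquot_multiplier_bound:
  assumes "h \<noteq> 0" shows "cmod ((exp (\<i> * complex_of_real (x * h)) - 1) / complex_of_real h) \<le> \<bar>x\<bar>"
  using iexp_approx1[of "x * h" 0] assms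
  by (simp add: norm_divide abs_mult divide_le_eq)

text \<open>
  The derivative of the exponential function at zero.
\<close>

lemma diffquot_multiplier_tendsto:
  "(\<lambda>k. (exp (\<i> * complex_of_real (x * inverse (real (Suc k)))) - 1) / complex_of_real (inverse (real (Suc k))))
     \<longlonglongrightarrow> \<i> * complex_of_real x"
proof -
  have "((\<lambda>z. exp (\<i> * complex_of_real x * z)) has_field_derivative (\<i> * complex_of_real x)) (at 0)"
    by (auto intro!: derivative_eq_intros)
  then have lim: "(\<lambda>z. (exp (\<i> * complex_of_real x * z) - 1) / z) \<midarrow>0\<rightarrow> \<i> * complex_of_real x"
    by (simp add: DERIV_def)
  have "filterlim (\<lambda>k. complex_of_real (inverse (real (Suc k)))) (at 0) sequentially"
    unfolding filterlim_at
  proof (intro conjI always_eventually allI)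
    have "(\<lambda>k. complex_of_real (inverse (real (Suc k)))) \<longlonglongrightarrow> complex_of_real 0"
      by (intro tendsto_of_real LIMSEQ_inverse_real_of_nat)
    then show "(\<lambda>k. complex_of_real (inverse (real (Suc k)))) \<longlonglongrightarrow> 0" by simp
  next
    fix k
    have "inverse (real (Suc k)) \<noteq> 0" by simp
    then show "complex_of_real (inverse (real (Suc k))) \<noteq> 0"
      by (simp only: of_real_eq_0_iff not_False_eq_True)
  qed simp
  from filterlim_compose[OF lim this] show ?thesis by (simp add: mult.assoc del: of_nat_Suc)
qed

text \<open>
  A function vanishing off \<open>{0..l}\<close> has a difference quotient supported in that interval and its
  translate; on the translate it agrees with the opposite difference quotient on the interval.
\<close>

lemma l2norm_diffquot_le:
  assumes f: "zero_ext l f = f" "f \<in> sq_integrable lborel" and h: "h \<noteq> 0"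
    and C: "\<And>k. k \<noteq> 0 \<Longrightarrow> l2norm (seg l) (diffquot k f) \<le> C"
  shows "l2norm lborel (diffquot h f) \<le> 2 * C"
proof -
  let ?g = "diffquot h f" and ?m = "diffquot (- h) f"
  let ?s = "\<lambda>t. zero_ext l ?m (t + h)"
  have m: "zero_ext l ?m \<in> sq_integrable lborel"
    by (rule zero_ext_sq_integrable[OF restrict_sq_integrable[OF diffquot_sq_integrable[OF f(2)]]])
  have e: "zero_ext l ?g \<in> sq_integrable lborel"
    by (rule zero_ext_sq_integrable[OF restrict_sq_integrable[OF diffquot_sq_integrable[OF f(2)]]])
  have s: "?s \<in> sq_integrable lborel" by (rule sq_integrable_translate[OF m])
  have f0: "f t = 0" if "t \<notin> {0..l}" for t
    using that fun_cong[OF f(1), of t] by (simp add: zero_ext_def)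
  have decomp: "cmod (?g t) \<le> cmod (complex_of_real (cmod (zero_ext l ?g t)) + complex_of_real (cmod (?s t)))" for t
  proof -
    have "cmod (?g t) \<le> cmod (zero_ext l ?g t) + cmod (?s t)"
    proof (cases "t \<in> {0..l}")
      case True
      then show ?thesis by (simp add: zero_ext_def)
    next
      case t: False
      show ?thesis
      proof (cases "t + h \<in> {0..l}")
        case True
        then have "?s t = complex_of_real (- 1 / h) * (f t - f (t + h))"
          by (simp add: zero_ext_def diffquot_def)
        also have "\<dots> = ?g t" by (simp add: diffquot_def diff_divide_distrib)
        finally have "?s t = ?g t" .
        then show ?thesis by simp
      next
        case False
        then show ?thesis using t f0 by (simp add: diffquot_def)
      qed
    qed
    then show ?thesis by (simp flip: of_real_add)
  qed
  have ec: "(\<lambda>t. complex_of_real (cmod (zero_ext l ?g t))) \<in> sq_integrable lborel"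
           "(\<lambda>t. complex_of_real (cmod (?s t))) \<in> sq_integrable lborel"
    using e s by (auto simp: sq_integrable_def)
  have "l2norm lborel ?g \<le> l2norm lborel (\<lambda>t. complex_of_real (cmod (zero_ext l ?g t)) + complex_of_real (cmod (?s t)))"
    unfolding l2norm_def
    by (intro real_sqrt_le_mono integral_mono sq_integrable_integrable diffquot_sq_integrable f sq_integrable_add ec power_mono decomp) simp
  also have "\<dots> \<le> l2norm lborel (\<lambda>t. complex_of_real (cmod (zero_ext l ?g t))) + l2norm lborel (\<lambda>t. complex_of_real (cmod (?s t)))"
    by (rule l2norm_triangle[OF ec])
  also have "l2norm lborel (\<lambda>t. complex_of_real (cmod (zero_ext l ?g t))) = l2norm (seg l) ?g"
    unfolding l2norm_interval by (simp add: l2norm_def)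
  also have "l2norm lborel (\<lambda>t. complex_of_real (cmod (?s t))) = l2norm (seg l) ?m"
    unfolding l2norm_interval using integral_translate[of "\<lambda>t. (cmod (zero_ext l ?m t))\<^sup>2" h] by (simp add: l2norm_def)
  also have "l2norm (seg l) ?g + l2norm (seg l) ?m \<le> 2 * C"
    using C[of h] C[of "- h"] h by simp
  finally show ?thesis .
qed

text \<open>
  If \<open>x * hat \<phi>\<close> pairs absolutely with every transform \<open>hat \<psi>\<close>, the difference quotients of \<open>\<phi>\<close> are weakly
  bounded in \<open>L\<^sup>2\<close> of the interval, because \<open>\<bar>exp (\<i> x h) - 1\<bar> / \<bar>h\<bar> \<le> \<bar>x\<bar>\<close>. Uniform boundedness turns this into a
  norm bound; letting \<open>h\<close> tend to zero on the Fourier side, Fatou's lemma bounds \<open>x * hat \<phi>\<close>.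
\<close>

theorem weak_first_moment_imp_strong:
  assumes \<phi>: "\<phi> \<in> L2 (seg l)"
    and weak: "\<And>\<psi>. \<psi> \<in> L2 (seg l) \<Longrightarrow>
      integrable lborel (\<lambda>x. complex_of_real x * (cnj (hat l \<psi> x) * hat l \<phi> x))"
  shows "(\<lambda>x. complex_of_real x * hat l \<phi> x) \<in> sq_integrable lborel"
proof -
  let ?I = "seg l"
  define f where "f = zero_ext l (rep \<phi>)"
  have f: "f \<in> sq_integrable lborel" "integrable lborel f" "zero_ext l f = f"
    unfolding f_def using rep_zero_ext[OF \<phi>] by auto
  have hat_f: "hat l \<phi> = fourier f" unfolding hat_def f_def ..
  have dq: "diffquot h f \<in> sq_integrable lborel" for h by (rule diffquot_sq_integrable[OF f(1)])
  have "\<exists>C. \<forall>h\<in>UNIV - {0}. l2norm ?I (diffquot h f) \<le> C"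
  proof (rule l2_uniform_boundedness)
    show "diffquot h f \<in> sq_integrable ?I" for h by (rule restrict_sq_integrable[OF dq])
    fix u assume u: "u \<in> sq_integrable ?I"
    have eu: "zero_ext l u \<in> sq_integrable lborel" "integrable lborel (zero_ext l u)"
      using u by (auto intro: zero_ext_sq_integrable zero_ext_integrable)
    have hu: "hat l (cls ?I u) = fourier (zero_ext l u)" by (rule hat_cls[OF u])
    have int: "integrable lborel (\<lambda>x. complex_of_real x * (cnj (fourier (zero_ext l u) x) * fourier f x))"
      using weak[OF cls_in_L2[OF u]] unfolding hu hat_f .
    define B where "B = (LINT x|lborel. cmod (complex_of_real x * (cnj (fourier (zero_ext l u) x) * fourier f x)))"
    have "cmod (l2ip ?I u (diffquot h f)) \<le> B" if "h \<noteq> 0" for h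
    proof -
      have "l2ip ?I u (diffquot h f) = l2ip lborel (fourier (zero_ext l u)) (fourier (diffquot h f))"
        unfolding l2ip_interval by (rule Plancherel_identity[symmetric, OF eu(2,1) diffquot_integrable[OF f(2)] dq])
      also have "cmod \<dots> \<le> (LINT x|lborel. cmod (cnj (fourier (zero_ext l u) x) * fourier (diffquot h f) x))"
        unfolding l2ip_def by (rule integral_norm_bound)
      also have "\<dots> \<le> B"
        unfolding B_def
      proof (rule integral_mono)
        show "integrable lborel (\<lambda>x. cmod (cnj (fourier (zero_ext l u) x) * fourier (diffquot h f) x))"
          by (intro integrable_norm integrable_cnj_mult fourier_isometry(1) eu diffquot_integrable dq f)
        show "integrable lborel (\<lambda>x. cmod (complex_of_real x * (cnj (fourier (zero_ext l u) x) * fourier f x)))"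
          by (rule integrable_norm[OF int])
        fix x
        have "cmod (fourier (diffquot h f) x) \<le> \<bar>x\<bar> * cmod (fourier f x)"
          unfolding fourier_diffquot[OF f(2)] norm_mult
          by (intro mult_right_mono diffquot_multiplier_bound that) simp
        then have "cmod (fourier (zero_ext l u) x) * cmod (fourier (diffquot h f) x) \<le> cmod (fourier (zero_ext l u) x) * (\<bar>x\<bar> * cmod (fourier f x))"
          by (intro mult_left_mono) simp_all
        then show "cmod (cnj (fourier (zero_ext l u) x) * fourier (diffquot h f) x)
            \<le> cmod (complex_of_real x * (cnj (fourier (zero_ext l u) x) * fourier f x))"
          by (simp add: norm_mult mult_ac)
      qed
      finally show ?thesis .
    qed
    then show "\<exists>B. \<forall>h\<in>UNIV - {0}. cmod (l2ip ?I u (diffquot h f)) \<le> B" by auto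
  qed
  then obtain C where C: "\<And>h. h \<noteq> 0 \<Longrightarrow> l2norm ?I (diffquot h f) \<le> C" by auto
  define e where "e k = inverse (real (Suc k))" for k
  have e0: "e k \<noteq> 0" for k unfolding e_def by simp
  have fm: "fourier f \<in> borel_measurable borel" using borel_measurable_fourier[OF f(2)] by simp
  have "(\<lambda>x. \<i> * complex_of_real x * fourier f x) \<in> sq_integrable lborel"
  proof (rule l2_Fatou(1)[where s="\<lambda>k. fourier (diffquot (e k) f)" and C="2 * C"])
    show "fourier (diffquot (e k) f) \<in> sq_integrable lborel" for k
      by (intro fourier_isometry(1) diffquot_integrable dq f)
    show "(\<lambda>x. \<i> * complex_of_real x * fourier f x) \<in> borel_measurable lborel" using fm by simp
    show "AE x in lborel. (\<lambda>k. fourier (diffquot (e k) f) x) \<longlonglongrightarrow> \<i> * complex_of_real x * fourier f x"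
      unfolding fourier_diffquot[OF f(2)] e_def
      by (intro AE_I2 tendsto_mult diffquot_multiplier_tendsto tendsto_const)
    show "\<forall>\<^sub>F k in sequentially. l2norm lborel (fourier (diffquot (e k) f)) \<le> 2 * C"
      using l2norm_diffquot_le[OF f(3,1) e0 C]
      by (intro always_eventually allI) (simp add: fourier_isometry(2)[OF diffquot_integrable[OF f(2)] dq])
  qed
  from sq_integrable_cmult[OF this, of "- \<i>"] show ?thesis unfolding hat_f by (simp add: mult.assoc[symmetric])
qed

section \<open>Absolutely continuous functions and their derivatives\<close>

lemma abs_continuous_on_imp_continuous_on:
  assumes "abs_continuous_on {a..b} f" shows "continuous_on {a..b} f"
  unfolding continuous_on_iff
proof (intro ballI allI impI)
  fix x e :: real assume x: "x \<in> {a..b}" and "0 < e"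
  then obtain d where "0 < d" and d: "\<And>(m::nat) u v. (\<forall>i<m. u i \<le> v i \<and> {u i..v i} \<subseteq> {a..b}) \<Longrightarrow>
      disjoint_family_on (\<lambda>i. {u i<..<v i}) {..<m} \<Longrightarrow> (\<Sum>i<m. v i - u i) < d \<Longrightarrow>
      (\<Sum>i<m. dist (f (u i)) (f (v i))) < e"
    using assms unfolding abs_continuous_on_def by meson
  have one: "dist (f u) (f v) < e" if "u \<le> v" "{u..v} \<subseteq> {a..b}" "v - u < d" for u v
    using d[of 1 "\<lambda>_. u" "\<lambda>_. v"] that by (simp add: disjoint_family_on_def)
  show "\<exists>d>0. \<forall>y\<in>{a..b}. dist y x < d \<longrightarrow> dist (f y) (f x) < e"
  proof (intro exI[of _ d] conjI ballI impI \<open>0 < d\<close>)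
    fix y assume y: "y \<in> {a..b}" "dist y x < d"
    show "dist (f y) (f x) < e"
    proof (cases "y \<le> x")
      case True
      then show ?thesis using one[of y x] x y by (simp add: dist_real_def)
    next
      case False
      then show ?thesis using one[of x y] x y by (simp add: dist_real_def dist_commute)
    qed
  qed
qed

text \<open>
  The fundamental theorem of calculus for absolutely continuous functions. On the exceptional null set the
  gauge is chosen inside an open set of small measure, so that the increments of \<open>F\<close> over the intervals
  tagged there are small by absolute continuity; elsewhere the gauge comes from differentiability.
\<close>

theorem abs_continuous_on_FTC:
  fixes F :: "real \<Rightarrow> 'a :: euclidean_space"
  assumes ab: "a \<le> b" and ac: "abs_continuous_on {a..b} F" and N: "negligible N"
    and der: "\<And>x. x \<in> {a..b} - N \<Longrightarrow> (F has_vector_derivative F' x) (at x within {a..b})"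
  shows "(F' has_integral (F b - F a)) {a..b}"
proof -
  define G where "G x = (if x \<in> N then 0 else F' x)" for x
  have "(G has_integral (F b - F a)) (cbox a b)"
    unfolding has_integral
  proof (intro allI impI)
    fix e :: real assume e: "0 < e"
    then have "0 < e / 2" by simp
    then obtain \<delta> where "0 < \<delta>" and \<delta>: "\<And>(m::nat) u v. (\<forall>i<m. u i \<le> v i \<and> {u i..v i} \<subseteq> {a..b}) \<Longrightarrow>
      disjoint_family_on (\<lambda>i. {u i<..<v i}) {..<m} \<Longrightarrow> (\<Sum>i<m. v i - u i) < \<delta> \<Longrightarrow>
      (\<Sum>i<m. dist (F (u i)) (F (v i))) < e / 2"
      using ac unfolding abs_continuous_on_def by meson
    have Nn: "N \<in> null_sets lebesgue" using N by (simp add: negligible_iff_null_sets)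
    obtain T where T: "open T" "N \<subseteq> T" "emeasure lebesgue (T - N) < ennreal \<delta>"
      by (rule sets_lebesgue_outer_open[of N \<delta>]) (use Nn \<open>0 < \<delta>\<close> in auto)
    have Tm: "emeasure lebesgue T < ennreal \<delta>"
      using T(3) emeasure_Diff_null_set[OF Nn, of T] T(1) by simp
    define c where "c = e / (2 * (b - a + 1))"
    have c: "0 < c" unfolding c_def using e ab by simp
    have "\<forall>x. \<exists>d>0. (x \<in> {a..b} - N \<longrightarrow> (\<forall>y\<in>{a..b}. \<bar>y - x\<bar> < d \<longrightarrow> norm (F y - F x - (y - x) *\<^sub>R F' x) \<le> c * \<bar>y - x\<bar>)) \<and>
        (x \<in> N \<longrightarrow> ball x d \<subseteq> T)"
    proof
      fix x
      show "\<exists>d>0. (x \<in> {a..b} - N \<longrightarrow> (\<forall>y\<in>{a..b}. \<bar>y - x\<bar> < d \<longrightarrow> norm (F y - F x - (y - x) *\<^sub>R F' x) \<le> c * \<bar>y - x\<bar>)) \<and>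
        (x \<in> N \<longrightarrow> ball x d \<subseteq> T)"
      proof (cases "x \<in> N")
        case True
        then obtain d where "0 < d" "ball x d \<subseteq> T" using T by (meson open_contains_ball subsetD)
        then show ?thesis using True by auto
      next
        case xN: False
        show ?thesis
        proof (cases "x \<in> {a..b}")
          case True
          have "\<exists>d>0. \<forall>y\<in>{a..b}. norm (y - x) < d \<longrightarrow> norm (F y - F x - (y - x) *\<^sub>R F' x) \<le> c * norm (y - x)"
            using der[of x] True xN c unfolding has_vector_derivative_def has_derivative_within_alt by auto
          then show ?thesis using xN by auto
        next
          case False
          then show ?thesis using xN zero_less_one by blast
        qed
      qed
    qed
    from choice[OF this] obtain d where "\<forall>x. 0 < d x \<and>
        (x \<in> {a..b} - N \<longrightarrow> (\<forall>y\<in>{a..b}. \<bar>y - x\<bar> < d x \<longrightarrow> norm (F y - F x - (y - x) *\<^sub>R F' x) \<le> c * \<bar>y - x\<bar>)) \<and>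
        (x \<in> N \<longrightarrow> ball x (d x) \<subseteq> T)" ..
    then have d0: "\<And>x. 0 < d x"
      and d1: "\<And>x y. x \<in> {a..b} - N \<Longrightarrow> y \<in> {a..b} \<Longrightarrow> \<bar>y - x\<bar> < d x \<Longrightarrow> norm (F y - F x - (y - x) *\<^sub>R F' x) \<le> c * \<bar>y - x\<bar>"
      and d2: "\<And>x. x \<in> N \<Longrightarrow> ball x (d x) \<subseteq> T"
      by blast+
    have "norm ((\<Sum>(x, K)\<in>D. measure lborel K *\<^sub>R G x) - (F b - F a)) < e"
      if D: "D tagged_division_of cbox a b" and fine: "(\<lambda>x. ball x (d x)) fine D" for D
    proof -
      have D': "D tagged_division_of {a..b}" using D by simp
      have finD: "finite D" using D by (rule tagged_division_of_finite)
      have tag: "\<exists>u v. K = {u..v} \<and> u \<le> v \<and> x \<in> {u..v} \<and> {u..v} \<subseteq> {a..b} \<and> {u..v} \<subseteq> ball x (d x)"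
        if xK: "(x, K) \<in> D" for x K
      proof -
        obtain u v where "K = cbox u v" using tagged_division_ofD(4)[OF D xK] by blast
        moreover have "x \<in> K" "K \<subseteq> cbox a b" using tagged_division_ofD(2,3)[OF D xK] by auto
        moreover have "K \<subseteq> ball x (d x)" using fine xK by (auto simp: fine_def)
        ultimately show ?thesis by auto
      qed
      let ?t = "\<lambda>(x, K). measure lborel K *\<^sub>R G x - (F (Sup K) - F (Inf K))"
      define D1 where "D1 = {p \<in> D. fst p \<notin> N}"
      define D2 where "D2 = {p \<in> D. fst p \<in> N}"
      have DD: "D = D1 \<union> D2" "D1 \<inter> D2 = {}" "finite D1" "finite D2" unfolding D1_def D2_def using finD by auto
      have "(\<Sum>(x, K)\<in>D. measure lborel K *\<^sub>R G x) - (F b - F a) = (\<Sum>p\<in>D. ?t p)"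
        using additive_tagged_division_1[OF ab D', of F] by (simp add: sum_subtractf case_prod_unfold)
      also have "\<dots> = (\<Sum>p\<in>D1. ?t p) + (\<Sum>p\<in>D2. ?t p)"
        unfolding DD(1) by (rule sum.union_disjoint[OF DD(3,4,2)])
      finally have split: "(\<Sum>(x, K)\<in>D. measure lborel K *\<^sub>R G x) - (F b - F a) = (\<Sum>p\<in>D1. ?t p) + (\<Sum>p\<in>D2. ?t p)" .
      have "norm (\<Sum>p\<in>D1. ?t p) \<le> (\<Sum>p\<in>D1. c * measure lborel (snd p))"
      proof (rule sum_norm_le)
        fix p assume "p \<in> D1"
        then obtain x K where p: "p = (x, K)" "(x, K) \<in> D" "x \<notin> N" unfolding D1_def by (cases p) auto
        obtain u v where K: "K = {u..v}" "u \<le> v" "x \<in> {u..v}" "{u..v} \<subseteq> {a..b}" "{u..v} \<subseteq> ball x (d x)"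
          using tag[OF p(2)] by blast
        have xab: "x \<in> {a..b} - N" "u \<in> {a..b}" "v \<in> {a..b}" "\<bar>u - x\<bar> < d x" "\<bar>v - x\<bar> < d x"
          using K p(3) subsetD[OF K(5), of u] subsetD[OF K(5), of v] by (auto simp: dist_real_def)
        have eq: "(v - u) *\<^sub>R F' x - (F v - F u) = (F u - F x - (u - x) *\<^sub>R F' x) - (F v - F x - (v - x) *\<^sub>R F' x)"
          by (simp add: algebra_simps)
        have "norm ((v - u) *\<^sub>R F' x - (F v - F u)) \<le> c * \<bar>u - x\<bar> + c * \<bar>v - x\<bar>"
          unfolding eq
          by (rule order_trans[OF norm_triangle_ineq4 add_mono[OF d1[OF xab(1,2,4)] d1[OF xab(1,3,5)]]])
        also have "\<dots> = c * (v - u)" using K(3) by (simp flip: distrib_left)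
        finally show "norm (?t p) \<le> c * measure lborel (snd p)" using p K(1,2) by (simp add: G_def)
      qed
      also have "\<dots> \<le> (\<Sum>p\<in>D. c * measure lborel (snd p))"
        using c finD DD by (intro sum_mono2) auto
      also have "\<dots> = c * (b - a)"
        using additive_content_tagged_division[OF D] ab by (simp add: case_prod_unfold flip: sum_distrib_left)
      also have "\<dots> < e / 2"
        unfolding c_def using e ab by (simp add: field_simps)
      finally have part1: "norm (\<Sum>p\<in>D1. ?t p) < e / 2" .
      obtain h m where h: "bij_betw h {..<m::nat} D2"
        using ex_bij_betw_nat_finite[OF DD(4)] by (auto simp: atLeast0LessThan)
      define u where "u i = Inf (snd (h i))" for i
      define v where "v i = Sup (snd (h i))" for i
      have hi: "fst (h i) \<in> N \<and> h i \<in> D \<and> snd (h i) = {u i..v i} \<and> u i \<le> v i \<and> {u i..v i} \<subseteq> {a..b} \<and> {u i..v i} \<subseteq> T"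
        if "i < m" for i
      proof -
        have "h i \<in> D2" using h that by (auto simp: bij_betw_def)
        then have hD: "h i \<in> D" "fst (h i) \<in> N" unfolding D2_def by auto
        then obtain u' v' where K: "snd (h i) = {u'..v'}" "u' \<le> v'" "{u'..v'} \<subseteq> {a..b}" "{u'..v'} \<subseteq> ball (fst (h i)) (d (fst (h i)))"
          using tag[of "fst (h i)" "snd (h i)"] by auto
        have "u i = u'" "v i = v'" unfolding u_def v_def K(1) using K(2) by auto
        then show ?thesis using hD K d2[OF hD(2)] by auto
      qed
      have disj: "disjoint_family_on (\<lambda>i. {u i<..<v i}) {..<m}"
        unfolding disjoint_family_on_def
      proof (intro ballI impI)
        fix i j assume ij: "i \<in> {..<m}" "j \<in> {..<m}" "i \<noteq> j"
        then have "h i \<noteq> h j" using h by (auto simp: bij_betw_def inj_on_def)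
        then have "interior (snd (h i)) \<inter> interior (snd (h j)) = {}"
          using tagged_division_ofD(5)[OF D, of "fst (h i)" "snd (h i)" "fst (h j)" "snd (h j)"] hi ij by auto
        then show "{u i<..<v i} \<inter> {u j<..<v j} = {}" using hi ij by simp
      qed
      have small: "(\<Sum>i<m. v i - u i) < \<delta>"
      proof -
        have "ennreal (\<Sum>i<m. v i - u i) = (\<Sum>i<m. ennreal (v i - u i))"
          using hi by (intro sum_ennreal[symmetric]) auto
        also have "\<dots> = (\<Sum>i<m. emeasure lebesgue {u i<..<v i})"
          using hi by (intro sum.cong refl) auto
        also have "\<dots> = emeasure lebesgue (\<Union>i<m. {u i<..<v i})"
          by (rule sum_emeasure) (use disj in auto)
        also have "\<dots> \<le> emeasure lebesgue T"
          using hi T(1) by (intro emeasure_mono) (fastforce, auto)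
        finally have "ennreal (\<Sum>i<m. v i - u i) < ennreal \<delta>" using Tm by simp
        moreover have "0 \<le> (\<Sum>i<m. v i - u i)" using hi by (intro sum_nonneg) auto
        ultimately show ?thesis by (simp only: ennreal_less_iff)
      qed
      have "norm (\<Sum>p\<in>D2. ?t p) \<le> (\<Sum>p\<in>D2. dist (F (Inf (snd p))) (F (Sup (snd p))))"
        by (rule sum_norm_le) (auto simp: D2_def G_def dist_norm)
      also have "\<dots> = (\<Sum>i<m. dist (F (u i)) (F (v i)))"
        unfolding u_def v_def by (rule sum.reindex_bij_betw[OF h, symmetric])
      also have "\<dots> < e / 2" using hi by (intro \<delta> disj small) auto
      finally have part2: "norm (\<Sum>p\<in>D2. ?t p) < e / 2" .
      show ?thesis unfolding split
        using norm_triangle_ineq[of "\<Sum>p\<in>D1. ?t p" "\<Sum>p\<in>D2. ?t p"] part1 part2 by linarith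
    qed
    then show "\<exists>\<gamma>. gauge \<gamma> \<and> (\<forall>D. D tagged_division_of cbox a b \<and> \<gamma> fine D \<longrightarrow>
        norm ((\<Sum>(x, K)\<in>D. measure lborel K *\<^sub>R G x) - (F b - F a)) < e)"
      using d0 by (intro exI[of _ "\<lambda>x. ball x (d x)"]) (auto intro: gauge_ball_dependent)
  qed
  then have "(G has_integral (F b - F a)) {a..b}" by simp
  then show ?thesis
    by (rule has_integral_spike[OF N, rotated]) (simp add: G_def)
qed

text \<open>
  Almost everywhere the averages over \<open>{x..x + h}\<close> tend to the value at \<open>x\<close>. Applied to the function and to its
  reflection, this gives both one-sided derivatives of the indefinite integral.
\<close>

theorem Lebesgue_differentiation:
  fixes e C :: "real \<Rightarrow> complex"
  assumes C: "\<And>a b. a \<le> b \<Longrightarrow> (e has_integral (C b - C a)) {a..b}"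
  shows "\<exists>N. negligible N \<and> (\<forall>x. x \<notin> N \<longrightarrow> (C has_vector_derivative e x) (at x))"
proof -
  have right: "\<exists>N. negligible N \<and> (\<forall>x d. x \<notin> N \<longrightarrow> 0 < d \<longrightarrow> (\<exists>r>0. \<forall>h. 0 < h \<and> h < r \<longrightarrow> cmod ((C (x + h) - C x) /\<^sub>R h - e x) < d))"
    if C: "\<And>a b. a \<le> b \<Longrightarrow> (e has_integral (C b - C a)) {a..b}" for e C :: "real \<Rightarrow> complex"
  proof -
    have i: "e integrable_on cbox a b" for a b
      by (cases "a \<le> b") (use C in \<open>auto simp: integrable_on_def\<close>)
    obtain N where "negligible N" and N: "\<And>x d. x \<notin> N \<Longrightarrow> 0 < d \<Longrightarrow>
        \<exists>r>0. \<forall>h. 0 < h \<and> h < r \<longrightarrow> norm (integral (cbox x (x + h *\<^sub>R One)) e /\<^sub>R h ^ DIM(real) - e x) < d"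
      using integrable_ccontinuous_explicit[of e, OF i] by metis
    have "integral {x..x + h} e = C (x + h) - C x" if "0 < h" for x h
      using C[of x "x + h"] that by (intro integral_unique) simp
    then show ?thesis using N \<open>negligible N\<close> by (intro exI[of _ N]) fastforce
  qed
  obtain N1 where N1: "negligible N1" and r1: "\<And>x d. x \<notin> N1 \<Longrightarrow> 0 < d \<Longrightarrow>
      \<exists>r>0. \<forall>h. 0 < h \<and> h < r \<longrightarrow> cmod ((C (x + h) - C x) /\<^sub>R h - e x) < d"
    using right[OF C] by blast
  have refl: "((\<lambda>t. e (- t)) has_integral (- C (- b) - - C (- a))) {a..b}" if "a \<le> b" for a b
  proof -
    have "((\<lambda>t. e (- t)) has_integral (C (- a) - C (- b))) {- (- a)..- (- b)}"
      unfolding has_integral_reflect_real using C[of "- b" "- a"] that by simp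
    then show ?thesis by simp
  qed
  obtain N2 where N2: "negligible N2" and r2: "\<And>x d. x \<notin> N2 \<Longrightarrow> 0 < d \<Longrightarrow>
      \<exists>r>0. \<forall>h. 0 < h \<and> h < r \<longrightarrow> cmod ((- C (- (x + h)) - - C (- x)) /\<^sub>R h - e (- x)) < d"
    using right[OF refl] by blast
  have "negligible (uminus ` N2)" using N2 by (intro negligible_differentiable_image_negligible) (auto intro: differentiable_on_minus differentiable_on_ident)
  then have neg: "negligible (N1 \<union> uminus ` N2)" using N1 by simp
  have "(C has_vector_derivative e x) (at x)" if x: "x \<notin> N1 \<union> uminus ` N2" for x
    unfolding has_vector_derivative_def has_derivative_within_alt
  proof (intro conjI allI impI bounded_linear_scaleR_left)
    fix d :: real assume "0 < d"
    have "- x \<notin> N2" using x by force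
    obtain s where "0 < s" and s: "\<And>h. 0 < h \<Longrightarrow> h < s \<Longrightarrow> cmod ((C (x + h) - C x) /\<^sub>R h - e x) < d"
      using r1[of x d] x \<open>0 < d\<close> by auto
    obtain r where "0 < r" and r: "\<And>h. 0 < h \<Longrightarrow> h < r \<Longrightarrow> cmod ((- C (- (- x + h)) - - C (- (- x))) /\<^sub>R h - e (- (- x))) < d"
      using r2[OF \<open>- x \<notin> N2\<close> \<open>0 < d\<close>] by auto
    have "cmod (C y - C x - (y - x) *\<^sub>R e x) \<le> d * norm (y - x)" if y: "norm (y - x) < min r s" for y
    proof -
      consider "y = x" | "x < y" | "y < x" by linarith
      then show ?thesis
      proof cases
        case 2
        define h where "h = y - x"
        have h: "0 < h" "h < s" "y = x + h" using 2 y by (auto simp: h_def)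
        have "C y - C x - (y - x) *\<^sub>R e x = h *\<^sub>R ((C (x + h) - C x) /\<^sub>R h - e x)"
          using h by (simp add: scaleR_right_diff_distrib)
        then have "cmod (C y - C x - (y - x) *\<^sub>R e x) = h * cmod ((C (x + h) - C x) /\<^sub>R h - e x)"
          using h by simp
        also have "\<dots> \<le> h * d" using s[OF h(1,2)] h by (intro mult_left_mono) auto
        finally show ?thesis using h by (simp add: mult.commute)
      next
        case 3
        define h where "h = x - y"
        have h: "0 < h" "h < r" "y = x - h" using 3 y by (auto simp: h_def)
        have "C y - C x - (y - x) *\<^sub>R e x = (- h) *\<^sub>R ((- C (- (- x + h)) - - C (- (- x))) /\<^sub>R h - e (- (- x)))"
          using h by (simp add: scaleR_right_diff_distrib)
        then have "cmod (C y - C x - (y - x) *\<^sub>R e x) = h * cmod ((- C (- (- x + h)) - - C (- (- x))) /\<^sub>R h - e (- (- x)))"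
          using h(1) by simp
        also have "\<dots> \<le> h * d" using r[OF h(1,2)] h(1) by (intro mult_left_mono less_imp_le) auto
        finally show ?thesis using h by (simp add: mult.commute)
      qed simp
    qed
    then show "\<exists>da>0. \<forall>y\<in>UNIV. norm (y - x) < da \<longrightarrow> cmod (C y - C x - (y - x) *\<^sub>R e x) \<le> d * norm (y - x)"
      using \<open>0 < r\<close> \<open>0 < s\<close> by (intro exI[of _ "min r s"]) auto
  qed
  then show ?thesis using neg by blast
qed

section \<open>The operator \<open>P\<^sub>0\<close> in the Fourier picture\<close>

lemma cmod_exp_diff_le:
  "cmod (wave (x * b) - wave (x * a)) \<le> \<bar>x\<bar> * \<bar>b - a\<bar>"
proof -
  have "- \<i> * complex_of_real (x * b) = - \<i> * complex_of_real (x * a) + \<i> * complex_of_real (- x * (b - a))"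
    by (simp add: algebra_simps)
  then have "wave (x * b) = wave (x * a) * exp (\<i> * complex_of_real (- x * (b - a)))"
    by (simp only: exp_add)
  then have "wave (x * b) - wave (x * a)
      = wave (x * a) * (exp (\<i> * complex_of_real (- x * (b - a))) - 1)"
    by (simp only: right_diff_distrib mult_1_right)
  then have "cmod (wave (x * b) - wave (x * a))
      = cmod (exp (\<i> * complex_of_real (- x * (b - a))) - 1)"
    by (simp only: norm_mult norm_exp_ii mult_1_left)
  also have "\<dots> \<le> \<bar>- x * (b - a)\<bar>" using iexp_approx1[of "- x * (b - a)" 0] by simp
  finally show ?thesis by (simp add: abs_mult)
qed

text \<open>
  The character is Lipschitz and bounded, and \<open>f\<close> is bounded because it is continuous on a compact interval.
\<close>

lemma abs_continuous_on_mult_character: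
  fixes f :: "real \<Rightarrow> complex"
  assumes f: "abs_continuous_on {a..b} f"
  shows "abs_continuous_on {a..b} (\<lambda>t. wave (x * t) * f t)"
  unfolding abs_continuous_on_def
proof (intro allI impI)
  let ?F = "\<lambda>t. wave (x * t) * f t"
  fix e :: real assume e: "0 < e"
  have "bounded (f ` {a..b})"
    by (intro compact_imp_bounded compact_continuous_image abs_continuous_on_imp_continuous_on f) simp
  then obtain M where "0 < M" and M: "\<And>t. t \<in> {a..b} \<Longrightarrow> cmod (f t) \<le> M" by (auto simp: bounded_pos)
  define L where "L = M * \<bar>x\<bar> + 1"
  have L: "0 < L" unfolding L_def using \<open>0 < M\<close> by (intro add_nonneg_pos mult_nonneg_nonneg) auto
  have "0 < e / 2" using e by simp
  then obtain d where "0 < d" and d: "\<And>(m::nat) u v. (\<forall>i<m. u i \<le> v i \<and> {u i..v i} \<subseteq> {a..b}) \<Longrightarrow>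
      disjoint_family_on (\<lambda>i. {u i<..<v i}) {..<m} \<Longrightarrow> (\<Sum>i<m. v i - u i) < d \<Longrightarrow>
      (\<Sum>i<m. dist (f (u i)) (f (v i))) < e / 2"
    using f unfolding abs_continuous_on_def by meson
  have lip: "dist (?F u) (?F v) \<le> dist (f u) (f v) + L * (v - u)" if "u \<le> v" "{u..v} \<subseteq> {a..b}" for u v
  proof -
    let ?E = "\<lambda>t. wave (x * t)"
    have "v \<in> {a..b}" using that by auto
    have "?F v - ?F u = ?E u * (f v - f u) + (?E v - ?E u) * f v" by (simp add: algebra_simps)
    then have "cmod (?F v - ?F u) \<le> cmod (?E u * (f v - f u)) + cmod ((?E v - ?E u) * f v)"
      by (metis norm_triangle_ineq)
    also have "\<dots> \<le> cmod (f v - f u) + (\<bar>x\<bar> * \<bar>v - u\<bar>) * M"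
      unfolding norm_mult norm_exp_ii
      by (intro add_mono mult_mono cmod_exp_diff_le M \<open>v \<in> {a..b}\<close>) auto
    also have "\<dots> \<le> cmod (f v - f u) + L * (v - u)"
      using that(1) by (simp add: L_def algebra_simps)
    finally show ?thesis by (simp add: dist_norm norm_minus_commute)
  qed
  show "\<exists>d>0. \<forall>(m::nat) u v. (\<forall>i<m. u i \<le> v i \<and> {u i..v i} \<subseteq> {a..b}) \<longrightarrow>
      disjoint_family_on (\<lambda>i. {u i<..<v i}) {..<m} \<longrightarrow> (\<Sum>i<m. v i - u i) < d \<longrightarrow>
      (\<Sum>i<m. dist (?F (u i)) (?F (v i))) < e"
  proof (intro exI[of _ "min d (e / (2 * L))"] conjI allI impI)
    show "0 < min d (e / (2 * L))" using \<open>0 < d\<close> e L by simp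
    fix m :: nat and u v
    assume uv: "\<forall>i<m. u i \<le> v i \<and> {u i..v i} \<subseteq> {a..b}" and dis: "disjoint_family_on (\<lambda>i. {u i<..<v i}) {..<m}"
      and len: "(\<Sum>i<m. v i - u i) < min d (e / (2 * L))"
    have "(\<Sum>i<m. dist (?F (u i)) (?F (v i))) \<le> (\<Sum>i<m. dist (f (u i)) (f (v i)) + L * (v i - u i))"
      using uv by (intro sum_mono lip) auto
    also have "\<dots> = (\<Sum>i<m. dist (f (u i)) (f (v i))) + L * (\<Sum>i<m. v i - u i)"
      by (simp add: sum.distrib sum_distrib_left)
    also have "\<dots> < e / 2 + L * (e / (2 * L))"
      using d[OF uv dis] len L by (intro add_strict_mono mult_strict_left_mono) auto
    also have "\<dots> = e" using L by simp
    finally show "(\<Sum>i<m. dist (?F (u i)) (?F (v i))) < e" .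
  qed
qed

text \<open>Integration by parts: the boundary terms vanish, so differentiation becomes multiplication by \<open>\<i> x\<close>.\<close>

lemma fourier_dirichlet_derivative:
  assumes l: "0 < l" and g: "has_dirichlet_derivative l \<phi> g"
  shows "fourier (zero_ext l g) x = \<i> * complex_of_real x * hat l \<phi> x"
proof -
  let ?I = "seg l"
  let ?E = "\<lambda>t. wave (x * t)"
  obtain f where \<phi>: "\<phi> \<in> L2 ?I" and gs: "g \<in> sq_integrable ?I" and f: "f \<in> \<phi>" "abs_continuous_on {0..l} f" "f 0 = 0" "f l = 0"
    and der: "AE t in ?I. (f has_vector_derivative g t) (at t within {0..l})"
    using g unfolding has_dirichlet_derivative_def by auto
  have fs: "f \<in> sq_integrable ?I" by (rule in_L2_sq_integrable[OF \<phi> f(1)])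
  have hat_f: "hat l \<phi> = fourier (zero_ext l f)"
    using hat_cls[OF fs] cls_eq_of_mem[OF \<phi> f(1)] by simp
  obtain N where N: "negligible N" "\<And>t. t \<in> {0..l} - N \<Longrightarrow> (f has_vector_derivative g t) (at t within {0..l})"
  proof -
    have "AE t in lborel. t \<in> {0..l} \<longrightarrow> (f has_vector_derivative g t) (at t within {0..l})"
      using der unfolding interval_AE_iff .
    then obtain N where "{t \<in> space lborel. \<not> (t \<in> {0..l} \<longrightarrow> (f has_vector_derivative g t) (at t within {0..l}))} \<subseteq> N"
        "emeasure lborel N = 0" "N \<in> sets lborel"
      by (rule AE_E)
    then show ?thesis
      by (intro that[of N]) (auto simp: negligible_iff_null_sets null_sets_completionI null_sets_def)
  qed
  define F' where "F' t = ?E t * g t - \<i> * complex_of_real x * (?E t * f t)" for t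
  have "(F' has_integral (?E l * f l - ?E 0 * f 0)) {0..l}"
  proof (rule abs_continuous_on_FTC[OF _ abs_continuous_on_mult_character[OF f(2)] N(1)])
    show "0 \<le> l" using l by simp
    fix t assume t: "t \<in> {0..l} - N"
    have "(?E has_vector_derivative (- \<i> * complex_of_real x * ?E t)) (at t within {0..l})"
    proof -
      have "((\<lambda>z. exp (- \<i> * complex_of_real x * z)) has_field_derivative (- \<i> * complex_of_real x * exp (- \<i> * complex_of_real x * complex_of_real t))) (at (complex_of_real t))"
        by (auto intro!: derivative_eq_intros)
      from has_vector_derivative_real_field[OF this, of "{0..l}"] show ?thesis by (simp add: mult.assoc)
    qed
    from has_vector_derivative_mult[OF this N(2)[OF t]]
    show "((\<lambda>t. ?E t * f t) has_vector_derivative F' t) (at t within {0..l})"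
      by (simp add: F'_def algebra_simps)
  qed
  then have z: "(F' has_integral 0) {0..l}" using f(3,4) by simp
  have ig: "integrable lborel (\<lambda>t. ?E t * zero_ext l g t)" "integrable lborel (\<lambda>t. ?E t * zero_ext l f t)"
    by (intro integrable_character_mult zero_ext_integrable gs fs)+
  have ie: "integrable lborel (\<lambda>t. ?E t * zero_ext l g t - \<i> * complex_of_real x * (?E t * zero_ext l f t))"
    by (intro Bochner_Integration.integrable_diff integrable_mult_right impI ig)
  have "(\<lambda>t. ?E t * zero_ext l g t - \<i> * complex_of_real x * (?E t * zero_ext l f t)) = (\<lambda>t. if t \<in> {0..l} then F' t else 0)"
    by (auto simp: F'_def zero_ext_def indicator_def)
  with has_integral_integral_lborel[OF ie]
  have "(F' has_integral (LINT t|lborel. ?E t * zero_ext l g t - \<i> * complex_of_real x * (?E t * zero_ext l f t))) {0..l}"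
    by (simp only: has_integral_restrict_UNIV)
  from has_integral_unique[OF this z]
  have "(LINT t|lborel. ?E t * zero_ext l g t) - \<i> * complex_of_real x * (LINT t|lborel. ?E t * zero_ext l f t) = 0"
    unfolding Bochner_Integration.integral_diff[OF ig(1) integrable_mult_right[OF ig(2)]] integral_mult_right_zero .
  then have "(LINT t|lborel. ?E t * zero_ext l g t) = \<i> * complex_of_real x * (LINT t|lborel. ?E t * zero_ext l f t)" by simp
  then show ?thesis unfolding hat_f unfolding fourier_def by (simp only: mult.left_commute mult.assoc)
qed

text \<open>
  The derivative chosen in the definition of \<open>P\<^sub>0\<close> may differ from the given one, but the Fourier transform of either is
  determined by \<open>\<phi>\<close>.
\<close>

lemma P0_Some:
  assumes l: "0 < l" and g: "has_dirichlet_derivative l \<phi> g"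
  obtains \<eta> where "P0 l \<phi> = Some \<eta>" "\<eta> \<in> L2 (seg l)"
    "\<And>x. hat l \<eta> x = complex_of_real x * hat l \<phi> x"
proof -
  define g' where "g' = (SOME g. has_dirichlet_derivative l \<phi> g)"
  have g': "has_dirichlet_derivative l \<phi> g'" unfolding g'_def by (rule someI[of "has_dirichlet_derivative l \<phi>", OF g])
  have gs: "(\<lambda>x. - \<i> * g' x) \<in> sq_integrable (seg l)"
    using g' unfolding has_dirichlet_derivative_def by (intro sq_integrable_cmult) auto
  show thesis
  proof
    show "P0 l \<phi> = Some (cls (seg l) (\<lambda>x. - \<i> * g' x))"
      unfolding P0_def g'_def using g by auto
    show "cls (seg l) (\<lambda>x. - \<i> * g' x) \<in> L2 (seg l)" by (rule cls_in_L2[OF gs])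
    fix x
    have "zero_ext l (\<lambda>x. - \<i> * g' x) = (\<lambda>t. - \<i> * zero_ext l g' t)" by (auto simp: zero_ext_def)
    then have "hat l (cls (seg l) (\<lambda>x. - \<i> * g' x)) x = - \<i> * fourier (zero_ext l g') x"
      unfolding hat_cls[OF gs] by (simp only: fourier_cmult)
    also have "\<dots> = complex_of_real x * hat l \<phi> x"
      unfolding fourier_dirichlet_derivative[OF l g'] by (simp add: mult.assoc[symmetric])
    finally show "hat l (cls (seg l) (\<lambda>x. - \<i> * g' x)) x = complex_of_real x * hat l \<phi> x" .
  qed
qed

lemma P0_dom_imp:
  assumes l: "0 < l" and "P0 l \<phi> = Some \<eta>"
  shows "\<phi> \<in> L2 (seg l)" "\<eta> \<in> L2 (seg l)"
    "hat l \<eta> x = complex_of_real x * hat l \<phi> x"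
proof -
  obtain g where g: "has_dirichlet_derivative l \<phi> g" using assms(2) unfolding P0_def by (auto split: if_splits)
  then show "\<phi> \<in> L2 (seg l)" unfolding has_dirichlet_derivative_def by simp
  obtain \<eta>' where "P0 l \<phi> = Some \<eta>'" "\<eta>' \<in> L2 (seg l)"
    "\<And>x. hat l \<eta>' x = complex_of_real x * hat l \<phi> x" by (rule P0_Some[OF l g]) blast
  then show "\<eta> \<in> L2 (seg l)" "hat l \<eta> x = complex_of_real x * hat l \<phi> x"
    using assms(2) by auto
qed

text \<open>
  With \<open>s = sqrt (1 + x\<^sup>2)\<close>, the product of \<open>inverse s\<close> and \<open>s * \<bar>f x\<bar>\<close> is at most the sum of their squares, and both
  squares are integrable.
\<close>

lemma integrable_of_first_moment:
  assumes f: "f \<in> sq_integrable lborel" and xf: "(\<lambda>x. complex_of_real x * f x) \<in> sq_integrable lborel"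
  shows "integrable lborel f"
proof -
  have [measurable]: "f \<in> borel_measurable borel" using sq_integrable_measurable[OF f] by simp
  have i1: "integrable lborel (\<lambda>x::real. inverse (1 + x\<^sup>2))"
    using integrable_inverse_1_plus_square by (simp add: set_integrable_def)
  have i2: "integrable lborel (\<lambda>x. (cmod (f x))\<^sup>2 + (cmod (complex_of_real x * f x))\<^sup>2)"
    using f xf by (simp add: sq_integrable_integrable)
  show ?thesis
  proof (rule Bochner_Integration.integrable_bound[OF Bochner_Integration.integrable_add[OF i1 i2]])
    show "AE x in lborel. norm (f x) \<le> norm (inverse (1 + x\<^sup>2) + ((cmod (f x))\<^sup>2 + (cmod (complex_of_real x * f x))\<^sup>2))"
    proof (intro AE_I2)
      fix x :: real
      have p: "0 < 1 + x\<^sup>2" by (simp add: add_pos_nonneg)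
      define s where "s = sqrt (1 + x\<^sup>2)"
      have s: "0 < s" "s\<^sup>2 = 1 + x\<^sup>2" unfolding s_def using p by auto
      have "cmod (f x) = inverse s * (s * cmod (f x))" using s by simp
      also have "\<dots> \<le> (inverse s)\<^sup>2 + (s * cmod (f x))\<^sup>2"
      proof -
        have "0 \<le> inverse s * (s * cmod (f x))" using s by simp
        then show ?thesis using sum_squares_bound[of "inverse s" "s * cmod (f x)"] by linarith
      qed
      also have "\<dots> = inverse (1 + x\<^sup>2) + ((cmod (f x))\<^sup>2 + (cmod (complex_of_real x * f x))\<^sup>2)"
        by (simp add: power_mult_distrib power_inverse s norm_mult algebra_simps)
      finally show "norm (f x) \<le> norm (inverse (1 + x\<^sup>2) + ((cmod (f x))\<^sup>2 + (cmod (complex_of_real x * f x))\<^sup>2))"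
        by (rule order_trans) simp
    qed
  qed measurable
qed

text \<open>
  The factor \<open>x\<close> removes the denominator of the transform of an indicator. This is how increments of a function arise
  from pairing \<open>x\<close> times its transform with the transform of an indicator.
\<close>

lemma fourier_indicator:
  assumes "a \<le> b"
  shows "complex_of_real x * fourier (indicator {a..b}) x
       = complex_of_real (1 / sqrt (2 * pi)) * (\<i> * (wave (x * b) - wave (x * a)))"
proof -
  let ?E = "\<lambda>t. wave (x * t)"
  have der: "((\<lambda>t. \<i> * ?E t) has_vector_derivative (complex_of_real x * ?E t)) (at t within S)" for t S
  proof -
    have "((\<lambda>z. \<i> * exp (- \<i> * complex_of_real x * z)) has_field_derivative (complex_of_real x * exp (- \<i> * complex_of_real x * complex_of_real t))) (at (complex_of_real t))"
      by (auto intro!: derivative_eq_intros simp: mult_ac)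
    from has_vector_derivative_real_field[OF this, of S] show ?thesis by (simp add: mult.assoc)
  qed
  have "(LINT t|lborel. indicator {a..b} t *\<^sub>R (complex_of_real x * ?E t)) = \<i> * ?E b - \<i> * ?E a"
    by (rule integral_FTC_atLeastAtMost[OF assms der]) (intro continuous_intros)
  moreover have "(LINT t|lborel. indicator {a..b} t *\<^sub>R (complex_of_real x * ?E t)) = complex_of_real x * (LINT t|lborel. ?E t * indicator {a..b} t)"
    unfolding integral_mult_right_zero[symmetric]
    by (intro Bochner_Integration.integral_cong refl) (auto simp: indicator_def)
  ultimately have J: "complex_of_real x * (LINT t|lborel. ?E t * indicator {a..b} t) = \<i> * (?E b - ?E a)"
    by (simp only: right_diff_distrib)
  have "complex_of_real x * fourier (indicator {a..b}) x
      = complex_of_real (1 / sqrt (2 * pi)) * (complex_of_real x * (LINT t|lborel. ?E t * indicator {a..b} t))"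
    unfolding fourier_def by (rule mult.left_commute)
  then show ?thesis unfolding J .
qed

lemma indicator_sq_integrable:
  "(indicator {a..b} :: real \<Rightarrow> complex) \<in> sq_integrable lborel" "integrable lborel (indicator {a..b} :: real \<Rightarrow> complex)"
proof -
  show i: "integrable lborel (indicator {a..b} :: real \<Rightarrow> complex)"
    by (rule integrable_complex_indicator) (auto simp: emeasure_lborel_Icc_eq)
  show "(indicator {a..b} :: real \<Rightarrow> complex) \<in> sq_integrable lborel"
    by (rule sq_integrable_of_bounded[OF i, of 1]) (simp add: indicator_def)
qed

lemma interval_integral_has_integral:
  fixes f :: "real \<Rightarrow> complex"
  assumes "integrable lborel (\<lambda>t. indicator {a..b} t * f t)"
  shows "(f has_integral (LINT t|lborel. indicator {a..b} t * f t)) {a..b}"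
proof -
  have "(\<lambda>t. indicator {a..b} t * f t) = (\<lambda>t. if t \<in> {a..b} then f t else 0)" by (auto simp: indicator_def)
  with has_integral_integral_lborel[OF assms] show ?thesis by (simp only: has_integral_restrict_UNIV)
qed

lemma integral_reflect_lborel:
  fixes f :: "real \<Rightarrow> complex" shows "(LINT x|lborel. f (- x)) = (LINT x|lborel. f x)"
  using lborel_integral_real_affine[of "-1" f 0] by simp

lemma integrable_reflect_lborel:
  fixes f :: "real \<Rightarrow> complex" shows "integrable lborel f \<Longrightarrow> integrable lborel (\<lambda>x. f (- x))"
  using lborel_integrable_real_affine[of f "-1" 0] by simp

lemma fourier_reflect: "fourier (\<lambda>x. f (- x)) t = fourier f (- t)"
proof -
  have "(LINT x|lborel. wave (t * x) * f (- x)) = (LINT x|lborel. wave (- t * x) * f x)"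
    using integral_reflect_lborel[of "\<lambda>x. wave (- t * x) * f x"] by simp
  then show ?thesis by (simp only: fourier_def)
qed

lemma l2ip_indicator: "l2ip lborel (indicator {a..b}) f = (LINT t|lborel. indicator {a..b} t * f t)"
  unfolding l2ip_def by (intro Bochner_Integration.integral_cong) (auto simp: indicator_def)

lemma cnj_fourier_indicator: "cnj (fourier (indicator {a..b}) x) = fourier (indicator {a..b}) (- x)"
proof -
  have "(\<lambda>t. cnj (indicator {a..b} t)) = (indicator {a..b} :: real \<Rightarrow> complex)" by (auto simp: indicator_def)
  then show ?thesis using fourier_cnj[of "indicator {a..b}" "- x"] by simp
qed

text \<open>
  Fourier inversion, tested against the indicator \<open>u\<close> of an interval: Plancherel's identity for \<open>u\<close> and \<open>f\<close>, then
  the multiplication formula for \<open>u\<close> and the reflected transform of \<open>f\<close>.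
\<close>

lemma interval_integral_inversion:
  assumes f: "integrable lborel f" "f \<in> sq_integrable lborel" and Ff: "integrable lborel (fourier f)"
  shows "(LINT t|lborel. indicator {a..b} t * f t) = (LINT t|lborel. indicator {a..b} t * fourier (fourier f) (- t))"
proof -
  let ?u = "indicator {a..b} :: real \<Rightarrow> complex"
  have "(LINT t|lborel. ?u t * f t) = l2ip lborel (fourier ?u) (fourier f)"
    unfolding l2ip_indicator[symmetric] by (rule Plancherel_identity[symmetric]) (rule indicator_sq_integrable f)+
  also have "\<dots> = (LINT x|lborel. fourier ?u (- x) * fourier f (- (- x)))"
    unfolding l2ip_def cnj_fourier_indicator by simp
  also have "\<dots> = (LINT x|lborel. fourier ?u x * fourier f (- x))"
    by (rule integral_reflect_lborel)
  also have "\<dots> = (LINT t|lborel. ?u t * fourier (\<lambda>x. fourier f (- x)) t)"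
    by (rule fourier_multiplication_formula[OF indicator_sq_integrable(2) integrable_reflect_lborel[OF Ff]])
  finally show ?thesis unfolding fourier_reflect .
qed

text \<open>
  In terms of \<open>c s = fourier h (- s)\<close>, the inverse transform of \<open>h\<close>, this says that \<open>c\<close> is an
  indefinite integral of \<open>\<i> * e\<close>.
\<close>

lemma interval_integral_of_moment:
  assumes h: "integrable lborel h" and e: "e \<in> sq_integrable lborel"
    and Fe: "fourier_plancherel (cls lborel e) = cls lborel (\<lambda>x. complex_of_real x * h x)"
    and xh: "(\<lambda>x. complex_of_real x * h x) \<in> sq_integrable lborel" and ab: "a \<le> b"
  shows "(LINT t|lborel. indicator {a..b} t * e t) = - \<i> * (fourier h (- b) - fourier h (- a))"
proof -
  let ?u = "indicator {a..b} :: real \<Rightarrow> complex"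
  let ?K = "complex_of_real (1 / sqrt (2 * pi))"
  let ?E = "\<lambda>s x. wave (s * x)"
  note u = indicator_sq_integrable[of a b]
  have i: "integrable lborel (\<lambda>x. ?E s x * h x)" for s by (rule integrable_character_mult[OF h])
  have "(LINT t|lborel. ?u t * e t) = inner_L2 lborel (cls lborel ?u) (cls lborel e)"
    unfolding inner_L2_cls[OF u(1) e] l2ip_indicator ..
  also have "\<dots> = inner_L2 lborel (fourier_plancherel (cls lborel ?u)) (fourier_plancherel (cls lborel e))"
    using Plancherel(1) cls_in_L2[OF u(1)] cls_in_L2[OF e] unfolding unitary_L2_def by metis
  also have "\<dots> = l2ip lborel (fourier ?u) (\<lambda>x. complex_of_real x * h x)"
    unfolding Plancherel(2)[OF u] Fe by (rule inner_L2_cls[OF fourier_isometry(1)[OF u(2,1)] xh])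
  also have "\<dots> = (LINT x|lborel. - \<i> * (?K * (?E (- b) x * h x) - ?K * (?E (- a) x * h x)))"
    unfolding l2ip_def
  proof (intro Bochner_Integration.integral_cong refl)
    fix x
    have cE: "cnj (wave (x * s)) = ?E (- s) x" for s
      by (simp add: exp_cnj mult.commute)
    have "cnj (fourier ?u x) * (complex_of_real x * h x) = cnj (complex_of_real x * fourier ?u x) * h x" by simp
    also have "\<dots> = cnj (?K * (\<i> * (wave (x * b) - wave (x * a)))) * h x"
      by (simp only: fourier_indicator[OF ab])
    also have "\<dots> = ?K * (- \<i> * (?E (- b) x - ?E (- a) x)) * h x"
      by (simp only: complex_cnj_mult complex_cnj_diff cE complex_cnj_complex_of_real complex_cnj_i)
    also have "\<dots> = - \<i> * (?K * (?E (- b) x * h x) - ?K * (?E (- a) x * h x))"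
      by (simp only: right_diff_distrib left_diff_distrib mult_ac)
    finally show "cnj (fourier ?u x) * (complex_of_real x * h x) = - \<i> * (?K * (?E (- b) x * h x) - ?K * (?E (- a) x * h x))" .
  qed
  also have "\<dots> = - \<i> * (fourier h (- b) - fourier h (- a))"
    unfolding fourier_def integral_mult_right_zero
    using i[of "- b"] i[of "- a"] by (subst Bochner_Integration.integral_diff) (auto simp only: integral_mult_right_zero intro!: integrable_mult_right)
  finally show ?thesis .
qed

text \<open>The derivative of the zero function is zero, so Lebesgue differentiation identifies \<open>f - g\<close> with zero.\<close>

lemma AE_eq_of_interval_integrals:
  fixes f g :: "real \<Rightarrow> complex"
  assumes i: "\<And>a b. integrable lborel (\<lambda>t. indicator {a..b} t * f t)" "\<And>a b. integrable lborel (\<lambda>t. indicator {a..b} t * g t)"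
    and eq: "\<And>a b. (LINT t|lborel. indicator {a..b} t * f t) = (LINT t|lborel. indicator {a..b} t * g t)"
  shows "AE t in lborel. f t = g t"
proof -
  have "((\<lambda>t. f t - g t) has_integral 0 - 0) {a..b}" for a b
    using has_integral_diff[OF interval_integral_has_integral[OF i(1)] interval_integral_has_integral[OF i(2)], of a b] eq[of a b]
    by simp
  then obtain N where N: "negligible N" "\<And>t. t \<notin> N \<Longrightarrow> ((\<lambda>_. 0) has_vector_derivative f t - g t) (at t)"
    using Lebesgue_differentiation[of "\<lambda>t. f t - g t" "\<lambda>_. 0"] by auto
  have z: "f t = g t" if "t \<notin> N" for t
    using vector_derivative_unique_at[OF N(2)[OF that] has_vector_derivative_const] by simp
  have "N \<in> null_sets lebesgue" using N(1) by (simp add: negligible_iff_null_sets)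
  then have "AE t in lebesgue. t \<notin> N" by (rule AE_not_in)
  then have "AE t in lebesgue. f t = g t" by eventually_elim (rule z)
  then show ?thesis by (simp only: AE_completion_iff)
qed

text \<open>
  The points of \<open>U\<close> where \<open>c\<close> does not vanish form an open null set, which is empty.
\<close>

lemma continuous_AE_zero_imp_zero:
  fixes c :: "real \<Rightarrow> complex"
  assumes c: "continuous_on UNIV c" and ae: "AE x in lborel. x \<in> U \<longrightarrow> c x = 0" and U: "open U" and x: "x \<in> closure U"
  shows "c x = 0"
proof (rule continuous_constant_on_closure[OF continuous_on_subset[OF c] _ x])
  let ?V = "U \<inter> {x. c x \<noteq> 0}"
  have "open {x. c x \<noteq> 0}" by (rule open_Collect_neq[OF c continuous_on_const])
  then have V: "open ?V" using U by auto
  have "AE x in lebesgue. x \<notin> ?V"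
    unfolding AE_completion_iff using ae by eventually_elim auto
  then have "?V \<in> null_sets lebesgue"
    using V by (subst AE_iff_null_sets) auto
  then have "negligible ?V" by (simp add: negligible_iff_null_sets)
  then have "?V = {}" using open_not_negligible[OF V] by blast
  then show "c y = 0" if "y \<in> U" for y using that by auto
qed simp

text \<open>
  The integral of \<open>\<bar>e\<bar>\<close> over a small set is small, because
  \<open>\<bar>e\<bar> \<le> 1 / k + k \<bar>e\<bar>\<^sup>2\<close> for every \<open>k > 0\<close>, so small total length forces small total increments.
\<close>

lemma abs_continuous_on_of_sq_integrable:
  fixes c e :: "real \<Rightarrow> complex"
  assumes e: "e \<in> sq_integrable lborel"
    and c: "\<And>a b. a \<le> b \<Longrightarrow> cmod (c b - c a) \<le> cmod (LINT t|lborel. indicator {a..b} t * e t)"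
  shows "abs_continuous_on S c"
  unfolding abs_continuous_on_def
proof (intro allI impI)
  fix r :: real assume r: "0 < r"
  have [measurable]: "e \<in> borel_measurable borel" using sq_integrable_measurable[OF e] by simp
  define A where "A = (LINT t|lborel. (cmod (e t))\<^sup>2)"
  have A0: "0 \<le> A" unfolding A_def by simp
  \<comment> \<open>With this \<open>k\<close> the quadratic term contributes at most \<open>r / 2\<close>.\<close>
  define k where "k = r / (2 * (A + 1))"
  have k: "0 < k" unfolding k_def using r A0 by simp
  have i2: "integrable lborel (\<lambda>t. indicator {a<..<b} t * (cmod (e t))\<^sup>2)" for a b
    by (rule integrable_indicator_mult_real[OF sq_integrable_integrable[OF e]]) simp
  have i1: "integrable lborel (\<lambda>t. indicator {a<..<b} t :: real)" if "a \<le> b" for a b :: real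
    using that by simp
  have inc: "dist (c a) (c b) \<le> (b - a) / k + k * (LINT t|lborel. indicator {a<..<b} t * (cmod (e t))\<^sup>2)" if ab: "a \<le> b" for a b
  proof -
    have ia: "integrable lborel (\<lambda>t. indicator {a..b} t * e t)" by (rule integrable_sq_integrable_interval[OF e])
    have "dist (c a) (c b) \<le> cmod (LINT t|lborel. indicator {a..b} t * e t)"
      using c[OF ab] by (simp add: dist_norm norm_minus_commute)
    also have "\<dots> \<le> (LINT t|lborel. cmod (indicator {a..b} t * e t))" by (rule integral_norm_bound)
    also have "\<dots> \<le> (LINT t|lborel. indicator {a<..<b} t / k + k * (indicator {a<..<b} t * (cmod (e t))\<^sup>2))"
    proof (rule integral_mono_AE)
      show "integrable lborel (\<lambda>t. cmod (indicator {a..b} t * e t))" by (rule integrable_norm[OF ia])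
      show "integrable lborel (\<lambda>t. indicator {a<..<b} t / k + k * (indicator {a<..<b} t * (cmod (e t))\<^sup>2))"
        using i1[OF ab] i2 by (intro Bochner_Integration.integrable_add integrable_divide integrable_mult_right) auto
      show "AE t in lborel. cmod (indicator {a..b} t * e t) \<le> indicator {a<..<b} t / k + k * (indicator {a<..<b} t * (cmod (e t))\<^sup>2)"
        using AE_lborel_singleton[of a] AE_lborel_singleton[of b]
      proof eventually_elim
        case (elim t)
        have "cmod (e t) \<le> 1 / k + k * (cmod (e t))\<^sup>2"
        proof (cases "cmod (e t) \<le> 1 / k")
          case True
          moreover have "0 \<le> k * (cmod (e t))\<^sup>2" using k by simp
          ultimately show ?thesis by linarith
        next
          case False
          then have "1 \<le> k * cmod (e t)" using k by (simp add: field_simps)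
          then have "1 * cmod (e t) \<le> (k * cmod (e t)) * cmod (e t)" by (intro mult_right_mono) auto
          moreover have "0 \<le> 1 / k" using k by simp
          ultimately show ?thesis unfolding power2_eq_square mult.assoc[symmetric] mult_1_left by linarith
        qed
        then show ?case using elim by (auto simp: indicator_def)
      qed
    qed
    also have "\<dots> = (b - a) / k + k * (LINT t|lborel. indicator {a<..<b} t * (cmod (e t))\<^sup>2)"
      using i1[OF ab] i2 ab by simp
    finally show ?thesis .
  qed
  show "\<exists>d>0. \<forall>(m::nat) u v. (\<forall>i<m. u i \<le> v i \<and> {u i..v i} \<subseteq> S) \<longrightarrow>
      disjoint_family_on (\<lambda>i. {u i<..<v i}) {..<m} \<longrightarrow> (\<Sum>i<m. v i - u i) < d \<longrightarrow>
      (\<Sum>i<m. dist (c (u i)) (c (v i))) < r"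
  proof (intro exI[of _ "k * r / 2"] conjI allI impI)
    show "0 < k * r / 2" using k r by simp
    fix m :: nat and u v
    assume uv: "\<forall>i<m. u i \<le> v i \<and> {u i..v i} \<subseteq> S" and dis: "disjoint_family_on (\<lambda>i. {u i<..<v i}) {..<m}"
      and len: "(\<Sum>i<m. v i - u i) < k * r / 2"
    have "(\<Sum>i<m. LINT t|lborel. indicator {u i<..<v i} t * (cmod (e t))\<^sup>2)
        = (LINT t|lborel. (\<Sum>i<m. indicator {u i<..<v i} t * (cmod (e t))\<^sup>2))"
      by (rule Bochner_Integration.integral_sum[symmetric]) (rule i2)
    also have "\<dots> \<le> A"
      unfolding A_def
    proof (rule integral_mono)
      show "integrable lborel (\<lambda>t. \<Sum>i<m. indicator {u i<..<v i} t * (cmod (e t))\<^sup>2)"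
        by (intro Bochner_Integration.integrable_sum i2)
      show "integrable lborel (\<lambda>t. (cmod (e t))\<^sup>2)" by (rule sq_integrable_integrable[OF e])
      fix t
      have "(\<Sum>i<m. indicator {u i<..<v i} t * (cmod (e t))\<^sup>2) = indicator (\<Union>i<m. {u i<..<v i}) t * (cmod (e t))\<^sup>2"
        unfolding indicator_UN_disjoint[OF finite_lessThan dis] by (rule sum_distrib_right[symmetric])
      also have "\<dots> \<le> (cmod (e t))\<^sup>2" by (simp add: indicator_def)
      finally show "(\<Sum>i<m. indicator {u i<..<v i} t * (cmod (e t))\<^sup>2) \<le> (cmod (e t))\<^sup>2" .
    qed
    finally have sq: "(\<Sum>i<m. LINT t|lborel. indicator {u i<..<v i} t * (cmod (e t))\<^sup>2) \<le> A" .
    have "(\<Sum>i<m. dist (c (u i)) (c (v i)))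
        \<le> (\<Sum>i<m. (v i - u i) / k + k * (LINT t|lborel. indicator {u i<..<v i} t * (cmod (e t))\<^sup>2))"
      using uv by (intro sum_mono inc) auto
    also have "\<dots> = (\<Sum>i<m. v i - u i) / k + k * (\<Sum>i<m. LINT t|lborel. indicator {u i<..<v i} t * (cmod (e t))\<^sup>2)"
      by (simp add: sum.distrib sum_distrib_left sum_divide_distrib)
    also have "\<dots> < (k * r / 2) / k + k * (A + 1)"
      using len k sq by (intro add_less_le_mono divide_strict_right_mono mult_left_mono) auto
    also have "\<dots> = r"
    proof -
      have "A + 1 \<noteq> 0" using A0 by linarith
      then have "k * (A + 1) = r / 2" unfolding k_def by (simp add: divide_simps)
      moreover have "(k * r / 2) / k = r / 2" using k by simp
      ultimately show ?thesis by linarith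
    qed
    finally show "(\<Sum>i<m. dist (c (u i)) (c (v i))) < r" .
  qed
qed

text \<open>
  If \<open>x * hat \<phi>\<close> is square integrable, then \<open>hat \<phi>\<close> is integrable, so \<open>\<phi>\<close> extended by zero has the
  continuous version \<open>c s = fourier (hat \<phi>) (- s)\<close>. It vanishes off the interval, hence at both endpoints;
  and its increments are the integrals of the inverse transform of \<open>\<i> x * hat \<phi>\<close>.
\<close>

theorem first_moment_imp_dirichlet_derivative:
  assumes l: "0 < l" and \<phi>: "\<phi> \<in> L2 (seg l)"
    and xh: "(\<lambda>x. complex_of_real x * hat l \<phi> x) \<in> sq_integrable lborel"
  shows "\<exists>g. has_dirichlet_derivative l \<phi> g"
proof -
  let ?I = "seg l"
  define h where "h = hat l \<phi>"
  define f where "f = zero_ext l (rep \<phi>)"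
  have f: "f \<in> sq_integrable lborel" "integrable lborel f" unfolding f_def using rep_zero_ext[OF \<phi>] by auto
  have h_f: "h = fourier f" unfolding h_def hat_def f_def ..
  have h: "integrable lborel h"
    unfolding h_def by (rule integrable_of_first_moment[OF hat_sq_integrable[OF \<phi>] xh])
  obtain \<eta> where \<eta>: "\<eta> \<in> L2 lborel" "fourier_plancherel \<eta> = cls lborel (\<lambda>x. complex_of_real x * h x)"
  proof -
    have "cls lborel (\<lambda>x. complex_of_real x * h x) \<in> fourier_plancherel ` L2 lborel"
      using Plancherel(1) cls_in_L2[OF xh] unfolding unitary_L2_def bij_betw_def h_def by simp
    then show ?thesis using that by auto
  qed
  define e where "e = rep \<eta>"
  have e: "e \<in> sq_integrable lborel" unfolding e_def by (rule rep_sq_integrable[OF \<eta>(1)])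
  have Fe: "fourier_plancherel (cls lborel e) = cls lborel (\<lambda>x. complex_of_real x * h x)"
    unfolding e_def cls_rep[OF \<eta>(1)] by (rule \<eta>(2))
  define c where "c s = fourier h (- s)" for s
  have c_cont: "continuous_on UNIV c"
    unfolding c_def[abs_def]
    by (rule continuous_on_compose2[OF continuous_fourier[OF h]]) (auto intro!: continuous_intros)
  have c_meas [measurable]: "c \<in> borel_measurable borel" by (rule borel_measurable_continuous_onI[OF c_cont])
  have inc: "c b - c a = \<i> * (LINT t|lborel. indicator {a..b} t * e t)" if "a \<le> b" for a b
    using interval_integral_of_moment[OF h e Fe _ that] xh unfolding c_def h_def
    by (simp add: mult.assoc[symmetric] right_diff_distrib)
  have cf: "AE t in lborel. f t = c t"
  proof (rule AE_eq_of_interval_integrals)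
    show "integrable lborel (\<lambda>t. indicator {a..b} t * f t)" for a b by (rule integrable_sq_integrable_interval[OF f(1)])
    show "integrable lborel (\<lambda>t. indicator {a..b} t * c t)" for a b
    proof (rule integrable_bounded_mult[OF indicator_sq_integrable(2)])
      show "c \<in> borel_measurable lborel" using c_meas by simp
      show "cmod (c t) \<le> 1 / sqrt (2 * pi) * (LINT x|lborel. cmod (h x))" for t
        unfolding c_def by (rule fourier_bound[OF h])
    qed
    show "(LINT t|lborel. indicator {a..b} t * f t) = (LINT t|lborel. indicator {a..b} t * c t)" for a b
      using interval_integral_inversion[OF f(2,1), of a b] h unfolding c_def h_f by simp
  qed
  have zero: "AE t in lborel. t \<notin> {0..l} \<longrightarrow> c t = 0"
    using cf by eventually_elim (auto simp: f_def zero_ext_def)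
  have c0: "c 0 = 0"
    by (rule continuous_AE_zero_imp_zero[OF c_cont, of "{..<0}"]) (use zero in \<open>auto elim: AE_mp simp: closure_lessThan\<close>)
  have cl: "c l = 0"
    by (rule continuous_AE_zero_imp_zero[OF c_cont, of "{l<..}"]) (use zero in \<open>auto elim: AE_mp simp: closure_greaterThan\<close>)
  have rc: "AE t in ?I. rep \<phi> t = c t"
    unfolding interval_AE_iff using cf by eventually_elim (auto simp: f_def zero_ext_def)
  have c_I: "c \<in> borel_measurable ?I"
    unfolding interval_measurable_iff zero_ext_def[abs_def] by measurable
  have c_sq: "c \<in> sq_integrable ?I"
    by (rule sq_integrable_cong_AE[OF rep_sq_integrable[OF \<phi>] c_I rc])
  have "c \<in> cls ?I (rep \<phi>)" unfolding in_cls_iff using rep_sq_integrable[OF \<phi>] c_sq rc by simp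
  then have c_in: "c \<in> \<phi>" unfolding cls_rep[OF \<phi>] .
  have ac: "abs_continuous_on {0..l} c"
    by (rule abs_continuous_on_of_sq_integrable[OF e]) (simp add: inc norm_mult)
  have "((\<lambda>t. \<i> * e t) has_integral (c b - c a)) {a..b}" if "a \<le> b" for a b
    unfolding inc[OF that]
    by (intro has_integral_mult_right interval_integral_has_integral integrable_sq_integrable_interval e)
  then obtain N where N: "negligible N" "\<And>t. t \<notin> N \<Longrightarrow> (c has_vector_derivative \<i> * e t) (at t)"
    using Lebesgue_differentiation[of "\<lambda>t. \<i> * e t" c] by blast
  have "AE t in lebesgue. t \<notin> N"
    using N(1) by (intro AE_not_in) (simp add: negligible_iff_null_sets)
  then have "AE t in lborel. t \<notin> N" by (simp only: AE_completion_iff)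
  then have der: "AE t in ?I. (c has_vector_derivative \<i> * e t) (at t within {0..l})"
    unfolding interval_AE_iff by eventually_elim (auto intro: has_vector_derivative_at_within N(2))
  have "has_dirichlet_derivative l \<phi> (\<lambda>t. \<i> * e t)"
    unfolding has_dirichlet_derivative_def
    using \<phi> restrict_sq_integrable[OF sq_integrable_cmult[OF e]] c_in ac c0 cl der by blast
  then show ?thesis by blast
qed

lemma P0_defined_iff:
  assumes l: "0 < l" and \<phi>: "\<phi> \<in> L2 (seg l)"
  shows "P0 l \<phi> \<noteq> None \<longleftrightarrow> (\<lambda>x. complex_of_real x * hat l \<phi> x) \<in> sq_integrable lborel"
proof
  assume "P0 l \<phi> \<noteq> None"
  then obtain \<eta> where \<eta>: "P0 l \<phi> = Some \<eta>" by auto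
  have "(\<lambda>x. complex_of_real x * hat l \<phi> x) = hat l \<eta>" by (rule ext) (rule P0_dom_imp(3)[OF l \<eta>, symmetric])
  then show "(\<lambda>x. complex_of_real x * hat l \<phi> x) \<in> sq_integrable lborel"
    using hat_sq_integrable[OF P0_dom_imp(2)[OF l \<eta>]] by simp
next
  assume "(\<lambda>x. complex_of_real x * hat l \<phi> x) \<in> sq_integrable lborel"
  then obtain g where "has_dirichlet_derivative l \<phi> g" using first_moment_imp_dirichlet_derivative[OF l \<phi>] by blast
  then show "P0 l \<phi> \<noteq> None" unfolding P0_def by auto
qed

section \<open>The moment operators\<close>

lemma power_le_Suc_power: "\<bar>x::real\<bar> ^ n \<le> 1 + \<bar>x\<bar> ^ Suc n"
proof (cases "\<bar>x\<bar> \<le> 1")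
  case True
  then have "\<bar>x\<bar> ^ n \<le> 1" by (intro power_le_one) auto
  then show ?thesis by (simp add: add_increasing2)
next
  case False
  then have "\<bar>x\<bar> ^ n \<le> \<bar>x\<bar> ^ Suc n" by (intro power_increasing) auto
  then show ?thesis by simp
qed

lemma lower_moment_sq_integrable:
  assumes h: "h \<in> sq_integrable lborel" and m: "(\<lambda>x. complex_of_real (x ^ Suc n) * h x) \<in> sq_integrable lborel"
  shows "(\<lambda>x. complex_of_real (x ^ n) * h x) \<in> sq_integrable lborel"
proof -
  have [measurable]: "h \<in> borel_measurable borel" using sq_integrable_measurable[OF h] by simp
  have "(\<lambda>x. complex_of_real (cmod (h x)) + complex_of_real (cmod (complex_of_real (x ^ Suc n) * h x))) \<in> sq_integrable lborel"
    using h m by (intro sq_integrable_add) (auto simp: sq_integrable_def)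
  then show ?thesis
  proof (rule sq_integrable_bound)
    fix x
    have "cmod (complex_of_real (x ^ n) * h x) = \<bar>x\<bar> ^ n * cmod (h x)" by (simp add: norm_mult norm_power)
    also have "\<dots> \<le> (1 + \<bar>x\<bar> ^ Suc n) * cmod (h x)" by (intro mult_right_mono power_le_Suc_power) simp
    also have "\<dots> = cmod (h x) + cmod (complex_of_real (x ^ Suc n) * h x)"
      by (simp add: norm_mult norm_power distrib_right)
    also have "\<dots> = cmod (complex_of_real (cmod (h x)) + complex_of_real (cmod (complex_of_real (x ^ Suc n) * h x)))"
      unfolding of_real_add[symmetric] norm_of_real by simp
    finally show "cmod (complex_of_real (x ^ n) * h x) \<le> cmod (complex_of_real (cmod (h x)) + complex_of_real (cmod (complex_of_real (x ^ Suc n) * h x)))" .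
  qed measurable
qed

lemma lower_moment_integrable:
  assumes h: "integrable lborel h" and m: "integrable lborel (\<lambda>x. complex_of_real (x ^ Suc n) * h x)"
  shows "integrable lborel (\<lambda>x. complex_of_real (x ^ n) * h x)"
proof (rule Bochner_Integration.integrable_bound[OF Bochner_Integration.integrable_add[OF integrable_norm[OF h] integrable_norm[OF m]]])
  have [measurable]: "h \<in> borel_measurable borel" using h by auto
  show "(\<lambda>x. complex_of_real (x ^ n) * h x) \<in> borel_measurable lborel" by measurable
  show "AE x in lborel. norm (complex_of_real (x ^ n) * h x) \<le> norm (norm (h x) + norm (complex_of_real (x ^ Suc n) * h x))"
  proof (intro AE_I2)
    fix x
    have "cmod (complex_of_real (x ^ n) * h x) = \<bar>x\<bar> ^ n * cmod (h x)" by (simp add: norm_mult norm_power)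
    also have "\<dots> \<le> (1 + \<bar>x\<bar> ^ Suc n) * cmod (h x)" by (intro mult_right_mono power_le_Suc_power) simp
    also have "\<dots> = cmod (h x) + cmod (complex_of_real (x ^ Suc n) * h x)"
      by (simp add: norm_mult norm_power distrib_right)
    also have "\<dots> = norm (norm (h x) + norm (complex_of_real (x ^ Suc n) * h x))" by simp
    finally show "norm (complex_of_real (x ^ n) * h x) \<le> norm (norm (h x) + norm (complex_of_real (x ^ Suc n) * h x))" .
  qed
qed

text \<open>
  Each application of \<open>P\<^sub>0\<close> multiplies the transform by \<open>x\<close>. The lower moments are
  controlled by the highest one, so the conditions for the intermediate powers follow from the last.
\<close>

theorem op_power_P0:
  assumes l: "0 < l"
  shows "op_power (seg l) (P0 l) n \<phi> \<noteq> None \<longleftrightarrow>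
           \<phi> \<in> L2 (seg l) \<and> (\<lambda>x. complex_of_real (x ^ n) * hat l \<phi> x) \<in> sq_integrable lborel"
    and "op_power (seg l) (P0 l) n \<phi> = Some \<eta> \<Longrightarrow>
           \<eta> \<in> L2 (seg l) \<and> hat l \<eta> = (\<lambda>x. complex_of_real (x ^ n) * hat l \<phi> x)"
proof -
  let ?I = "seg l" and ?m = "\<lambda>n x. complex_of_real (x ^ n) * hat l \<phi> x"
  have step: "op_power ?I (P0 l) (Suc n) \<phi> = (case op_power ?I (P0 l) n \<phi> of None \<Rightarrow> None | Some \<eta> \<Rightarrow> P0 l \<eta>)" for n
    by (simp add: op_power_def map_comp_def)
  have "(op_power ?I (P0 l) n \<phi> \<noteq> None \<longleftrightarrow> \<phi> \<in> L2 ?I \<and> ?m n \<in> sq_integrable lborel) \<and>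
    (\<forall>\<eta>. op_power ?I (P0 l) n \<phi> = Some \<eta> \<longrightarrow> \<eta> \<in> L2 ?I \<and> hat l \<eta> = ?m n)"
  proof (induction n)
    case 0
    have "op_power ?I (P0 l) 0 \<phi> = (if \<phi> \<in> L2 ?I then Some \<phi> else None)"
      by (simp add: op_power_def restrict_map_def)
    then show ?case using hat_sq_integrable[of \<phi> l] by auto
  next
    case (Suc n)
    show ?case
    proof (cases "op_power ?I (P0 l) n \<phi>")
      case None
      then have "\<not> (\<phi> \<in> L2 ?I \<and> ?m n \<in> sq_integrable lborel)" using Suc by simp
      then have "\<not> (\<phi> \<in> L2 ?I \<and> ?m (Suc n) \<in> sq_integrable lborel)"
        using lower_moment_sq_integrable[OF hat_sq_integrable] by blast
      then show ?thesis using None by (simp only: step option.case simp_thms option.distinct)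
    next
      case (Some \<zeta>)
      then have z: "\<zeta> \<in> L2 ?I" "hat l \<zeta> = ?m n" and \<phi>: "\<phi> \<in> L2 ?I" using Suc by auto
      have m: "(\<lambda>x. complex_of_real x * hat l \<zeta> x) = ?m (Suc n)" unfolding z(2) by (simp add: mult.assoc)
      have s: "op_power ?I (P0 l) (Suc n) \<phi> = P0 l \<zeta>" unfolding step Some by simp
      have "P0 l \<zeta> \<noteq> None \<longleftrightarrow> \<phi> \<in> L2 ?I \<and> ?m (Suc n) \<in> sq_integrable lborel"
        using P0_defined_iff[OF l z(1)] \<phi> unfolding m by simp
      moreover have "\<eta> \<in> L2 ?I \<and> hat l \<eta> = ?m (Suc n)" if "P0 l \<zeta> = Some \<eta>" for \<eta>
      proof
        show "\<eta> \<in> L2 ?I" by (rule P0_dom_imp(2)[OF l that])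
        show "hat l \<eta> = ?m (Suc n)" unfolding m[symmetric] by (rule ext) (rule P0_dom_imp(3)[OF l that])
      qed
      ultimately show ?thesis unfolding s by blast
    qed
  qed
  then show "op_power ?I (P0 l) n \<phi> \<noteq> None \<longleftrightarrow> \<phi> \<in> L2 ?I \<and> ?m n \<in> sq_integrable lborel"
    and "op_power ?I (P0 l) n \<phi> = Some \<eta> \<Longrightarrow> \<eta> \<in> L2 ?I \<and> hat l \<eta> = ?m n" by blast+
qed

lemma moment_integrable:
  assumes \<psi>: "\<psi> \<in> L2 (seg l)"
    and m: "(\<lambda>x. complex_of_real (x ^ n) * hat l \<phi> x) \<in> sq_integrable lborel"
  shows "integrable lborel (\<lambda>x. complex_of_real (x ^ n) * (cnj (hat l \<psi> x) * hat l \<phi> x))"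
  using integrable_cnj_mult[OF hat_sq_integrable[OF \<psi>] m] by (simp only: mult.left_commute)

text \<open>The case of the first moment applies to \<open>P\<^sub>0\<^sup>n \<phi>\<close> and gives the case \<open>n + 1\<close>.\<close>

lemma weak_moment_imp_strong:
  assumes l: "0 < l" and \<phi>: "\<phi> \<in> L2 (seg l)"
    and weak: "\<And>\<psi>. \<psi> \<in> L2 (seg l) \<Longrightarrow>
      integrable lborel (\<lambda>x. complex_of_real (x ^ n) * (cnj (hat l \<psi> x) * hat l \<phi> x))"
  shows "(\<lambda>x. complex_of_real (x ^ n) * hat l \<phi> x) \<in> sq_integrable lborel"
  using weak
proof (induction n)
  case 0
  then show ?case using hat_sq_integrable[OF \<phi>] by simp
next
  case (Suc n)
  have "integrable lborel (\<lambda>x. complex_of_real (x ^ n) * (cnj (hat l \<psi> x) * hat l \<phi> x))"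
    if "\<psi> \<in> L2 (seg l)" for \<psi>
    by (rule lower_moment_integrable[OF integrable_cnj_mult[OF hat_sq_integrable[OF that] hat_sq_integrable[OF \<phi>]]
          Suc.prems[OF that]])
  then have m: "(\<lambda>x. complex_of_real (x ^ n) * hat l \<phi> x) \<in> sq_integrable lborel" by (rule Suc.IH)
  then obtain \<eta> where "op_power (seg l) (P0 l) n \<phi> = Some \<eta>"
    using op_power_P0(1)[OF l, of n \<phi>] \<phi> by auto
  then have \<eta>: "\<eta> \<in> L2 (seg l)" "hat l \<eta> = (\<lambda>x. complex_of_real (x ^ n) * hat l \<phi> x)"
    using op_power_P0(2)[OF l] by auto
  have eq: "complex_of_real x * hat l \<eta> x = complex_of_real (x ^ Suc n) * hat l \<phi> x" for x
    unfolding \<eta>(2) by (simp add: mult.assoc)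
  have "(\<lambda>x. complex_of_real x * hat l \<eta> x) \<in> sq_integrable lborel"
  proof (rule weak_first_moment_imp_strong[OF \<eta>(1)])
    fix \<psi> assume \<psi>: "\<psi> \<in> L2 (seg l)"
    have "complex_of_real x * (cnj (hat l \<psi> x) * hat l \<eta> x) = complex_of_real (x ^ Suc n) * (cnj (hat l \<psi> x) * hat l \<phi> x)" for x
      using eq[of x] by (simp only: mult.left_commute[of "complex_of_real x"] mult.left_commute[of "complex_of_real (x ^ Suc n)"])
    then show "integrable lborel (\<lambda>x. complex_of_real x * (cnj (hat l \<psi> x) * hat l \<eta> x))"
      using Suc.prems[OF \<psi>] by (simp only:)
  qed
  then show ?case unfolding eq .
qed

lemma moment_vector_eq:
  assumes l: "0 < l" and \<phi>: "\<phi> \<in> L2 (seg l)"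
    and \<eta>: "op_power (seg l) (P0 l) n \<phi> = Some \<eta>"
  shows "moment_vector (seg l) (momentum_povm l) n \<phi> = \<eta>"
proof -
  let ?I = "seg l"
  have m: "(\<lambda>x. complex_of_real (x ^ n) * hat l \<phi> x) \<in> sq_integrable lborel"
    using op_power_P0(1)[OF l, of n \<phi>] \<eta> by simp
  have h: "\<eta> \<in> L2 ?I" "hat l \<eta> = (\<lambda>x. complex_of_real (x ^ n) * hat l \<phi> x)"
    using op_power_P0(2)[OF l \<eta>] by auto
  have eq: "inner_L2 ?I \<psi> \<eta> = complex_measure_integral (matrix_measure ?I (momentum_povm l) \<psi> \<phi>) (\<lambda>x. x ^ n)"
    if \<psi>: "\<psi> \<in> L2 ?I" for \<psi>
    unfolding moment_integral[OF \<psi> \<phi> moment_integrable[OF \<psi> m]] hat_Parseval[OF \<psi> h(1), symmetric] h(2) l2ip_def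
    by (simp only: mult.left_commute)
  show ?thesis
    unfolding moment_vector_def
  proof (rule the_equality)
    fix \<eta>' assume "\<eta>' \<in> L2 ?I \<and> (\<forall>\<psi>\<in>L2 ?I. inner_L2 ?I \<psi> \<eta>' =
      complex_measure_integral (matrix_measure ?I (momentum_povm l) \<psi> \<phi>) (\<lambda>x. x ^ n))"
    then show "\<eta>' = \<eta>" using h(1) eq by (intro L2_eqI) auto
  qed (use h(1) eq in auto)
qed

theorem proposition18:
  fixes l :: real and n :: nat
  assumes "0 < l" and "1 \<le> n"
  shows "moment_op (interval_measure_space l) (momentum_povm l) n
           = moment_op_tilde (interval_measure_space l) (momentum_povm l) n
       \<and> moment_op_tilde (interval_measure_space l) (momentum_povm l) n
           = op_power (interval_measure_space l) (P0 l) n"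
proof -
  let ?I = "seg l" and ?E = "momentum_povm l"
  have dom: "(\<forall>\<psi>\<in>L2 ?I. (\<integral>\<^sup>+ x. ennreal (\<bar>x\<bar> ^ n) \<partial>total_variation (matrix_measure ?I ?E \<psi> \<phi>)) < \<infinity>)
      \<longleftrightarrow> (\<lambda>x. complex_of_real (x ^ n) * hat l \<phi> x) \<in> sq_integrable lborel" if \<phi>: "\<phi> \<in> L2 ?I" for \<phi>
  proof
    assume fin: "\<forall>\<psi>\<in>L2 ?I. (\<integral>\<^sup>+ x. ennreal (\<bar>x\<bar> ^ n) \<partial>total_variation (matrix_measure ?I ?E \<psi> \<phi>)) < \<infinity>"
    show "(\<lambda>x. complex_of_real (x ^ n) * hat l \<phi> x) \<in> sq_integrable lborel"
    proof (rule weak_moment_imp_strong[OF assms(1) \<phi>])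
      fix \<psi> assume "\<psi> \<in> L2 ?I"
      with fin show "integrable lborel (\<lambda>x. complex_of_real (x ^ n) * (cnj (hat l \<psi> x) * hat l \<phi> x))"
        using moment_condition_iff[OF _ \<phi>] by blast
    qed
  next
    assume m: "(\<lambda>x. complex_of_real (x ^ n) * hat l \<phi> x) \<in> sq_integrable lborel"
    show "\<forall>\<psi>\<in>L2 ?I. (\<integral>\<^sup>+ x. ennreal (\<bar>x\<bar> ^ n) \<partial>total_variation (matrix_measure ?I ?E \<psi> \<phi>)) < \<infinity>"
      using moment_condition_iff[OF _ \<phi>] moment_integrable[OF _ m] by blast
  qed
  have tilde: "moment_op_tilde ?I ?E n \<phi> = op_power ?I (P0 l) n \<phi>" for \<phi>
  proof (cases "op_power ?I (P0 l) n \<phi>")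
    case None
    then have "\<not> (\<phi> \<in> L2 ?I \<and> (\<lambda>x. complex_of_real (x ^ n) * hat l \<phi> x) \<in> sq_integrable lborel)"
      using op_power_P0(1)[OF assms(1), of n \<phi>] by simp
    then show ?thesis unfolding None moment_op_tilde_def using moment_condition_tilde_iff[of \<phi> l n] by auto
  next
    case (Some \<eta>)
    then have \<phi>: "\<phi> \<in> L2 ?I" and "(\<lambda>x. complex_of_real (x ^ n) * hat l \<phi> x) \<in> sq_integrable lborel"
      using op_power_P0(1)[OF assms(1), of n \<phi>] by auto
    then show ?thesis
      unfolding Some moment_op_tilde_def moment_vector_eq[OF assms(1) \<phi> Some]
      using moment_condition_tilde_iff[OF \<phi>, of n] by simp
  qed
  have "moment_op ?I ?E n \<phi> = moment_op_tilde ?I ?E n \<phi>" for \<phi>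
  proof (cases "\<phi> \<in> L2 ?I")
    case True
    show ?thesis unfolding moment_op_def moment_op_tilde_def dom[OF True] moment_condition_tilde_iff[OF True]
      using True by (simp only: dom[OF True] moment_condition_tilde_iff[OF True] simp_thms)
  next
    case False
    then show ?thesis by (simp add: moment_op_def moment_op_tilde_def)
  qed
  with tilde show ?thesis by (auto simp: fun_eq_iff)
qed

end
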